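(* Let $F$ be a finite field of characteristic $p>3$ containing $q=p^k$ elements and let $G=C_n\times D_{12}$, where $n=p^rs$, $r\ge 0$, and $(p,s)=1$. Put $d_l=\mathrm{ord}_l(q)$ and $e_l=\phi(l)/d_l$. If $V=1+J(FG)$, then $$U(FG)/V\cong C_{q-1}^4\times GL(2,F)^2\times\Big(\prod_{l>1,\ l\mid s}\big(C_{q^{d_l}-1}^4\times GL(2,F_{d_l})^2\big)^{e_l}\Big),$$ and $V$ is a group of exponent $p^r$ and order $p^{12sk(p^r-1)}$.
   Context: $C_m$ denotes the cyclic group of order $m$, and powers of groups denote direct powers. $D_{12}$ is the dihedral group of order 12, $D_{12}=\langle x,y\mid x^6=y^2=1,\ yx=x^5y\rangle$. $FG$ is the group algebra of $G$ over $F$, $U(FG)$ is its group of units and $J(FG)$ its Jacobson radical. $F_d$ denotes the extension field of $F$ of degree $d$, and $GL(2,F)$ is the general linear group of degree $2$ over $F$. For coprime integers $a$ and $m$, $\mathrm{ord}_m(a)$ is the multiplicative order of $a$ modulo $m$; $\phi$ is Euler's totient function. The product runs over all divisors $l>1$ of $s$. *)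

theory Defs
  imports "HOL-Algebra.Algebra" "HOL-Number_Theory.Number_Theory"
begin

section \<open>Groups\<close>

abbreviation group_power :: "('a, 'm) monoid_scheme \<Rightarrow> nat \<Rightarrow> (nat \<Rightarrow> 'a) monoid" where
  "group_power G m \<equiv> product_group {..<m} (\<lambda>_. G)"

definition has_exponent :: "('a, 'm) monoid_scheme \<Rightarrow> nat \<Rightarrow> bool" where
  "has_exponent G m \<longleftrightarrow>
     0 < m \<and> (\<forall>x\<in>carrier G. x [^]\<^bsub>G\<^esub> m = \<one>\<^bsub>G\<^esub>) \<and>
     (\<forall>m'. 0 < m' \<and> (\<forall>x\<in>carrier G. x [^]\<^bsub>G\<^esub> m' = \<one>\<^bsub>G\<^esub>) \<longrightarrow> m \<le> m')"

text \<open>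
  The dihedral group of order \<open>2 * m\<close> in normal form: \<open>(i, c)\<close> stands for \<open>x\<^sup>i\<close> if \<open>c\<close> is
  \<open>False\<close> and for \<open>x\<^sup>i y\<close> if \<open>c\<close> is \<open>True\<close>, so that \<open>y x = x\<^sup>-\<^sup>1 y\<close>.  The lemmas below show that
  it is the group presented by \<open>x\<^sup>m = y\<^sup>2 = 1\<close> and \<open>y x = x\<^sup>m\<^sup>-\<^sup>1 y\<close>.
\<close>

definition dihedral_group :: "nat \<Rightarrow> (int \<times> bool) monoid" where
  "dihedral_group m =
     \<lparr>carrier = {0..<int m} \<times> UNIV,
      monoid.mult = (\<lambda>(i, b) (j, c). ((if b then i - j else i + j) mod int m, b \<noteq> c)),
      one = (0, False)\<rparr>"

lemma dihedral_group_is_group: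
  assumes "0 < m" shows "group (dihedral_group m)"
proof (rule groupI)
  fix u assume "u \<in> carrier (dihedral_group m)"
  then obtain i b where u: "u = (i, b)" "0 \<le> i" "i < int m"
    by (auto simp: dihedral_group_def)
  define v where "v = (if b then i else (- i) mod int m, b)"
  have "v \<in> carrier (dihedral_group m)" "v \<otimes>\<^bsub>dihedral_group m\<^esub> u = \<one>\<^bsub>dihedral_group m\<^esub>"
    using u assms by (auto simp: v_def dihedral_group_def mod_add_left_eq)
  then show "\<exists>v\<in>carrier (dihedral_group m). v \<otimes>\<^bsub>dihedral_group m\<^esub> u = \<one>\<^bsub>dihedral_group m\<^esub>"
    by blast
qed (use assms in \<open>auto simp: dihedral_group_def mod_simps algebra_simps\<close>)

lemma order_dihedral_group: "order (dihedral_group m) = 2 * m"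
  by (simp add: order_def dihedral_group_def card_cartesian_product UNIV_bool)

lemma dihedral_group_pow_x:
  assumes "1 < m"
  shows "(1, False) [^]\<^bsub>dihedral_group m\<^esub> (i::nat) = (int i mod int m, False)"
proof (induction i)
  case (Suc i)
  then show ?case
    by (simp add: nat_pow_def dihedral_group_def mod_simps algebra_simps)
qed (simp add: nat_pow_def dihedral_group_def)

lemma dihedral_group_relations:
  assumes "1 < m"
  defines "D \<equiv> dihedral_group m" and "x \<equiv> (1, False)" and "y \<equiv> (0, True)"
  shows "x \<in> carrier D" "y \<in> carrier D"
    "x [^]\<^bsub>D\<^esub> m = \<one>\<^bsub>D\<^esub>" "y [^]\<^bsub>D\<^esub> (2::nat) = \<one>\<^bsub>D\<^esub>"
    "y \<otimes>\<^bsub>D\<^esub> x = x [^]\<^bsub>D\<^esub> (m - 1) \<otimes>\<^bsub>D\<^esub> y"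
proof -
  interpret group D using assms dihedral_group_is_group by simp
  show "x \<in> carrier D" "y \<in> carrier D"
    using assms(1) by (auto simp: D_def x_def y_def dihedral_group_def)
  then show "y [^]\<^bsub>D\<^esub> (2::nat) = \<one>\<^bsub>D\<^esub>"
    by (simp add: numeral_2_eq_2) (simp add: D_def y_def dihedral_group_def)
  show "x [^]\<^bsub>D\<^esub> m = \<one>\<^bsub>D\<^esub>"
    unfolding D_def x_def dihedral_group_pow_x[OF assms(1)] by (simp add: dihedral_group_def)
  have "int (m - 1) mod int m = (- 1) mod int m"
    using assms(1) by (simp add: of_nat_diff zmod_minus1)
  then show "y \<otimes>\<^bsub>D\<^esub> x = x [^]\<^bsub>D\<^esub> (m - 1) \<otimes>\<^bsub>D\<^esub> y"
    unfolding D_def x_def y_def dihedral_group_pow_x[OF assms(1)]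
    by (simp add: dihedral_group_def)
qed

lemma dihedral_group_normal_form:
  assumes "1 < m" "(i, c) \<in> carrier (dihedral_group m)"
  shows "(i, c) = (1, False) [^]\<^bsub>dihedral_group m\<^esub> nat i \<otimes>\<^bsub>dihedral_group m\<^esub>
                  (if c then (0, True) else \<one>\<^bsub>dihedral_group m\<^esub>)"
  unfolding dihedral_group_pow_x[OF assms(1)] using assms(2) by (auto simp: dihedral_group_def)

text \<open>By the preceding lemma a homomorphism is determined by the images of \<open>x\<close> and \<open>y\<close>.\<close>

lemma dihedral_group_universal:
  assumes "1 < m" "group H" "a \<in> carrier H" "b \<in> carrier H"
    and am: "a [^]\<^bsub>H\<^esub> m = \<one>\<^bsub>H\<^esub>" and b2: "b [^]\<^bsub>H\<^esub> (2::nat) = \<one>\<^bsub>H\<^esub>"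
    and ba: "b \<otimes>\<^bsub>H\<^esub> a = a [^]\<^bsub>H\<^esub> (m - 1) \<otimes>\<^bsub>H\<^esub> b"
  shows "\<exists>h\<in>hom (dihedral_group m) H. h (1, False) = a \<and> h (0, True) = b"
proof -
  interpret group H by fact
  note [simp] = assms(3,4)
  define h where "h = (\<lambda>(i::int, c). a [^]\<^bsub>H\<^esub> i \<otimes>\<^bsub>H\<^esub> (if c then b else \<one>\<^bsub>H\<^esub>))"
  have am': "a [^]\<^bsub>H\<^esub> int m = \<one>\<^bsub>H\<^esub>" using am by (simp add: int_pow_int)
  have pmod: "a [^]\<^bsub>H\<^esub> (i mod int m) = a [^]\<^bsub>H\<^esub> i" for i
  proof -
    have "a [^]\<^bsub>H\<^esub> i = a [^]\<^bsub>H\<^esub> (int m * (i div int m) + i mod int m)" by simp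
    also have "\<dots> = (a [^]\<^bsub>H\<^esub> int m) [^]\<^bsub>H\<^esub> (i div int m) \<otimes>\<^bsub>H\<^esub> a [^]\<^bsub>H\<^esub> (i mod int m)"
      by (simp only: int_pow_mult[OF assms(3)] int_pow_pow[OF assms(3)])
    finally show ?thesis using am' by simp
  qed
  have bb: "b \<otimes>\<^bsub>H\<^esub> b = \<one>\<^bsub>H\<^esub>" using b2 by (simp add: numeral_2_eq_2)
  have "a [^]\<^bsub>H\<^esub> (m - 1) = a [^]\<^bsub>H\<^esub> (int m - 1)"
    using assms(1) by (simp add: int_pow_int[symmetric] of_nat_diff)
  also have "\<dots> = inv\<^bsub>H\<^esub> a"
    using int_pow_diff[OF assms(3), of "int m" 1] am' by simp
  finally have ba': "b \<otimes>\<^bsub>H\<^esub> a = inv\<^bsub>H\<^esub> a \<otimes>\<^bsub>H\<^esub> b" using ba by simp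
  have bpn: "b \<otimes>\<^bsub>H\<^esub> a [^]\<^bsub>H\<^esub> (j::nat) = inv\<^bsub>H\<^esub> a [^]\<^bsub>H\<^esub> j \<otimes>\<^bsub>H\<^esub> b" for j
  proof (induction j)
    case (Suc j)
    have "b \<otimes>\<^bsub>H\<^esub> a [^]\<^bsub>H\<^esub> Suc j = (b \<otimes>\<^bsub>H\<^esub> a [^]\<^bsub>H\<^esub> j) \<otimes>\<^bsub>H\<^esub> a" by (simp add: m_assoc)
    also have "\<dots> = inv\<^bsub>H\<^esub> a [^]\<^bsub>H\<^esub> j \<otimes>\<^bsub>H\<^esub> (b \<otimes>\<^bsub>H\<^esub> a)" by (simp add: Suc m_assoc)
    also have "\<dots> = inv\<^bsub>H\<^esub> a [^]\<^bsub>H\<^esub> Suc j \<otimes>\<^bsub>H\<^esub> b" by (simp add: ba' m_assoc)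
    finally show ?case .
  qed simp
  have bp: "b \<otimes>\<^bsub>H\<^esub> a [^]\<^bsub>H\<^esub> j = a [^]\<^bsub>H\<^esub> (- j) \<otimes>\<^bsub>H\<^esub> b" if "0 \<le> j" for j :: int
    using bpn[of "nat j"] that
    by (simp add: int_pow_int[symmetric] int_pow_neg int_pow_inv)
  have "h \<in> hom (dihedral_group m) H"
  proof (rule homI)
    fix u v assume "u \<in> carrier (dihedral_group m)" "v \<in> carrier (dihedral_group m)"
    then obtain i c j d where uv: "u = (i, c)" "v = (j, d)" "0 \<le> j"
      by (auto simp: dihedral_group_def)
    define B where "B = (\<lambda>e. if e then b else \<one>\<^bsub>H\<^esub>)"
    have Bc: "B e \<in> carrier H" for e by (simp add: B_def)
    have BB: "B c \<otimes>\<^bsub>H\<^esub> B d = B (c \<noteq> d)" by (auto simp: B_def bb)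
    have mv: "B c \<otimes>\<^bsub>H\<^esub> a [^]\<^bsub>H\<^esub> j = a [^]\<^bsub>H\<^esub> (if c then - j else j) \<otimes>\<^bsub>H\<^esub> B c"
      using uv(3) by (simp add: B_def bp)
    have "h u \<otimes>\<^bsub>H\<^esub> h v = a [^]\<^bsub>H\<^esub> i \<otimes>\<^bsub>H\<^esub> (B c \<otimes>\<^bsub>H\<^esub> a [^]\<^bsub>H\<^esub> j) \<otimes>\<^bsub>H\<^esub> B d"
      using Bc by (simp add: uv h_def B_def m_assoc)
    also have "\<dots> = a [^]\<^bsub>H\<^esub> i \<otimes>\<^bsub>H\<^esub> a [^]\<^bsub>H\<^esub> (if c then - j else j) \<otimes>\<^bsub>H\<^esub> (B c \<otimes>\<^bsub>H\<^esub> B d)"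
      unfolding mv using Bc by (simp add: m_assoc)
    also have "\<dots> = a [^]\<^bsub>H\<^esub> (i + (if c then - j else j)) \<otimes>\<^bsub>H\<^esub> B (c \<noteq> d)"
      unfolding BB by (simp only: int_pow_mult[OF assms(3)])
    also have "\<dots> = h (u \<otimes>\<^bsub>dihedral_group m\<^esub> v)"
      by (auto simp: uv h_def B_def dihedral_group_def pmod)
    finally show "h (u \<otimes>\<^bsub>dihedral_group m\<^esub> v) = h u \<otimes>\<^bsub>H\<^esub> h v" ..
  qed (auto simp: h_def)
  moreover have "h (1, False) = a" "h (0, True) = b" by (auto simp: h_def)
  ultimately show ?thesis by blast
qed


section \<open>Rings\<close>

definition ring_characteristic :: "('a, 'm) ring_scheme \<Rightarrow> nat" where
  "ring_characteristic R = group.ord (add_monoid R) \<one>\<^bsub>R\<^esub>"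

definition extension_of_degree ::
    "('a, 'm) ring_scheme \<Rightarrow> nat \<Rightarrow> ('b, 'n) ring_scheme \<Rightarrow> bool" where
  "extension_of_degree F d K \<longleftrightarrow>
     field K \<and> (\<exists>h\<in>ring_hom F K. ring.dimension K d (h ` carrier F) (carrier K))"

text \<open>Finitely supported functions \<open>G \<rightarrow> F\<close> under convolution; \<open>f\<close> stands for the formal sum of
  the \<open>f x \<cdot> x\<close>.\<close>

definition group_algebra ::
    "('a, 'm) ring_scheme \<Rightarrow> ('g, 'n) monoid_scheme \<Rightarrow> ('g \<Rightarrow> 'a) ring" where
  "group_algebra F G =
     \<lparr>carrier = {f \<in> carrier G \<rightarrow>\<^sub>E carrier F. finite {x \<in> carrier G. f x \<noteq> \<zero>\<^bsub>F\<^esub>}},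
      monoid.mult = (\<lambda>f g. \<lambda>x\<in>carrier G.
        \<Oplus>\<^bsub>F\<^esub>y\<in>{y \<in> carrier G. f y \<noteq> \<zero>\<^bsub>F\<^esub>}. f y \<otimes>\<^bsub>F\<^esub> g (inv\<^bsub>G\<^esub> y \<otimes>\<^bsub>G\<^esub> x)),
      monoid.one = (\<lambda>x\<in>carrier G. if x = \<one>\<^bsub>G\<^esub> then \<one>\<^bsub>F\<^esub> else \<zero>\<^bsub>F\<^esub>),
      ring.zero = (\<lambda>x\<in>carrier G. \<zero>\<^bsub>F\<^esub>),
      ring.add = (\<lambda>f g. \<lambda>x\<in>carrier G. f x \<oplus>\<^bsub>F\<^esub> g x)\<rparr>"

text \<open>The library's \<^const>\<open>maximalideal\<close> is two-sided, so it cannot be used here.\<close>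

definition left_ideal :: "'a set \<Rightarrow> ('a, 'm) ring_scheme \<Rightarrow> bool" where
  "left_ideal I R \<longleftrightarrow>
     additive_subgroup I R \<and> (\<forall>a\<in>carrier R. \<forall>x\<in>I. a \<otimes>\<^bsub>R\<^esub> x \<in> I)"

definition maximal_left_ideal :: "'a set \<Rightarrow> ('a, 'm) ring_scheme \<Rightarrow> bool" where
  "maximal_left_ideal M R \<longleftrightarrow>
     left_ideal M R \<and> M \<noteq> carrier R \<and>
     (\<forall>I. left_ideal I R \<and> M \<subseteq> I \<longrightarrow> I = M \<or> I = carrier R)"

definition jacobson_radical :: "('a, 'm) ring_scheme \<Rightarrow> 'a set" where
  "jacobson_radical R = {x \<in> carrier R. \<forall>M. maximal_left_ideal M R \<longrightarrow> x \<in> M}"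

definition matrix_monoid :: "nat \<Rightarrow> ('a, 'm) ring_scheme \<Rightarrow> (nat \<times> nat \<Rightarrow> 'a) monoid" where
  "matrix_monoid n R =
     \<lparr>carrier = {..<n} \<times> {..<n} \<rightarrow>\<^sub>E carrier R,
      monoid.mult = (\<lambda>A B. \<lambda>(i, j)\<in>{..<n} \<times> {..<n}. \<Oplus>\<^bsub>R\<^esub>k\<in>{..<n}. A (i, k) \<otimes>\<^bsub>R\<^esub> B (k, j)),
      monoid.one = (\<lambda>(i, j)\<in>{..<n} \<times> {..<n}. if i = j then \<one>\<^bsub>R\<^esub> else \<zero>\<^bsub>R\<^esub>)\<rparr>"

definition GL :: "nat \<Rightarrow> ('a, 'm) ring_scheme \<Rightarrow> (nat \<times> nat \<Rightarrow> 'a) monoid" where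
  "GL n R = units_of (matrix_monoid n R)"

end

theory Submission
  imports Defs
begin

text \<open>
  For a primitive \<open>l\<close>-th root of unity \<open>\<zeta>\<close> in the extension of degree \<open>d\<^sub>l\<close>, \<open>l\<close> dividing \<open>s\<close>, sending the
  generator of \<open>C\<^sub>n\<close> to \<open>\<zeta>\<close> and \<open>D12\<close> through its six irreducible representations, all of which have integral
  matrices, is a multiplicative map from \<open>FG\<close> to four copies of the field and two copies of its
  \<open>2\<close> by \<open>2\<close> matrices. Choose one \<open>\<zeta>\<close> in each of the \<open>e\<^sub>l\<close> Frobenius orbits.  Fourier inversion on
  \<open>D12\<close> (12 is invertible) and on \<open>C\<^sub>s\<close> (\<open>s\<close> is invertible; Ramanujan's sums let the roots of
  unity of different levels live in unrelated fields) shows that two elements have the same image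
  under all these maps iff they agree modulo the normal \<open>p\<close>-subgroup \<open>\<langle>a\<rangle>\<close> of order \<open>p^r\<close>.  Counting
  then gives surjectivity.  The kernel is \<open>(a - 1) FG\<close>, whose elements have vanishing \<open>p^r\<close>-th power, and the
  image has no radical, so the kernel is \<open>J(FG)\<close>; units lift because the kernel is nil.
\<close>

section \<open>Rings of prime characteristic\<close>

text \<open>The target is never made into a ring. It is a product of multiplicative monoids, and all
  that remains of additivity is that two elements have the same image iff their difference has the
  same image as \<open>\<zero>\<close>. Units, radical and cardinalities follow from this alone,
  with semisimplicity replaced by a condition on idempotents.

  One \<open>\<zeta>\<close> per Frobenius orbit is enough because the \<open>q\<close>-th power
  fixes \<open>F\<close>: a polynomial over \<open>F\<close> that vanishes at \<open>\<zeta>\<close>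
  vanishes at \<open>\<zeta>^q\<close>. An orbit has d_l members, hence e_l = phi(l) / d_l copies of
  a field of size q^d_l. Since d_l e_l = phi(l) and these add up to \<open>s\<close>, the target has
  q^(12 s) elements, exactly as many as there are classes modulo the \<open>p\<close>-subgroup.

  The power sums of primitive roots are integers, so a relation found in one extension can be pulled
  back along the injective embedding of \<open>F\<close>; only in \<open>F\<close> are the levels
  combined.

  The exponent is exactly p^r because \<open>a\<close> itself lies in \<open>V\<close>; the order of
  \<open>V\<close> is the quotient of q^(12 n) by q^(12 s).\<close>

lemma (in ring) minus_eq_minusI:
  assumes "a \<in> carrier R" "b \<in> carrier R" "u \<in> carrier R" "v \<in> carrier R" "a \<oplus> u = b \<oplus> v"
  shows "a \<ominus> b = v \<ominus> u"
proof -
  have "a \<ominus> b = (a \<oplus> u) \<ominus> u \<ominus> b" using assms(1-4) by algebra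
  also have "\<dots> = (b \<oplus> v) \<ominus> u \<ominus> b" using assms(5) by simp
  also have "\<dots> = v \<ominus> u" using assms(1-4) by algebra
  finally show ?thesis .
qed

text \<open>\<open>FG\<close> is not commutative, but \<open>\<one>\<close> commutes with
  \<open>x\<close>, so the binomial theorem survives; the induction is Pascal's rule.\<close>

lemma (in ring) one_plus_pow:
  assumes x: "x \<in> carrier R"
  shows "(\<one> \<oplus> x) [^] (n::nat) = (\<Oplus>k\<in>{..n}. [(n choose k)] \<cdot> (x [^] k))"
proof (induction n)
  case 0
  show ?case using x by (simp add: add.finprod_0)
next
  case (Suc n)
  define T where "T = (\<Oplus>k\<in>{..n}. [(n choose k)] \<cdot> (x [^] k))"
  define A where "A = (\<Oplus>k\<in>{..n}. [(n choose k)] \<cdot> (x [^] Suc k))"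
  define B where "B = (\<Oplus>k\<in>{..n}. [(n choose Suc k)] \<cdot> (x [^] Suc k))"
  have cl: "A \<in> carrier R" "B \<in> carrier R" "T \<in> carrier R"
    unfolding A_def B_def T_def using x by (auto intro!: finsum_closed)
  \<comment> \<open>One sum up to \<open>Suc n\<close>, read twice: its last coefficient
    \<open>n choose Suc n\<close> is zero, and removing its term for \<open>k = 0\<close> leaves
    \<open>B\<close>.\<close>
  have T1: "T = B \<oplus> \<one>"
  proof -
    have "(\<Oplus>k\<in>{..Suc n}. [(n choose k)] \<cdot> (x [^] k)) = T"
      unfolding T_def using x by (subst finsum_Suc) (auto intro!: l_zero finsum_closed simp: binomial_eq_0)
    moreover have "(\<Oplus>k\<in>{..Suc n}. [(n choose k)] \<cdot> (x [^] k)) = B \<oplus> \<one>"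
      unfolding B_def using x by (subst finsum_Suc2) (auto)
    ultimately show ?thesis by simp
  qed
  have "(\<one> \<oplus> x) [^] Suc n = T \<oplus> T \<otimes> x"
    using Suc x cl by (simp add: T_def[symmetric] r_distr)
  also have "T \<otimes> x = A"
    unfolding T_def A_def using x
    by (subst finsum_ldistr) (auto intro!: finsum_cong' simp: add_pow_ldistr)
  also have "T \<oplus> A = (A \<oplus> B) \<oplus> \<one>"
    using T1 cl by (simp add: a_ac)
  also have "A \<oplus> B = (\<Oplus>k\<in>{..n}. [(Suc n choose Suc k)] \<cdot> (x [^] Suc k))"
    unfolding A_def B_def using x
    by (subst finsum_addf[symmetric]) (auto intro!: finsum_cong' simp: add.nat_pow_mult)
  also have "\<dots> \<oplus> \<one> = (\<Oplus>k\<in>{..Suc n}. [(Suc n choose k)] \<cdot> (x [^] k))"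
    using x by (subst finsum_Suc2) auto
  finally show ?case .
qed

text \<open>Frobenius for the commuting pair \<open>\<one>\<close>, \<open>x\<close>: the inner
  binomial coefficients of a prime are multiples of it. This is what turns
  \<open>a [^] (p ^ r) = \<one>\<close> into nilpotency of
  \<open>a \<ominus> \<one>\<close>.\<close>

lemma (in ring) one_plus_pow_prime_power:
  assumes p: "Factorial_Ring.prime p" and ch: "\<And>y. y \<in> carrier R \<Longrightarrow> [p] \<cdot> y = \<zero>" and x: "x \<in> carrier R"
  shows "(\<one> \<oplus> x) [^] (p ^ r :: nat) = \<one> \<oplus> x [^] (p ^ r)"
proof -
  have ch': "[m] \<cdot> y = \<zero>" if "p dvd m" "y \<in> carrier R" for m y
  proof -
    from that obtain j where "m = p * j" by auto
    then show ?thesis using that ch[of "[j] \<cdot> y"]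
      by (simp add: add.nat_pow_pow mult.commute)
  qed
  have prime_case: "(\<one> \<oplus> y) [^] p = \<one> \<oplus> y [^] p" if y: "y \<in> carrier R" for y
  proof -
    \<comment> \<open>With \<open>p = m + 2\<close> the inner coefficients are those at
      \<open>Suc k\<close> for \<open>k \<le> m\<close>, between the two end terms.\<close>
    obtain m where m: "p = Suc (Suc m)"
      using prime_ge_2_nat[OF p] le_Suc_ex[of 2 p] by auto
    have "(\<Oplus>k\<in>{..m}. [(p choose Suc k)] \<cdot> (y [^] Suc k)) = (\<Oplus>k\<in>{..m}. \<zero>)"
    proof (rule finsum_cong')
      fix k assume "k \<in> {..m}"
      then have "p dvd p choose Suc k"
        using p by (intro dvd_choose_prime) (auto simp: m)
      then show "[(p choose Suc k)] \<cdot> (y [^] Suc k) = \<zero>" using y ch' by blast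
    qed auto
    then have z: "(\<Oplus>k\<in>{..m}. [(p choose Suc k)] \<cdot> (y [^] Suc k)) = \<zero>" by simp
    have "(\<one> \<oplus> y) [^] p = (\<Oplus>k\<in>{..Suc (Suc m)}. [(p choose k)] \<cdot> (y [^] k))"
      using one_plus_pow[OF y, of p] m by simp
    also have "\<dots> = y [^] p \<oplus> (\<Oplus>k\<in>{..Suc m}. [(p choose k)] \<cdot> (y [^] k))"
      using y by (subst finsum_Suc) (auto simp: m)
    also have "(\<Oplus>k\<in>{..Suc m}. [(p choose k)] \<cdot> (y [^] k)) = \<one>"
      using y z by (subst finsum_Suc2) auto
    finally show ?thesis using y by (simp add: a_comm)
  qed
  show ?thesis
  proof (induction r)
    case (Suc r)
    have "(\<one> \<oplus> x) [^] (p ^ Suc r) = ((\<one> \<oplus> x) [^] (p ^ r)) [^] p"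
      using x by (simp add: nat_pow_pow mult.commute)
    also have "\<dots> = \<one> \<oplus> (x [^] (p ^ r)) [^] p"
      using x Suc prime_case[of "x [^] (p ^ r)"] by simp
    finally show ?case using x by (simp add: nat_pow_pow mult.commute)
  qed (use x in simp)
qed

section \<open>The Jacobson radical as the kernel of a multiplicative map\<close>

text \<open>Finiteness stands in for Zorn's lemma.\<close>

lemma (in ring) exists_maximal_left_ideal:
  assumes fin: "finite (carrier R)" and I: "left_ideal I R" "I \<noteq> carrier R"
  shows "\<exists>M. maximal_left_ideal M R \<and> I \<subseteq> M"
proof -
  define S where "S = {M. left_ideal M R \<and> M \<noteq> carrier R \<and> I \<subseteq> M}"
  have sub: "S \<subseteq> Pow (carrier R)"
    by (auto simp: S_def left_ideal_def additive_subgroup_def dest: subgroup.mem_carrier)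
  have "I \<in> S" using I by (auto simp: S_def)
  moreover have "finite S" using sub fin by (meson finite_Pow_iff finite_subset)
  ultimately have "\<exists>M\<in>S. I \<subseteq> M \<and> (\<forall>Y\<in>S. M \<subseteq> Y \<longrightarrow> M = Y)"
    using finite_has_maximal2 by metis
  then obtain M where M: "M \<in> S" "I \<subseteq> M" "\<And>Y. Y \<in> S \<Longrightarrow> M \<subseteq> Y \<Longrightarrow> M = Y"
    by metis
  have "maximal_left_ideal M R"
    unfolding maximal_left_ideal_def
  proof (intro conjI allI impI)
    fix Y assume "left_ideal Y R \<and> M \<subseteq> Y"
    then show "Y = M \<or> Y = carrier R" using M by (auto simp: S_def)
  qed (use M in \<open>auto simp: S_def\<close>)
  then show ?thesis using M by blast
qed

lemma left_idealD:
  assumes "left_ideal I R" and "ring R"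
  shows "I \<subseteq> carrier R" "\<zero>\<^bsub>R\<^esub> \<in> I" "\<And>x y. x \<in> I \<Longrightarrow> y \<in> I \<Longrightarrow> x \<oplus>\<^bsub>R\<^esub> y \<in> I"
    "\<And>x. x \<in> I \<Longrightarrow> \<ominus>\<^bsub>R\<^esub> x \<in> I" "\<And>a x. a \<in> carrier R \<Longrightarrow> x \<in> I \<Longrightarrow> a \<otimes>\<^bsub>R\<^esub> x \<in> I"
proof -
  interpret ring R by fact
  interpret I: additive_subgroup I R using assms by (simp add: left_ideal_def)
  show "I \<subseteq> carrier R" "\<zero>\<^bsub>R\<^esub> \<in> I" "\<And>x y. x \<in> I \<Longrightarrow> y \<in> I \<Longrightarrow> x \<oplus>\<^bsub>R\<^esub> y \<in> I"
    by (auto intro: I.a_subset)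
  show "\<And>x. x \<in> I \<Longrightarrow> \<ominus>\<^bsub>R\<^esub> x \<in> I"
    using I.a_subgroup add.subgroupE(3) by blast
  show "\<And>a x. a \<in> carrier R \<Longrightarrow> x \<in> I \<Longrightarrow> a \<otimes>\<^bsub>R\<^esub> x \<in> I"
    using assms by (auto simp: left_ideal_def)
qed

lemma (in ring) left_idealI:
  assumes "I \<subseteq> carrier R" "\<zero> \<in> I" "\<And>x y. x \<in> I \<Longrightarrow> y \<in> I \<Longrightarrow> x \<ominus> y \<in> I"
    "\<And>a x. a \<in> carrier R \<Longrightarrow> x \<in> I \<Longrightarrow> a \<otimes> x \<in> I"
  shows "left_ideal I R"
proof -
  have neg: "\<ominus> x \<in> I" if "x \<in> I" for x
  proof -
    have "\<ominus> x = \<zero> \<ominus> x" using that assms(1) by (auto simp: a_minus_def)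
    then show ?thesis using assms(3)[OF assms(2) that] by simp
  qed
  have "x \<oplus> y \<in> I" if "x \<in> I" "y \<in> I" for x y
  proof -
    have "x \<oplus> y = x \<ominus> (\<ominus> y)" using that assms(1) by (auto simp: a_minus_def)
    then show ?thesis using assms(3)[OF that(1) neg[OF that(2)]] by simp
  qed
  then have "subgroup I (add_monoid R)"
    using assms(1,2) neg by (intro add.subgroupI) auto
  then show ?thesis using assms(4) by (simp add: left_ideal_def additive_subgroup_def)
qed

lemma (in ring) maximal_left_ideal_one:
  assumes "maximal_left_ideal M R"
  shows "\<one> \<notin> M"
proof
  assume one: "\<one> \<in> M"
  have M: "left_ideal M R" "M \<noteq> carrier R" using assms by (auto simp: maximal_left_ideal_def)
  note d = left_idealD[OF M(1) ring_axioms]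
  have "a \<in> M" if "a \<in> carrier R" for a using d(5)[OF that one] that by simp
  then show False using M(2) d(1) by blast
qed

text \<open>If the left ideal \<open>R (1 - x)\<close> were proper, a maximal left ideal above it
  would contain both \<open>1 - x\<close> and \<open>x\<close>, hence \<open>1\<close>.\<close>

lemma (in ring) jacobson_radical_left_invertible:
  assumes fin: "finite (carrier R)" and x: "x \<in> jacobson_radical R"
  shows "\<exists>u\<in>carrier R. u \<otimes> (\<one> \<ominus> x) = \<one>"
proof (rule ccontr)
  assume not: "\<not> ?thesis"
  have xc: "x \<in> carrier R" using x by (simp add: jacobson_radical_def)
  define I where "I = (\<lambda>u. u \<otimes> (\<one> \<ominus> x)) ` carrier R"
  have "left_ideal I R"
  proof (rule left_idealI)
    show "\<zero> \<in> I" using xc by (auto simp: I_def intro!: image_eqI[of _ _ \<zero>])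
  next
    fix y z assume "y \<in> I" "z \<in> I"
    then obtain u v where "u \<in> carrier R" "v \<in> carrier R" "y = u \<otimes> (\<one> \<ominus> x)" "z = v \<otimes> (\<one> \<ominus> x)"
      by (auto simp: I_def)
    then show "y \<ominus> z \<in> I" using xc
      by (auto simp: I_def a_minus_def l_distr l_minus intro!: image_eqI[of _ _ "u \<ominus> v"])
  next
    fix a y assume a: "a \<in> carrier R" and "y \<in> I"
    then obtain u where "u \<in> carrier R" "y = u \<otimes> (\<one> \<ominus> x)" by (auto simp: I_def)
    then show "a \<otimes> y \<in> I" using xc a
      by (auto simp: I_def m_assoc[symmetric] intro!: image_eqI[of _ _ "a \<otimes> u"])
  qed (use xc in \<open>auto simp: I_def\<close>)
  moreover have "I \<noteq> carrier R"
  proof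
    assume "I = carrier R"
    then have "\<one> \<in> I" by simp
    then show False using not by (auto simp: I_def)
  qed
  ultimately obtain M where M: "maximal_left_ideal M R" "I \<subseteq> M"
    using exists_maximal_left_ideal[OF fin] by blast
  have "\<one> \<ominus> x \<in> I" using xc by (auto simp: I_def intro!: image_eqI[of _ _ \<one>])
  then have 1: "\<one> \<ominus> x \<in> M" using M by blast
  have 2: "x \<in> M" using x M by (auto simp: jacobson_radical_def)
  have "(\<one> \<ominus> x) \<oplus> x \<in> M"
    using left_idealD(3)[OF _ ring_axioms 1 2] M by (simp add: maximal_left_ideal_def)
  also have "(\<one> \<ominus> x) \<oplus> x = \<one>" using xc by (simp add: a_minus_def a_assoc l_neg)
  finally show False using maximal_left_ideal_one[OF M(1)] by blast
qed

lemma (in ring) jacobson_radical_mult_closed: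
  assumes "a \<in> carrier R" "x \<in> jacobson_radical R"
  shows "a \<otimes> x \<in> jacobson_radical R"
  using assms left_idealD(5)[OF _ ring_axioms]
  by (auto simp: jacobson_radical_def maximal_left_ideal_def)

text \<open>For \<open>x\<close> outside a maximal left ideal \<open>M\<close>, maximality gives
  \<open>M + R x = R\<close>, so \<open>1 = m + a x\<close>. As \<open>- a x\<close> lies in
  \<open>N\<close>, the element \<open>m = 1 - a x\<close> has a left inverse, which forces
  \<open>1\<close> into \<open>M\<close>.\<close>

lemma (in ring) left_ideal_le_jacobson_radical:
  assumes N: "left_ideal N R" and inv: "\<And>x. x \<in> N \<Longrightarrow> \<exists>u\<in>carrier R. u \<otimes> (\<one> \<oplus> x) = \<one>"
  shows "N \<subseteq> jacobson_radical R"
proof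
  fix x assume x: "x \<in> N"
  note dN = left_idealD[OF N ring_axioms]
  have xc: "x \<in> carrier R" using x dN by blast
  have "x \<in> M" if M: "maximal_left_ideal M R" for M
  proof (rule ccontr)
    assume xM: "x \<notin> M"
    have Ml: "left_ideal M R" using M by (simp add: maximal_left_ideal_def)
    note dM = left_idealD[OF Ml ring_axioms]
    have Mc: "m \<in> carrier R" if "m \<in> M" for m using that dM by blast
    define I where "I = {m \<oplus> a \<otimes> x | m a. m \<in> M \<and> a \<in> carrier R}"
    have "left_ideal I R"
    proof (rule left_idealI)
      show "I \<subseteq> carrier R" using xc Mc by (auto simp: I_def)
      show "\<zero> \<in> I" unfolding I_def using dM(2) xc by (auto intro!: exI[of _ \<zero>])
    next
      fix y z assume "y \<in> I" "z \<in> I"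
      then obtain m a m' a' where h: "m \<in> M" "m' \<in> M" "a \<in> carrier R" "a' \<in> carrier R"
        "y = m \<oplus> a \<otimes> x" "z = m' \<oplus> a' \<otimes> x" by (auto simp: I_def)
      have "y \<ominus> z = (m \<oplus> \<ominus> m') \<oplus> (a \<ominus> a') \<otimes> x"
        using h xc Mc by (simp add: a_minus_def l_distr l_minus minus_add a_ac)
      then show "y \<ominus> z \<in> I" unfolding I_def using h dM(3,4) by blast
    next
      fix b y assume b: "b \<in> carrier R" and "y \<in> I"
      then obtain m a where h: "m \<in> M" "a \<in> carrier R" "y = m \<oplus> a \<otimes> x" by (auto simp: I_def)
      have "b \<otimes> y = b \<otimes> m \<oplus> (b \<otimes> a) \<otimes> x" using h b xc Mc by (simp add: r_distr m_assoc)
      then show "b \<otimes> y \<in> I" unfolding I_def using h b dM(5) by blast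
    qed
    moreover have "M \<subseteq> I"
    proof
      fix y assume "y \<in> M"
      moreover have "y = y \<oplus> \<zero> \<otimes> x" using Mc[OF \<open>y \<in> M\<close>] xc by simp
      ultimately show "y \<in> I" unfolding I_def by blast
    qed
    moreover have "x \<in> I"
    proof -
      have "x = \<zero> \<oplus> \<one> \<otimes> x" using xc by simp
      then show ?thesis unfolding I_def using dM(2) by blast
    qed
    ultimately have "I = carrier R" using M xM by (auto simp: maximal_left_ideal_def)
    then have "\<one> \<in> I" by simp
    then obtain m a where h: "m \<in> M" "a \<in> carrier R" "\<one> = m \<oplus> a \<otimes> x"
      unfolding I_def by blast
    have "\<ominus> (a \<otimes> x) \<in> N" using h x dN by blast
    then obtain u where u: "u \<in> carrier R" "u \<otimes> (\<one> \<oplus> \<ominus> (a \<otimes> x)) = \<one>" using inv by blast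
    have "\<one> \<oplus> \<ominus> (a \<otimes> x) = m"
      unfolding h(3) using h(1,2) xc Mc by (simp add: a_assoc r_neg)
    then have "\<one> \<in> M" using u h(1) dM(5) by metis
    then show False using maximal_left_ideal_one[OF M] by blast
  qed
  then show "x \<in> jacobson_radical R" using xc by (simp add: jacobson_radical_def)
qed

abbreviation idempotent :: "('a, 'm) monoid_scheme \<Rightarrow> 'a \<Rightarrow> bool" where
  "idempotent M a \<equiv> a \<otimes>\<^bsub>M\<^esub> a = a"

text \<open>A multiplicative stand-in for semisimplicity: matrix algebras over fields and their products
  have the property, with \<open>z\<close> the zero matrix.\<close>

definition idem_regular :: "('a, 'm) monoid_scheme \<Rightarrow> 'a \<Rightarrow> bool" where
  "idem_regular M z \<longleftrightarrow>
     z \<in> carrier M \<and> (\<forall>c\<in>carrier M. c \<otimes>\<^bsub>M\<^esub> z = z \<and> z \<otimes>\<^bsub>M\<^esub> c = z) \<and>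
     (\<forall>b\<in>carrier M. b \<noteq> z \<longrightarrow>
       (\<exists>c\<in>carrier M. c \<otimes>\<^bsub>M\<^esub> b \<noteq> z \<and> idempotent M (c \<otimes>\<^bsub>M\<^esub> b)))"

text \<open>\<open>M\<close> has no addition: \<open>map_eq_iff\<close> is the part of additivity
  that the argument needs, with \<open>z\<close> in the role of zero. Nilpotency of the kernel is
  assumed in the form \<open>unipotent\<close>, which yields both the invertibility of
  \<open>1 + x\<close> and the exponent of \<open>V\<close>.\<close>

locale radical_map = ring R + M: monoid M for R (structure) and M (structure) +
  fixes \<Phi> :: "'a \<Rightarrow> 'c" and z :: 'c and m :: nat
  assumes finite_carrier: "finite (carrier R)"
    and hom: "\<Phi> \<in> hom R M" and map_one: "\<Phi> \<one> = \<one>\<^bsub>M\<^esub>"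
    and surj: "\<Phi> ` carrier R = carrier M"
    and regular: "idem_regular M z"
    and map_eq_iff: "\<And>x y. x \<in> carrier R \<Longrightarrow> y \<in> carrier R \<Longrightarrow> \<Phi> x = \<Phi> y \<longleftrightarrow> \<Phi> (x \<ominus> y) = z"
    and m_pos: "0 < m"
    and unipotent: "\<And>x. x \<in> carrier R \<Longrightarrow> \<Phi> x = z \<Longrightarrow> (\<one> \<oplus> x) [^] m = \<one>"
begin

abbreviation ker where "ker \<equiv> {x \<in> carrier R. \<Phi> x = z}"

lemma map_mult: "x \<in> carrier R \<Longrightarrow> y \<in> carrier R \<Longrightarrow> \<Phi> (x \<otimes> y) = \<Phi> x \<otimes>\<^bsub>M\<^esub> \<Phi> y"
  using hom by (simp add: hom_def)

lemma map_closed: "x \<in> carrier R \<Longrightarrow> \<Phi> x \<in> carrier M"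
  using surj by blast

lemma map_zero: "\<Phi> \<zero> = z"
  using map_eq_iff[of \<zero> \<zero>] by (simp add: a_minus_def)

lemma ker_left_ideal: "left_ideal ker R"
proof (rule left_idealI)
  show "x \<ominus> y \<in> ker" if "x \<in> ker" "y \<in> ker" for x y
    using that map_eq_iff[of x y] by auto
  show "a \<otimes> x \<in> ker" if "a \<in> carrier R" "x \<in> ker" for a x
    using that regular by (auto simp: map_mult idem_regular_def map_closed)
qed (auto simp: map_zero)

text \<open>Such an \<open>x\<close> is one plus an element of the kernel, so
  \<open>x [^] m = \<one>\<close> and the power with exponent \<open>m - 1\<close> is its
  inverse.\<close>

lemma unipotent_unit:
  assumes "x \<in> carrier R" "\<Phi> x = \<one>\<^bsub>M\<^esub>"
  shows "\<exists>u\<in>carrier R. u \<otimes> x = \<one> \<and> x \<otimes> u = \<one>"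
proof -
  have "\<Phi> (x \<ominus> \<one>) = z" using map_eq_iff[of x \<one>] assms map_one by simp
  then have "(\<one> \<oplus> (x \<ominus> \<one>)) [^] m = \<one>" using assms by (intro unipotent) auto
  moreover have "\<one> \<oplus> (x \<ominus> \<one>) = x" using assms(1) by algebra
  ultimately have "x [^] m = \<one>" by simp
  moreover obtain i where "m = Suc i" using m_pos gr0_conv_Suc by blast
  ultimately have "x [^] i \<otimes> x = \<one>" "x \<otimes> x [^] i = \<one>"
    using assms(1) by (simp_all flip: nat_pow_Suc2)
  then show ?thesis using assms(1) by blast
qed

text \<open>Lift the inverse of \<open>\<Phi> x\<close> to some \<open>y\<close>. Both
  \<open>y x\<close> and \<open>x y\<close> lie over one and are units, so \<open>x\<close> has a
  left and a right inverse, and these coincide.\<close>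

lemma unit_iff: assumes x: "x \<in> carrier R" shows "x \<in> Units R \<longleftrightarrow> \<Phi> x \<in> Units M"
proof
  assume "x \<in> Units R"
  then obtain y where "y \<in> carrier R" "y \<otimes> x = \<one>" "x \<otimes> y = \<one>" by (auto simp: Units_def)
  then show "\<Phi> x \<in> Units M" using x map_closed map_mult map_one
    unfolding Units_def by (metis (mono_tags, lifting) mem_Collect_eq)
next
  assume "\<Phi> x \<in> Units M"
  then obtain b where b: "b \<in> carrier M" "b \<otimes>\<^bsub>M\<^esub> \<Phi> x = \<one>\<^bsub>M\<^esub>" "\<Phi> x \<otimes>\<^bsub>M\<^esub> b = \<one>\<^bsub>M\<^esub>"
    by (auto simp: Units_def)
  then obtain y where y: "y \<in> carrier R" "b = \<Phi> y" using surj by blast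
  obtain u where u: "u \<in> carrier R" "u \<otimes> (y \<otimes> x) = \<one>"
    using unipotent_unit[of "y \<otimes> x"] x y b by (auto simp: map_mult)
  obtain v where v: "v \<in> carrier R" "(x \<otimes> y) \<otimes> v = \<one>"
    using unipotent_unit[of "x \<otimes> y"] x y b by (auto simp: map_mult)
  have l: "(u \<otimes> y) \<otimes> x = \<one>" and r: "x \<otimes> (y \<otimes> v) = \<one>"
    using u v x y by (simp_all add: m_assoc)
  have "u \<otimes> y = y \<otimes> v" using l r x y u v inv_unique[of "u \<otimes> y" x "y \<otimes> v"] by simp
  then show "x \<in> Units R" using l r x y u v unfolding Units_def by auto
qed

text \<open>The kernel is a left ideal with all \<open>1 + x\<close> invertible. Conversely, an
  element of the radical outside the kernel has a left multiple \<open>y\<close> whose image is an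
  idempotent different from \<open>z\<close>. With \<open>u\<close> a left inverse of
  \<open>1 - y\<close>, one gets \<open>y = u (1 - y) y = u (y - y y)\<close>, and
  \<open>y - y y\<close> lies in the kernel.\<close>

lemma jacobson_radical_eq: "jacobson_radical R = ker"
proof
  show "ker \<subseteq> jacobson_radical R"
  proof (rule left_ideal_le_jacobson_radical[OF ker_left_ideal])
    fix x assume x: "x \<in> ker"
    have "(\<one> \<oplus> x) \<ominus> \<one> = x" using x by (simp add: a_minus_def a_ac r_neg)
    then have "\<Phi> (\<one> \<oplus> x) = \<one>\<^bsub>M\<^esub>" using map_eq_iff[of "\<one> \<oplus> x" \<one>] x map_one by simp
    then show "\<exists>u\<in>carrier R. u \<otimes> (\<one> \<oplus> x) = \<one>" using unipotent_unit[of "\<one> \<oplus> x"] x by auto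
  qed
next
  show "jacobson_radical R \<subseteq> ker"
  proof
    fix x assume x: "x \<in> jacobson_radical R"
    then have xc: "x \<in> carrier R" by (simp add: jacobson_radical_def)
    have "\<Phi> x = z"
    proof (rule ccontr)
      assume "\<Phi> x \<noteq> z"
      then obtain c where c: "c \<in> carrier M" "c \<otimes>\<^bsub>M\<^esub> \<Phi> x \<noteq> z"
        "idempotent M (c \<otimes>\<^bsub>M\<^esub> \<Phi> x)"
        using regular map_closed[OF xc] by (auto simp: idem_regular_def)
      then obtain a where a: "a \<in> carrier R" "c = \<Phi> a" using surj by blast
      define y where "y = a \<otimes> x"
      have y: "y \<in> carrier R" "\<Phi> y \<noteq> z" "\<Phi> (y \<otimes> y) = \<Phi> y"
        using a c xc by (auto simp: y_def map_mult)
      obtain u where u: "u \<in> carrier R" "u \<otimes> (\<one> \<ominus> y) = \<one>"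
        using jacobson_radical_left_invertible[OF finite_carrier, of y]
          jacobson_radical_mult_closed[OF a(1) x] by (auto simp: y_def)
      have "y \<ominus> y \<otimes> y \<in> ker" using map_eq_iff[of y "y \<otimes> y"] y by auto
      then have "u \<otimes> (y \<ominus> y \<otimes> y) \<in> ker"
        using left_idealD(5)[OF ker_left_ideal ring_axioms u(1)] by blast
      moreover have "y \<ominus> y \<otimes> y = (\<one> \<ominus> y) \<otimes> y" using y(1) by algebra
      then have "u \<otimes> (y \<ominus> y \<otimes> y) = y"
        using u y(1) by (simp add: m_assoc[symmetric])
      ultimately show False using y by auto
    qed
    then show "x \<in> ker" using xc by simp
  qed
qed

lemma one_plus_radical: "(\<lambda>j. \<one> \<oplus> j) ` jacobson_radical R = {x \<in> carrier R. \<Phi> x = \<one>\<^bsub>M\<^esub>}"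
proof -
  have "x \<in> (\<lambda>j. \<one> \<oplus> j) ` ker" if "x \<in> carrier R" "\<Phi> x = \<one>\<^bsub>M\<^esub>" for x
  proof (rule image_eqI)
    show "x = \<one> \<oplus> (x \<ominus> \<one>)" using that(1) by algebra
    show "x \<ominus> \<one> \<in> ker" using map_eq_iff[of x \<one>] that map_one by auto
  qed
  moreover have "\<Phi> (\<one> \<oplus> x) = \<one>\<^bsub>M\<^esub>" if "x \<in> ker" for x
  proof -
    have "(\<one> \<oplus> x) \<ominus> \<one> = x" using that by (simp add: a_minus_def a_ac r_neg)
    then show ?thesis using map_eq_iff[of "\<one> \<oplus> x" \<one>] that map_one by simp
  qed
  ultimately show ?thesis by (auto simp: jacobson_radical_eq)
qed

text \<open>By \<open>map_eq_iff\<close> the fibres are additive cosets of the kernel, although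
  \<open>M\<close> has no addition; translation by \<open>\<one>\<close> gives each of them the size
  of \<open>1 + J\<close>.\<close>

lemma card_carrier:
  "card (carrier R) = card ((\<lambda>j. \<one> \<oplus> j) ` jacobson_radical R) * card (carrier M)"
proof -
  have coset: "card ((\<lambda>j. x \<oplus> j) ` ker) = card ker" if "x \<in> carrier R" for x
    using that by (intro card_image inj_onI) simp
  have fibre: "card {x \<in> carrier R. \<Phi> x = y} = card ker" if "y \<in> \<Phi> ` carrier R" for y
  proof -
    from that obtain w where w: "w \<in> carrier R" "y = \<Phi> w" by blast
    have "{x \<in> carrier R. \<Phi> x = y} = (\<lambda>j. w \<oplus> j) ` ker"
    proof (intro Set.equalityI subsetI)
      fix x assume x: "x \<in> {x \<in> carrier R. \<Phi> x = y}"
      then have "x \<ominus> w \<in> ker" using map_eq_iff[of x w] w by auto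
      moreover have "x \<in> carrier R" using x by simp
      then have "x = w \<oplus> (x \<ominus> w)" using w(1) by algebra
      ultimately show "x \<in> (\<lambda>j. w \<oplus> j) ` ker" by blast
    next
      fix x assume "x \<in> (\<lambda>j. w \<oplus> j) ` ker"
      then obtain j where j: "j \<in> carrier R" "\<Phi> j = z" "x = w \<oplus> j" by auto
      have "(w \<oplus> j) \<ominus> w = j" using j(1) w(1) by algebra
      then show "x \<in> {x \<in> carrier R. \<Phi> x = y}" using map_eq_iff[of x w] w j by auto
    qed
    then show ?thesis using coset[OF w(1)] by simp
  qed
  have "card (carrier R) = (\<Sum>y\<in>\<Phi> ` carrier R. card {x \<in> carrier R. \<Phi> x = y})"
    using sum.image_gen[OF finite_carrier, of "\<lambda>_. 1::nat" \<Phi>] by simp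
  also have "\<dots> = card (\<Phi> ` carrier R) * card ker" using fibre by simp
  finally show ?thesis using coset[OF one_closed] surj by (simp add: jacobson_radical_eq)
qed

lemma units_hom: "group_hom (units_of R) (units_of M) \<Phi>"
  unfolding group_hom_def group_hom_axioms_def
  using units_group M.units_group unit_iff map_mult
  by (auto simp: hom_def units_of_def dest: Units_closed)

lemma kernel_units: "kernel (units_of R) (units_of M) \<Phi> = (\<lambda>j. \<one> \<oplus> j) ` jacobson_radical R"
  unfolding one_plus_radical using unit_iff
  by (auto simp: kernel_def units_of_def)

lemma units_quotient:
  "(\<lambda>j. \<one> \<oplus> j) ` jacobson_radical R \<lhd> units_of R"
  "units_of R Mod (\<lambda>j. \<one> \<oplus> j) ` jacobson_radical R \<cong> units_of M"
proof -
  interpret U: group_hom "units_of R" "units_of M" \<Phi> by (rule units_hom)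
  show "(\<lambda>j. \<one> \<oplus> j) ` jacobson_radical R \<lhd> units_of R"
    using U.normal_kernel by (simp add: kernel_units)
  \<comment> \<open>A unit of \<open>M\<close> has some preimage in \<open>R\<close>, and
    \<open>unit_iff\<close> makes it a unit.\<close>
  have "\<Phi> ` carrier (units_of R) = carrier (units_of M)"
  proof
    show "carrier (units_of M) \<subseteq> \<Phi> ` carrier (units_of R)"
    proof
      fix b assume b: "b \<in> carrier (units_of M)"
      then have "b \<in> carrier M" by (auto simp: units_of_def M.Units_closed)
      then obtain x where "x \<in> carrier R" "b = \<Phi> x" using surj by blast
      then show "b \<in> \<Phi> ` carrier (units_of R)" using b unit_iff by (auto simp: units_of_def)
    qed
  qed auto
  then show "units_of R Mod (\<lambda>j. \<one> \<oplus> j) ` jacobson_radical R \<cong> units_of M"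
    using U.FactGroup_iso by (simp add: kernel_units)
qed

end

section \<open>Units and regularity of products and matrix monoids\<close>

lemma (in abelian_monoid) finsum_swap:
  assumes "finite A" "finite B" "\<And>a b. a \<in> A \<Longrightarrow> b \<in> B \<Longrightarrow> f a b \<in> carrier G"
  shows "(\<Oplus>a\<in>A. \<Oplus>b\<in>B. f a b) = (\<Oplus>b\<in>B. \<Oplus>a\<in>A. f a b)"
  using assms(1,3)
proof (induction A rule: finite_induct)
  case (insert x A)
  have "(\<Oplus>b\<in>B. \<Oplus>a\<in>insert x A. f a b) = (\<Oplus>b\<in>B. f x b \<oplus> (\<Oplus>a\<in>A. f a b))"
    using insert by (intro finsum_cong') (auto intro!: finsum_closed)
  also have "\<dots> = (\<Oplus>b\<in>B. f x b) \<oplus> (\<Oplus>b\<in>B. \<Oplus>a\<in>A. f a b)"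
    using insert by (intro finsum_addf) (auto intro!: finsum_closed)
  finally show ?case using insert by (auto intro!: finsum_closed simp: Pi_def)
qed simp

lemma (in abelian_monoid) finsum_delta:
  assumes "finite A" "a \<in> A" "c \<in> carrier G"
  shows "(\<Oplus>j\<in>A. if j = a then c else \<zero>) = c"
  using add.finprod_singleton[of a A "\<lambda>_. c"] assms by (simp add: eq_commute)

lemma (in abelian_monoid) finsum_Times:
  assumes "finite A" "finite B" "\<And>a b. a \<in> A \<Longrightarrow> b \<in> B \<Longrightarrow> f (a, b) \<in> carrier G"
  shows "(\<Oplus>z\<in>A \<times> B. f z) = (\<Oplus>a\<in>A. \<Oplus>b\<in>B. f (a, b))"
  using assms(1,3)
proof (induction A rule: finite_induct)
  case (insert a A)
  have eq: "insert a A \<times> B = Pair a ` B \<union> A \<times> B" by auto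
  have "(\<Oplus>z\<in>insert a A \<times> B. f z) = (\<Oplus>z\<in>Pair a ` B. f z) \<oplus> (\<Oplus>z\<in>A \<times> B. f z)"
    unfolding eq using insert assms(2) by (intro finsum_Un_disjoint) auto
  also have "(\<Oplus>z\<in>Pair a ` B. f z) = (\<Oplus>b\<in>B. f (a, b))"
    using insert.prems by (intro finsum_reindex) (auto simp: inj_on_def)
  finally show ?case using insert assms(2) by (simp add: finsum_closed Pi_def)
qed simp

text \<open>Serves to find the size of the image of \<open>wedderburn_map\<close> without describing
  that image: it is compared with \<open>reduce\<close>, whose image is explicit.\<close>

lemma card_image_eq_of_same_fibres:
  assumes "\<And>x y. x \<in> A \<Longrightarrow> y \<in> A \<Longrightarrow> f x = f y \<longleftrightarrow> g x = g y"
  shows "card (f ` A) = card (g ` A)"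
proof -
  have "bij_betw (\<lambda>y. g (inv_into A f y)) (f ` A) (g ` A)"
  proof (rule bij_betw_imageI)
    show "inj_on (\<lambda>y. g (inv_into A f y)) (f ` A)"
      using assms by (auto simp: inj_on_def) (metis f_inv_into_f imageI inv_into_into)
    have "g (inv_into A f (f x)) = g x" if "x \<in> A" for x
      using assms that by (metis f_inv_into_f imageI inv_into_into)
    then show "(\<lambda>y. g (inv_into A f y)) ` f ` A = g ` A" by (auto simp: image_image)
  qed
  then show ?thesis by (rule bij_betw_same_card)
qed

lemma units_of_DirProd:
  assumes "monoid M" "monoid N"
  shows "units_of (M \<times>\<times> N) = units_of M \<times>\<times> units_of N"
proof -
  have "Units (M \<times>\<times> N) = Units M \<times> Units N"
    by (auto simp: Units_def; metis)
  then show ?thesis by (simp add: units_of_def DirProd_def)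
qed

text \<open>\<open>\<times>\<times>\<close> associates to the right, whereas the block of
  \<open>F\<close> is produced as a single left factor.\<close>

lemma DirProd_assoc_iso: "(A \<times>\<times> B) \<times>\<times> C \<cong> A \<times>\<times> (B \<times>\<times> C)"
proof (rule is_isoI)
  show "(\<lambda>((a, b), c). (a, (b, c))) \<in> iso ((A \<times>\<times> B) \<times>\<times> C) (A \<times>\<times> (B \<times>\<times> C))"
    by (force simp: iso_def hom_def inj_on_def bij_betw_def)
qed

lemma monoid_product_group:
  assumes "\<And>i. i \<in> I \<Longrightarrow> monoid (M i)"
  shows "monoid (product_group I M)"
  using assms
  by (intro monoidI) (auto simp: monoid.m_closed monoid.m_assoc PiE_iff extensional_def fun_eq_iff monoid.one_closed)

lemma units_of_product_group:
  assumes "\<And>i. i \<in> I \<Longrightarrow> monoid (M i)"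
  shows "units_of (product_group I M) = product_group I (\<lambda>i. units_of (M i))"
proof -
  have "Units (product_group I M) = (\<Pi>\<^sub>E i\<in>I. Units (M i))"
  proof (rule Set.set_eqI, rule iffI)
    fix x assume "x \<in> Units (product_group I M)"
    then obtain y where xy: "x \<in> (\<Pi>\<^sub>E i\<in>I. carrier (M i))" "y \<in> (\<Pi>\<^sub>E i\<in>I. carrier (M i))"
      "(\<lambda>i\<in>I. y i \<otimes>\<^bsub>M i\<^esub> x i) = (\<lambda>i\<in>I. \<one>\<^bsub>M i\<^esub>)" "(\<lambda>i\<in>I. x i \<otimes>\<^bsub>M i\<^esub> y i) = (\<lambda>i\<in>I. \<one>\<^bsub>M i\<^esub>)"
      by (auto simp: Units_def)
    have "y i \<otimes>\<^bsub>M i\<^esub> x i = \<one>\<^bsub>M i\<^esub>" "x i \<otimes>\<^bsub>M i\<^esub> y i = \<one>\<^bsub>M i\<^esub>" if "i \<in> I" for i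
      using fun_cong[OF xy(3), of i] fun_cong[OF xy(4), of i] that by auto
    then show "x \<in> (\<Pi>\<^sub>E i\<in>I. Units (M i))" using xy(1,2)
      by (fastforce simp: Units_def PiE_iff)
  next
    fix x assume x: "x \<in> (\<Pi>\<^sub>E i\<in>I. Units (M i))"
    then have "\<forall>i\<in>I. \<exists>y\<in>carrier (M i). y \<otimes>\<^bsub>M i\<^esub> x i = \<one>\<^bsub>M i\<^esub> \<and> x i \<otimes>\<^bsub>M i\<^esub> y = \<one>\<^bsub>M i\<^esub>"
      by (auto simp: Units_def PiE_iff)
    then obtain y where y: "\<And>i. i \<in> I \<Longrightarrow> y i \<in> carrier (M i)"
        "\<And>i. i \<in> I \<Longrightarrow> y i \<otimes>\<^bsub>M i\<^esub> x i = \<one>\<^bsub>M i\<^esub>" "\<And>i. i \<in> I \<Longrightarrow> x i \<otimes>\<^bsub>M i\<^esub> y i = \<one>\<^bsub>M i\<^esub>"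
      by metis
    have "x \<in> carrier (product_group I M)" using x by (auto simp: Units_def PiE_iff)
    moreover have "restrict y I \<in> carrier (product_group I M)" using y by auto
    moreover have "restrict y I \<otimes>\<^bsub>product_group I M\<^esub> x = \<one>\<^bsub>product_group I M\<^esub>"
        "x \<otimes>\<^bsub>product_group I M\<^esub> restrict y I = \<one>\<^bsub>product_group I M\<^esub>"
      using y by (auto simp: fun_eq_iff)
    ultimately show "x \<in> Units (product_group I M)" unfolding Units_def by blast
  qed
  then show ?thesis by (simp add: units_of_def product_group_def)
qed

section \<open>Idempotent regularity of products and matrix monoids\<close>

lemma idem_regularI:
  assumes "z \<in> carrier M" "\<And>c. c \<in> carrier M \<Longrightarrow> c \<otimes>\<^bsub>M\<^esub> z = z" "\<And>c. c \<in> carrier M \<Longrightarrow> z \<otimes>\<^bsub>M\<^esub> c = z"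
    "\<And>b. b \<in> carrier M \<Longrightarrow> b \<noteq> z \<Longrightarrow>
       \<exists>c\<in>carrier M. c \<otimes>\<^bsub>M\<^esub> b \<noteq> z \<and> idempotent M (c \<otimes>\<^bsub>M\<^esub> b)"
  shows "idem_regular M z"
  using assms by (auto simp: idem_regular_def)

lemma idem_regularD:
  assumes "idem_regular M z"
  shows "z \<in> carrier M" "\<And>c. c \<in> carrier M \<Longrightarrow> c \<otimes>\<^bsub>M\<^esub> z = z" "\<And>c. c \<in> carrier M \<Longrightarrow> z \<otimes>\<^bsub>M\<^esub> c = z"
    "\<And>b. b \<in> carrier M \<Longrightarrow> b \<noteq> z \<Longrightarrow>
       \<exists>c\<in>carrier M. c \<otimes>\<^bsub>M\<^esub> b \<noteq> z \<and> idempotent M (c \<otimes>\<^bsub>M\<^esub> b)"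
  using assms by (auto simp: idem_regular_def)

text \<open>A multiplier that is zero in one coordinate wipes that coordinate out, so an idempotent
  found in one factor becomes an idempotent of the product.\<close>

lemma idem_regular_DirProd:
  assumes M: "idem_regular M z" and N: "idem_regular N w"
  shows "idem_regular (M \<times>\<times> N) (z, w)"
proof (rule idem_regularI)
  note m = idem_regularD[OF M] and n = idem_regularD[OF N]
  fix b assume b: "b \<in> carrier (M \<times>\<times> N)" "b \<noteq> (z, w)"
  then obtain b1 b2 where b12: "b = (b1, b2)" "b1 \<in> carrier M" "b2 \<in> carrier N" "b1 \<noteq> z \<or> b2 \<noteq> w"
    by (cases b) auto
  show "\<exists>c\<in>carrier (M \<times>\<times> N). c \<otimes>\<^bsub>M \<times>\<times> N\<^esub> b \<noteq> (z, w) \<and>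
      idempotent (M \<times>\<times> N) (c \<otimes>\<^bsub>M \<times>\<times> N\<^esub> b)"
    using b12(4)
  proof
    assume "b1 \<noteq> z"
    then obtain c where "c \<in> carrier M" "c \<otimes>\<^bsub>M\<^esub> b1 \<noteq> z"
      "idempotent M (c \<otimes>\<^bsub>M\<^esub> b1)" using m(4) b12 by blast
    then show ?thesis using b12 n by (intro bexI[of _ "(c, w)"]) auto
  next
    assume "b2 \<noteq> w"
    then obtain c where "c \<in> carrier N" "c \<otimes>\<^bsub>N\<^esub> b2 \<noteq> w"
      "idempotent N (c \<otimes>\<^bsub>N\<^esub> b2)" using n(4) b12 by blast
    then show ?thesis using b12 m by (intro bexI[of _ "(z, c)"]) auto
  qed
qed (use assms in \<open>auto simp: idem_regularD\<close>)

lemma idem_regular_product_group: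
  assumes M: "\<And>i. i \<in> I \<Longrightarrow> idem_regular (M i) (z i)"
  shows "idem_regular (product_group I M) (\<lambda>i\<in>I. z i)"
proof (rule idem_regularI)
  note m = idem_regularD[OF M]
  let ?P = "product_group I M" and ?z = "\<lambda>i\<in>I. z i"
  fix b assume b: "b \<in> carrier ?P" "b \<noteq> ?z"
  then obtain i where i: "i \<in> I" "b i \<noteq> z i"
    by (auto simp: PiE_iff fun_eq_iff extensional_def split: if_splits)
  moreover have "b i \<in> carrier (M i)" using b i by auto
  ultimately obtain c where c: "c \<in> carrier (M i)" "c \<otimes>\<^bsub>M i\<^esub> b i \<noteq> z i"
      "idempotent (M i) (c \<otimes>\<^bsub>M i\<^esub> b i)" using m(4) by blast
  \<comment> \<open>The multiplier acts as \<open>c\<close> at the index \<open>i\<close> and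
    annihilates all other coordinates.\<close>
  define d where "d = (\<lambda>j\<in>I. if j = i then c else z j)"
  have db: "d \<otimes>\<^bsub>?P\<^esub> b = (\<lambda>j\<in>I. if j = i then c \<otimes>\<^bsub>M i\<^esub> b i else z j)"
    using m(3) b by (auto simp: d_def fun_eq_iff PiE_iff)
  have "(d \<otimes>\<^bsub>?P\<^esub> b) i \<noteq> ?z i" using i c unfolding db by simp
  then have "d \<otimes>\<^bsub>?P\<^esub> b \<noteq> ?z" by metis
  moreover have "idempotent ?P (d \<otimes>\<^bsub>?P\<^esub> b)"
    unfolding db using c m(1,2) by (auto simp: fun_eq_iff)
  moreover have "d \<in> carrier ?P" using c m(1) by (auto simp: d_def)
  ultimately show "\<exists>d\<in>carrier ?P. d \<otimes>\<^bsub>?P\<^esub> b \<noteq> ?z \<and> idempotent ?P (d \<otimes>\<^bsub>?P\<^esub> b)"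
    by blast
qed (auto simp: fun_eq_iff PiE_iff idem_regularD[OF M])

lemma idem_regular_field:
  assumes "field L" shows "idem_regular L \<zero>\<^bsub>L\<^esub>"
proof (rule idem_regularI)
  interpret field L by fact
  fix b assume b: "b \<in> carrier L" "b \<noteq> \<zero>\<^bsub>L\<^esub>"
  then have "b \<in> Units L" using field_Units by auto
  then have "inv\<^bsub>L\<^esub> b \<otimes>\<^bsub>L\<^esub> b = \<one>\<^bsub>L\<^esub>" "inv\<^bsub>L\<^esub> b \<in> carrier L" by auto
  then show "\<exists>c\<in>carrier L. c \<otimes>\<^bsub>L\<^esub> b \<noteq> \<zero>\<^bsub>L\<^esub> \<and> idempotent L (c \<otimes>\<^bsub>L\<^esub> b)"
    by (intro bexI[of _ "inv\<^bsub>L\<^esub> b"]) auto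
next
  interpret field L by fact
  show "\<zero>\<^bsub>L\<^esub> \<in> carrier L" by simp
  fix c assume "c \<in> carrier L"
  then show "c \<otimes>\<^bsub>L\<^esub> \<zero>\<^bsub>L\<^esub> = \<zero>\<^bsub>L\<^esub>" "\<zero>\<^bsub>L\<^esub> \<otimes>\<^bsub>L\<^esub> c = \<zero>\<^bsub>L\<^esub>" by simp_all
qed

lemma matrix_monoid_simps:
  "carrier (matrix_monoid n R) = {..<n} \<times> {..<n} \<rightarrow>\<^sub>E carrier R"
  "\<one>\<^bsub>matrix_monoid n R\<^esub> = (\<lambda>(i, j)\<in>{..<n} \<times> {..<n}. if i = j then \<one>\<^bsub>R\<^esub> else \<zero>\<^bsub>R\<^esub>)"
  "i < n \<Longrightarrow> j < n \<Longrightarrow> (A \<otimes>\<^bsub>matrix_monoid n R\<^esub> B) (i, j) = (\<Oplus>\<^bsub>R\<^esub>k\<in>{..<n}. A (i, k) \<otimes>\<^bsub>R\<^esub> B (k, j))"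
  by (simp_all add: matrix_monoid_def)

lemma matrix_eqI:
  assumes "A \<in> extensional ({..<n::nat} \<times> {..<n})" "B \<in> extensional ({..<n} \<times> {..<n})"
    "\<And>i j. i < n \<Longrightarrow> j < n \<Longrightarrow> A (i, j) = B (i, j)"
  shows "A = B"
  using assms by (intro extensionalityI[of A "{..<n} \<times> {..<n}"]) auto

lemma matrix_mult_extensional: "A \<otimes>\<^bsub>matrix_monoid n R\<^esub> B \<in> extensional ({..<n} \<times> {..<n})"
  by (auto simp: matrix_monoid_def)

lemma (in ring) matrix_mult_closed:
  assumes "A \<in> carrier (matrix_monoid n R)" "B \<in> carrier (matrix_monoid n R)"
  shows "A \<otimes>\<^bsub>matrix_monoid n R\<^esub> B \<in> carrier (matrix_monoid n R)"
  using assms by (auto simp: matrix_monoid_def PiE_iff intro!: finsum_closed)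

lemma (in ring) monoid_matrix_monoid: "monoid (matrix_monoid n R)"
proof (rule monoidI)
  let ?M = "matrix_monoid n R"
  have ext: "A \<in> extensional ({..<n} \<times> {..<n})" if "A \<in> carrier ?M" for A
    using that by (auto simp: matrix_monoid_simps PiE_iff)
  have cl: "A (i, j) \<in> carrier R" if "A \<in> carrier ?M" "i < n" "j < n" for A i j
    using that by (auto simp: matrix_monoid_simps PiE_iff)
  fix A B C assume A: "A \<in> carrier ?M" and B: "B \<in> carrier ?M" and C: "C \<in> carrier ?M"
  show "(A \<otimes>\<^bsub>?M\<^esub> B) \<otimes>\<^bsub>?M\<^esub> C = A \<otimes>\<^bsub>?M\<^esub> (B \<otimes>\<^bsub>?M\<^esub> C)"
  proof (rule matrix_eqI[OF matrix_mult_extensional matrix_mult_extensional])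
    fix i j assume ij: "i < n" "j < n"
    have "((A \<otimes>\<^bsub>?M\<^esub> B) \<otimes>\<^bsub>?M\<^esub> C) (i, j) = (\<Oplus>k\<in>{..<n}. (\<Oplus>l\<in>{..<n}. A (i, l) \<otimes> B (l, k)) \<otimes> C (k, j))"
      using ij cl[OF A] cl[OF B] cl[OF C]
      by (auto simp: matrix_monoid_simps intro!: finsum_cong' finsum_closed)
    also have "\<dots> = (\<Oplus>k\<in>{..<n}. \<Oplus>l\<in>{..<n}. A (i, l) \<otimes> B (l, k) \<otimes> C (k, j))"
      using ij cl[OF A] cl[OF B] cl[OF C] by (intro finsum_cong' finsum_ldistr) (auto intro!: finsum_closed)
    also have "\<dots> = (\<Oplus>l\<in>{..<n}. \<Oplus>k\<in>{..<n}. A (i, l) \<otimes> B (l, k) \<otimes> C (k, j))"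
      using ij cl[OF A] cl[OF B] cl[OF C] by (intro finsum_swap) auto
    also have "\<dots> = (\<Oplus>l\<in>{..<n}. A (i, l) \<otimes> (\<Oplus>k\<in>{..<n}. B (l, k) \<otimes> C (k, j)))"
      using ij cl[OF A] cl[OF B] cl[OF C]
      by (intro finsum_cong') (auto simp: finsum_rdistr m_assoc intro!: finsum_closed finsum_cong')
    also have "\<dots> = (A \<otimes>\<^bsub>?M\<^esub> (B \<otimes>\<^bsub>?M\<^esub> C)) (i, j)"
      using ij cl[OF A] cl[OF B] cl[OF C]
      by (auto simp: matrix_monoid_simps intro!: finsum_cong' finsum_closed)
    finally show "((A \<otimes>\<^bsub>?M\<^esub> B) \<otimes>\<^bsub>?M\<^esub> C) (i, j) = (A \<otimes>\<^bsub>?M\<^esub> (B \<otimes>\<^bsub>?M\<^esub> C)) (i, j)" .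
  qed
  show "\<one>\<^bsub>?M\<^esub> \<otimes>\<^bsub>?M\<^esub> A = A"
  proof (rule matrix_eqI[OF matrix_mult_extensional ext[OF A]])
    fix i j assume ij: "i < n" "j < n"
    have "(\<one>\<^bsub>?M\<^esub> \<otimes>\<^bsub>?M\<^esub> A) (i, j) = (\<Oplus>k\<in>{..<n}. if k = i then A (i, j) else \<zero>)"
      using ij cl[OF A] by (auto simp: matrix_monoid_simps intro!: finsum_cong')
    then show "(\<one>\<^bsub>?M\<^esub> \<otimes>\<^bsub>?M\<^esub> A) (i, j) = A (i, j)" using ij cl[OF A] by (simp add: finsum_delta)
  qed
  show "A \<otimes>\<^bsub>?M\<^esub> \<one>\<^bsub>?M\<^esub> = A"
  proof (rule matrix_eqI[OF matrix_mult_extensional ext[OF A]])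
    fix i j assume ij: "i < n" "j < n"
    have "(A \<otimes>\<^bsub>?M\<^esub> \<one>\<^bsub>?M\<^esub>) (i, j) = (\<Oplus>k\<in>{..<n}. if k = j then A (i, j) else \<zero>)"
      using ij cl[OF A] by (auto simp: matrix_monoid_simps intro!: finsum_cong')
    then show "(A \<otimes>\<^bsub>?M\<^esub> \<one>\<^bsub>?M\<^esub>) (i, j) = A (i, j)" using ij cl[OF A] by (simp add: finsum_delta)
  qed
  show "A \<otimes>\<^bsub>?M\<^esub> B \<in> carrier ?M" by (rule matrix_mult_closed[OF A B])
qed (auto simp: matrix_monoid_simps)

definition zero_matrix :: "nat \<Rightarrow> ('a, 'm) ring_scheme \<Rightarrow> nat \<times> nat \<Rightarrow> 'a" where
  "zero_matrix n R = (\<lambda>_\<in>{..<n} \<times> {..<n}. \<zero>\<^bsub>R\<^esub>)"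

text \<open>Choose a nonzero entry \<open>A (i, j)\<close> and let \<open>C\<close> have its inverse
  at position \<open>(j, i)\<close> and zeros elsewhere. Then \<open>C A\<close> is zero outside row
  \<open>j\<close> and has \<open>1\<close> at \<open>(j, j)\<close>; every matrix of this shape is
  idempotent.\<close>

lemma idem_regular_matrix_monoid:
  assumes "field L" shows "idem_regular (matrix_monoid n L) (zero_matrix n L)"
proof (rule idem_regularI)
  interpret field L by fact
  let ?M = "matrix_monoid n L" and ?z = "zero_matrix n L"
  have cl: "A (i, j) \<in> carrier L" if "A \<in> carrier ?M" "i < n" "j < n" for A i j
    using that by (auto simp: matrix_monoid_simps PiE_iff)
  have zext: "?z \<in> extensional ({..<n} \<times> {..<n})" by (simp add: zero_matrix_def)
  show "?z \<in> carrier ?M" by (auto simp: matrix_monoid_simps zero_matrix_def)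
  fix A assume A: "A \<in> carrier ?M"
  have Aext: "A \<in> extensional ({..<n} \<times> {..<n})" using A by (auto simp: matrix_monoid_simps PiE_iff)
  show "A \<otimes>\<^bsub>?M\<^esub> ?z = ?z"
    using cl[OF A] by (intro matrix_eqI[OF matrix_mult_extensional zext])
      (auto simp: matrix_monoid_simps zero_matrix_def intro!: add.finprod_one_eqI)
  show "?z \<otimes>\<^bsub>?M\<^esub> A = ?z"
    using cl[OF A] by (intro matrix_eqI[OF matrix_mult_extensional zext])
      (auto simp: matrix_monoid_simps zero_matrix_def intro!: add.finprod_one_eqI)
  assume "A \<noteq> ?z"
  then obtain i j where ij: "i < n" "j < n" "A (i, j) \<noteq> \<zero>\<^bsub>L\<^esub>"
    using matrix_eqI[OF Aext zext] by (auto simp: zero_matrix_def)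
  then have u: "A (i, j) \<in> Units L" using field_Units cl[OF A] by auto
  define t where "t = inv\<^bsub>L\<^esub> A (i, j)"
  have t: "t \<in> carrier L" "t \<otimes>\<^bsub>L\<^esub> A (i, j) = \<one>\<^bsub>L\<^esub>" using u by (auto simp: t_def)
  define C where "C = (\<lambda>(a, b)\<in>{..<n} \<times> {..<n}. if a = j \<and> b = i then t else \<zero>\<^bsub>L\<^esub>)"
  have C: "C \<in> carrier ?M" using t by (auto simp: C_def matrix_monoid_simps)
  define E where "E = C \<otimes>\<^bsub>?M\<^esub> A"
  have E: "E (a, b) = (if a = j then t \<otimes>\<^bsub>L\<^esub> A (i, b) else \<zero>\<^bsub>L\<^esub>)" if "a < n" "b < n" for a b
  proof -
    have "E (a, b) = (\<Oplus>\<^bsub>L\<^esub>k\<in>{..<n}. if k = i then (if a = j then t \<otimes>\<^bsub>L\<^esub> A (i, b) else \<zero>\<^bsub>L\<^esub>) else \<zero>\<^bsub>L\<^esub>)"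
      unfolding E_def using that cl[OF A] t
      by (auto simp: matrix_monoid_simps C_def intro!: finsum_cong' add.finprod_one_eqI)
    then show ?thesis using that cl[OF A] t ij by (simp add: finsum_delta)
  qed
  have "E (j, j) \<noteq> ?z (j, j)" using E[of j j] ij t by (simp add: zero_matrix_def)
  then have "E \<noteq> ?z" by auto
  moreover have "E \<otimes>\<^bsub>?M\<^esub> E = E"
  proof (rule matrix_eqI[OF matrix_mult_extensional])
    show "E \<in> extensional ({..<n} \<times> {..<n})" by (simp add: E_def matrix_mult_extensional)
    fix a b assume ab: "a < n" "b < n"
    have "(E \<otimes>\<^bsub>?M\<^esub> E) (a, b) = (\<Oplus>\<^bsub>L\<^esub>k\<in>{..<n}. if k = j then E (a, b) else \<zero>\<^bsub>L\<^esub>)"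
      using ab cl[OF A] t ij by (auto simp: matrix_monoid_simps E intro!: finsum_cong')
    then show "(E \<otimes>\<^bsub>?M\<^esub> E) (a, b) = E (a, b)" using ab cl[OF A] t ij by (simp add: finsum_delta E)
  qed
  ultimately show "\<exists>C\<in>carrier ?M. C \<otimes>\<^bsub>?M\<^esub> A \<noteq> ?z \<and> idempotent ?M (C \<otimes>\<^bsub>?M\<^esub> A)"
    using C unfolding E_def by blast
qed

lemma card_group_power: "card (carrier (group_power M m)) = card (carrier M) ^ m"
  by (simp add: card_PiE)

lemma card_matrix_monoid: "card (carrier (matrix_monoid n R)) = card (carrier R) ^ (n * n)"
  by (simp add: matrix_monoid_simps card_PiE card_cartesian_product)

section \<open>Unit groups of finite fields\<close>

abbreviation mult_group :: "('a, 'm) ring_scheme \<Rightarrow> 'a monoid" where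
  "mult_group R \<equiv> Multiplicative_Group.mult_of R"

text \<open>Exponentiation maps \<open>{0..<N}\<close> onto the group, and both have
  \<open>N\<close> elements; injectivity comes from this count and not from the order of
  \<open>a\<close>.\<close>

lemma (in group) cyclic_iso_integer_mod_group:
  assumes fin: "finite (carrier G)" and a: "a \<in> carrier G"
    and gen: "carrier G = {a [^] i | i::nat. True}"
  shows "G \<cong> integer_mod_group (order G)"
proof -
  define N where "N = order G"
  have N: "N > 0" using fin one_closed by (auto simp: N_def order_def card_gt_0_iff)
  have aN: "a [^] int N = \<one>" using a pow_order_eq_1[OF a] by (simp add: N_def int_pow_int)
  have pmod: "a [^] (i mod int N) = a [^] i" for i :: int
  proof -
    have "a [^] i = a [^] (int N * (i div int N) + i mod int N)" by simp
    also have "\<dots> = (a [^] int N) [^] (i div int N) \<otimes> a [^] (i mod int N)"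
      by (simp only: int_pow_mult[OF a] int_pow_pow[OF a])
    finally show ?thesis using aN a by simp
  qed
  define h where "h = (\<lambda>i::int. a [^] i)"
  have car: "carrier (integer_mod_group N) = {0..<int N}" using N by (simp add: carrier_integer_mod_group)
  have im: "h ` {0..<int N} = carrier G"
  proof
    show "h ` {0..<int N} \<subseteq> carrier G" using a by (auto simp: h_def)
    show "carrier G \<subseteq> h ` {0..<int N}"
    proof
      fix x assume "x \<in> carrier G"
      then obtain i :: nat where "x = a [^] i" using gen by auto
      then have "x = h (int i mod int N)" by (simp add: h_def pmod int_pow_int)
      then show "x \<in> h ` {0..<int N}" using N by auto
    qed
  qed
  moreover have "card {0..<int N} = card (carrier G)" by (simp add: N_def order_def)
  ultimately have "bij_betw h {0..<int N} (carrier G)"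
    by (simp add: bij_betw_def eq_card_imp_inj_on)
  moreover have "h \<in> hom (integer_mod_group N) G"
    using a by (auto simp: hom_def h_def pmod int_pow_mult)
  ultimately have "integer_mod_group N \<cong> G"
    by (auto simp: is_iso_def iso_def car)
  then show ?thesis unfolding N_def by (rule group.iso_sym[OF group_integer_mod_group])
qed

lemma (in field) units_cyclic:
  assumes fin: "finite (carrier R)"
  shows "units_of R \<cong> integer_mod_group (card (carrier R) - 1)"
proof -
  interpret U: group "mult_group R" by (rule field_mult_group)
  obtain a where a: "a \<in> carrier (mult_group R)" "carrier (mult_group R) = {a [^] i | i::nat. i \<in> UNIV}"
    using finite_field_mult_group_has_gen[OF fin] by blast
  have "mult_group R \<cong> integer_mod_group (order (mult_group R))"
  proof (rule U.cyclic_iso_integer_mod_group[OF _ a(1)])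
    show "carrier (mult_group R) = {a [^]\<^bsub>mult_group R\<^esub> i | i::nat. True}"
      unfolding Multiplicative_Group.nat_pow_mult_of a(2) by simp
  qed (use fin in simp)
  then show ?thesis
    using order_mult_of[OF fin] by (simp only: order_def mult_of_is_Units)
qed

section \<open>The Wedderburn block of a field\<close>

abbreviation block :: "('a, 'm) ring_scheme \<Rightarrow> ((nat \<Rightarrow> 'a) \<times> (nat \<Rightarrow> nat \<times> nat \<Rightarrow> 'a)) monoid" where
  "block L \<equiv> group_power L 4 \<times>\<times> group_power (matrix_monoid 2 L) 2"

definition zero_block :: "('a, 'm) ring_scheme \<Rightarrow> (nat \<Rightarrow> 'a) \<times> (nat \<Rightarrow> nat \<times> nat \<Rightarrow> 'a)" where
  "zero_block L = ((\<lambda>_\<in>{..<4}. \<zero>\<^bsub>L\<^esub>), (\<lambda>_\<in>{..<2}. zero_matrix 2 L))"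

lemma monoid_block: assumes "ring L" shows "monoid (block L)"
  by (rule DirProd_monoid; rule monoid_product_group)
    (use assms in \<open>simp_all add: ring.monoid_matrix_monoid ring.is_monoid\<close>)

text \<open>The exponent \<open>4 + 2 * 2^2\<close> is the order of the dihedral group, which is
  what makes the later comparison of cardinalities come out even.\<close>

lemma card_block: "card (carrier (block L)) = card (carrier L) ^ 12"
proof -
  have "card (carrier (block L)) = card (carrier L) ^ 4 * (card (carrier L) ^ (2 * 2)) ^ 2"
    by (simp only: carrier_DirProd card_cartesian_product card_group_power card_matrix_monoid)
  then show ?thesis by (simp flip: power_mult power_add)
qed

lemma idem_regular_block: assumes "field L" shows "idem_regular (block L) (zero_block L)"
  unfolding zero_block_def
  by (rule idem_regular_DirProd; rule idem_regular_product_group)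
    (simp_all add: idem_regular_field idem_regular_matrix_monoid assms)

lemma block_units_iso:
  assumes "field L" "finite (carrier L)"
  shows "units_of (block L) \<cong>
    group_power (integer_mod_group (card (carrier L) - 1)) 4 \<times>\<times> group_power (GL 2 L) 2"
proof -
  interpret field L by fact
  have M: "monoid (matrix_monoid 2 L)" by (rule monoid_matrix_monoid)
  have "units_of (block L) = group_power (units_of L) 4 \<times>\<times> group_power (GL 2 L) 2"
    using M monoid_axioms by (simp add: units_of_DirProd monoid_product_group units_of_product_group GL_def)
  moreover have "group_power (units_of L) 4 \<cong> group_power (integer_mod_group (card (carrier L) - 1)) 4"
    using units_cyclic[OF assms(2)] units_group by (intro iso_product_groupI) auto
  then have "group_power (units_of L) 4 \<times>\<times> group_power (GL 2 L) 2 \<cong>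
      group_power (integer_mod_group (card (carrier L) - 1)) 4 \<times>\<times> group_power (GL 2 L) 2"
    by (intro group.DirProd_iso_trans[OF product_group _ iso_refl]) (simp_all add: units_group)
  ultimately show ?thesis by simp
qed

section \<open>Group algebras of finite groups\<close>

locale finite_group_algebra = cring F + G: group G for F (structure) and G (structure) +
  assumes finite_G: "finite (carrier G)"
begin

abbreviation FG where "FG \<equiv> group_algebra F G"

lemma carrier_FG: "carrier FG = carrier G \<rightarrow>\<^sub>E carrier F"
  using finite_G by (auto simp: group_algebra_def)

lemma in_FG: "f \<in> carrier FG \<Longrightarrow> x \<in> carrier G \<Longrightarrow> f x \<in> carrier F"
  by (auto simp: carrier_FG)

lemma FG_eqI:
  assumes "f \<in> carrier FG" "g \<in> carrier FG" "\<And>x. x \<in> carrier G \<Longrightarrow> f x = g x"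
  shows "f = g"
  using assms by (auto simp: carrier_FG intro: PiE_ext)

lemma FG_simps:
  "x \<in> carrier G \<Longrightarrow> (f \<oplus>\<^bsub>FG\<^esub> g) x = f x \<oplus> g x"
  "x \<in> carrier G \<Longrightarrow> \<one>\<^bsub>FG\<^esub> x = (if x = \<one>\<^bsub>G\<^esub> then \<one> else \<zero>)"
  "x \<in> carrier G \<Longrightarrow> \<zero>\<^bsub>FG\<^esub> x = \<zero>"
  by (simp_all add: group_algebra_def)

text \<open>The defining sum runs over the support of \<open>f\<close>; summing over the whole group
  instead allows translation and exchange of sums.\<close>

lemma FG_mult:
  assumes "f \<in> carrier FG" "g \<in> carrier FG" "x \<in> carrier G"
  shows "(f \<otimes>\<^bsub>FG\<^esub> g) x = (\<Oplus>y\<in>carrier G. f y \<otimes> g (inv\<^bsub>G\<^esub> y \<otimes>\<^bsub>G\<^esub> x))"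
proof -
  have "(\<Oplus>y\<in>{y \<in> carrier G. f y \<noteq> \<zero>}. f y \<otimes> g (inv\<^bsub>G\<^esub> y \<otimes>\<^bsub>G\<^esub> x)) =
      (\<Oplus>y\<in>carrier G. f y \<otimes> g (inv\<^bsub>G\<^esub> y \<otimes>\<^bsub>G\<^esub> x))"
    using finite_G in_FG[OF assms(1)] in_FG[OF assms(2)] assms(3)
    by (intro add.finprod_mono_neutral_cong_left) auto
  then show ?thesis using assms(3) by (simp add: group_algebra_def)
qed

text \<open>Stated for sums in an arbitrary \<open>R\<close>, since it is applied both in
  \<open>F\<close> and in the extension fields.\<close>

lemma finsum_translate:
  assumes "z \<in> carrier G" "\<And>y. y \<in> carrier G \<Longrightarrow> h y \<in> carrier R" "abelian_monoid R"
  shows "(\<Oplus>\<^bsub>R\<^esub>y\<in>carrier G. h y) = (\<Oplus>\<^bsub>R\<^esub>y\<in>carrier G. h (z \<otimes>\<^bsub>G\<^esub> y))"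
proof -
  interpret R: abelian_monoid R by fact
  have "(\<lambda>y. z \<otimes>\<^bsub>G\<^esub> y) ` carrier G = carrier G"
    using G.surj_const_mult[OF assms(1)] .
  then show ?thesis
    using R.add.finprod_reindex[of h "\<lambda>y. z \<otimes>\<^bsub>G\<^esub> y" "carrier G"] G.inj_on_cmult[OF assms(1)] assms(1,2)
    by (simp add: Pi_def)
qed

lemma FG_closed:
  "f \<in> carrier FG \<Longrightarrow> g \<in> carrier FG \<Longrightarrow> f \<oplus>\<^bsub>FG\<^esub> g \<in> carrier FG"
  "f \<in> carrier FG \<Longrightarrow> g \<in> carrier FG \<Longrightarrow> f \<otimes>\<^bsub>FG\<^esub> g \<in> carrier FG"
  "\<one>\<^bsub>FG\<^esub> \<in> carrier FG" "\<zero>\<^bsub>FG\<^esub> \<in> carrier FG"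
proof -
  show "f \<otimes>\<^bsub>FG\<^esub> g \<in> carrier FG" if "f \<in> carrier FG" "g \<in> carrier FG"
  proof -
    have "f \<otimes>\<^bsub>FG\<^esub> g \<in> extensional (carrier G)" by (simp add: group_algebra_def)
    moreover have "(f \<otimes>\<^bsub>FG\<^esub> g) x \<in> carrier F" if "x \<in> carrier G" for x
      using that \<open>f \<in> carrier FG\<close> \<open>g \<in> carrier FG\<close> by (auto simp: FG_mult in_FG intro!: finsum_closed)
    ultimately show ?thesis by (auto simp: carrier_FG PiE_iff)
  qed
qed (auto simp: carrier_FG, auto simp: group_algebra_def)

lemma FG_assoc:
  assumes f: "f \<in> carrier FG" and g: "g \<in> carrier FG" and k: "k \<in> carrier FG"
  shows "(f \<otimes>\<^bsub>FG\<^esub> g) \<otimes>\<^bsub>FG\<^esub> k = f \<otimes>\<^bsub>FG\<^esub> (g \<otimes>\<^bsub>FG\<^esub> k)"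
proof (rule FG_eqI)
  fix x assume x: "x \<in> carrier G"
  note cl = in_FG[OF f] in_FG[OF g] in_FG[OF k]
  let ?t = "\<lambda>y z. f z \<otimes> g (inv\<^bsub>G\<^esub> z \<otimes>\<^bsub>G\<^esub> y) \<otimes> k (inv\<^bsub>G\<^esub> y \<otimes>\<^bsub>G\<^esub> x)"
  have "((f \<otimes>\<^bsub>FG\<^esub> g) \<otimes>\<^bsub>FG\<^esub> k) x =
      (\<Oplus>y\<in>carrier G. (\<Oplus>z\<in>carrier G. f z \<otimes> g (inv\<^bsub>G\<^esub> z \<otimes>\<^bsub>G\<^esub> y)) \<otimes> k (inv\<^bsub>G\<^esub> y \<otimes>\<^bsub>G\<^esub> x))"
    using x cl f g k by (auto simp: FG_mult FG_closed intro!: finsum_cong' finsum_closed)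
  also have "\<dots> = (\<Oplus>y\<in>carrier G. \<Oplus>z\<in>carrier G. ?t y z)"
    using x cl finite_G by (intro finsum_cong' finsum_ldistr) (auto intro!: finsum_closed)
  also have "\<dots> = (\<Oplus>z\<in>carrier G. \<Oplus>y\<in>carrier G. ?t y z)"
    using x cl finite_G by (intro finsum_swap) auto
  also have "\<dots> = (\<Oplus>z\<in>carrier G. f z \<otimes> (g \<otimes>\<^bsub>FG\<^esub> k) (inv\<^bsub>G\<^esub> z \<otimes>\<^bsub>G\<^esub> x))"
  proof (rule finsum_cong')
    fix z assume z: "z \<in> carrier G"
    \<comment> \<open>Replacing \<open>y\<close> by \<open>z y\<close> turns \<open>z^-1 y\<close>
      into \<open>y\<close> and \<open>y^-1 x\<close> into \<open>y^-1 (z^-1 x)\<close>.\<close>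
    have "(\<Oplus>y\<in>carrier G. ?t y z) = (\<Oplus>y\<in>carrier G. ?t (z \<otimes>\<^bsub>G\<^esub> y) z)"
      using x z cl by (intro finsum_translate) (auto intro: abelian_monoid_axioms)
    also have "\<dots> = (\<Oplus>y\<in>carrier G. f z \<otimes> (g y \<otimes> k (inv\<^bsub>G\<^esub> y \<otimes>\<^bsub>G\<^esub> (inv\<^bsub>G\<^esub> z \<otimes>\<^bsub>G\<^esub> x))))"
      using x z cl
      by (intro finsum_cong') (auto simp: m_assoc G.m_assoc[symmetric] G.inv_mult_group)
    also have "\<dots> = f z \<otimes> (g \<otimes>\<^bsub>FG\<^esub> k) (inv\<^bsub>G\<^esub> z \<otimes>\<^bsub>G\<^esub> x)"
      using x z cl finite_G by (simp add: FG_mult[OF g k] finsum_rdistr Pi_def)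
    finally show "(\<Oplus>y\<in>carrier G. ?t y z) = f z \<otimes> (g \<otimes>\<^bsub>FG\<^esub> k) (inv\<^bsub>G\<^esub> z \<otimes>\<^bsub>G\<^esub> x)" .
  qed (use x cl in \<open>auto simp: in_FG FG_closed g k\<close>)
  also have "\<dots> = (f \<otimes>\<^bsub>FG\<^esub> (g \<otimes>\<^bsub>FG\<^esub> k)) x"
    using x f g k by (simp add: FG_mult FG_closed)
  finally show "((f \<otimes>\<^bsub>FG\<^esub> g) \<otimes>\<^bsub>FG\<^esub> k) x = (f \<otimes>\<^bsub>FG\<^esub> (g \<otimes>\<^bsub>FG\<^esub> k)) x" .
qed (use assms in \<open>auto simp: FG_closed\<close>)

text \<open>The group element \<open>a\<close> as a basis vector of \<open>FG\<close>.\<close>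

definition delta :: "'c \<Rightarrow> 'c \<Rightarrow> 'a" where
  "delta a = (\<lambda>x\<in>carrier G. if x = a then \<one> else \<zero>)"

lemma delta_closed: "delta a \<in> carrier FG"
  by (auto simp: delta_def carrier_FG)

lemma one_eq_delta: "\<one>\<^bsub>FG\<^esub> = delta \<one>\<^bsub>G\<^esub>"
  by (simp add: delta_def group_algebra_def)

lemma delta_mult:
  assumes a: "a \<in> carrier G" and f: "f \<in> carrier FG" and x: "x \<in> carrier G"
  shows "(delta a \<otimes>\<^bsub>FG\<^esub> f) x = f (inv\<^bsub>G\<^esub> a \<otimes>\<^bsub>G\<^esub> x)"
proof -
  have "(delta a \<otimes>\<^bsub>FG\<^esub> f) x = (\<Oplus>y\<in>carrier G. if y = a then f (inv\<^bsub>G\<^esub> a \<otimes>\<^bsub>G\<^esub> x) else \<zero>)"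
    using assms in_FG[OF f] by (subst FG_mult[OF delta_closed f x]) (auto simp: delta_def intro!: finsum_cong')
  then show ?thesis using assms finite_G in_FG[OF f] by (simp add: finsum_delta)
qed

lemma mult_delta:
  assumes a: "a \<in> carrier G" and f: "f \<in> carrier FG" and x: "x \<in> carrier G"
  shows "(f \<otimes>\<^bsub>FG\<^esub> delta a) x = f (x \<otimes>\<^bsub>G\<^esub> inv\<^bsub>G\<^esub> a)"
proof -
  have eq: "inv\<^bsub>G\<^esub> y \<otimes>\<^bsub>G\<^esub> x = a \<longleftrightarrow> y = x \<otimes>\<^bsub>G\<^esub> inv\<^bsub>G\<^esub> a" if "y \<in> carrier G" for y
    using that a x by (metis G.inv_closed G.inv_solve_left G.inv_solve_right)
  have "(f \<otimes>\<^bsub>FG\<^esub> delta a) x = (\<Oplus>y\<in>carrier G. if y = x \<otimes>\<^bsub>G\<^esub> inv\<^bsub>G\<^esub> a then f (x \<otimes>\<^bsub>G\<^esub> inv\<^bsub>G\<^esub> a) else \<zero>)"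
    using assms in_FG[OF f]
    by (subst FG_mult[OF f delta_closed x]) (auto simp: delta_def eq intro!: finsum_cong')
  then show ?thesis using assms finite_G in_FG[OF f] by (simp add: finsum_delta)
qed

lemma ring_FG: "ring FG"
proof (rule ringI)
  show "abelian_group FG"
  proof (rule abelian_groupI)
    fix f assume f: "f \<in> carrier FG"
    then have "(\<lambda>x\<in>carrier G. \<ominus> f x) \<in> carrier FG" by (auto simp: carrier_FG)
    moreover have "(\<lambda>x\<in>carrier G. \<ominus> f x) \<oplus>\<^bsub>FG\<^esub> f = \<zero>\<^bsub>FG\<^esub>"
      using f calculation in_FG[OF f] by (intro FG_eqI) (auto simp: FG_closed FG_simps l_neg)
    ultimately show "\<exists>g\<in>carrier FG. g \<oplus>\<^bsub>FG\<^esub> f = \<zero>\<^bsub>FG\<^esub>" by blast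
  qed (auto intro!: FG_eqI simp: FG_closed FG_simps in_FG a_ac)
next
  show "monoid FG"
    by (intro monoidI)
      (auto simp: FG_closed FG_assoc one_eq_delta delta_closed delta_mult mult_delta intro!: FG_eqI)
next
  fix f g k assume h: "f \<in> carrier FG" "g \<in> carrier FG" "k \<in> carrier FG"
  note cl = in_FG[OF h(1)] in_FG[OF h(2)] in_FG[OF h(3)]
  show "(f \<oplus>\<^bsub>FG\<^esub> g) \<otimes>\<^bsub>FG\<^esub> k = f \<otimes>\<^bsub>FG\<^esub> k \<oplus>\<^bsub>FG\<^esub> g \<otimes>\<^bsub>FG\<^esub> k"
  proof (rule FG_eqI)
    fix x assume x: "x \<in> carrier G"
    have "((f \<oplus>\<^bsub>FG\<^esub> g) \<otimes>\<^bsub>FG\<^esub> k) x =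
        (\<Oplus>y\<in>carrier G. f y \<otimes> k (inv\<^bsub>G\<^esub> y \<otimes>\<^bsub>G\<^esub> x) \<oplus> g y \<otimes> k (inv\<^bsub>G\<^esub> y \<otimes>\<^bsub>G\<^esub> x))"
      unfolding FG_mult[OF FG_closed(1)[OF h(1,2)] h(3) x]
      using x cl by (intro finsum_cong') (auto simp: FG_simps l_distr)
    also have "\<dots> = (f \<otimes>\<^bsub>FG\<^esub> k \<oplus>\<^bsub>FG\<^esub> g \<otimes>\<^bsub>FG\<^esub> k) x"
      using x cl by (simp add: FG_simps FG_mult h finsum_addf Pi_def)
    finally show "((f \<oplus>\<^bsub>FG\<^esub> g) \<otimes>\<^bsub>FG\<^esub> k) x = (f \<otimes>\<^bsub>FG\<^esub> k \<oplus>\<^bsub>FG\<^esub> g \<otimes>\<^bsub>FG\<^esub> k) x" .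
  qed (simp_all add: h FG_closed)
  show "k \<otimes>\<^bsub>FG\<^esub> (f \<oplus>\<^bsub>FG\<^esub> g) = k \<otimes>\<^bsub>FG\<^esub> f \<oplus>\<^bsub>FG\<^esub> k \<otimes>\<^bsub>FG\<^esub> g"
  proof (rule FG_eqI)
    fix x assume x: "x \<in> carrier G"
    have "(k \<otimes>\<^bsub>FG\<^esub> (f \<oplus>\<^bsub>FG\<^esub> g)) x =
        (\<Oplus>y\<in>carrier G. k y \<otimes> f (inv\<^bsub>G\<^esub> y \<otimes>\<^bsub>G\<^esub> x) \<oplus> k y \<otimes> g (inv\<^bsub>G\<^esub> y \<otimes>\<^bsub>G\<^esub> x))"
      unfolding FG_mult[OF h(3) FG_closed(1)[OF h(1,2)] x]
      using x cl by (intro finsum_cong') (auto simp: FG_simps r_distr)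
    also have "\<dots> = (k \<otimes>\<^bsub>FG\<^esub> f \<oplus>\<^bsub>FG\<^esub> k \<otimes>\<^bsub>FG\<^esub> g) x"
      using x cl by (simp add: FG_simps FG_mult h finsum_addf Pi_def)
    finally show "(k \<otimes>\<^bsub>FG\<^esub> (f \<oplus>\<^bsub>FG\<^esub> g)) x = (k \<otimes>\<^bsub>FG\<^esub> f \<oplus>\<^bsub>FG\<^esub> k \<otimes>\<^bsub>FG\<^esub> g) x" .
  qed (simp_all add: h FG_closed)
qed

lemma FG_uminus:
  assumes f: "f \<in> carrier FG" and x: "x \<in> carrier G"
  shows "(\<ominus>\<^bsub>FG\<^esub> f) x = \<ominus> f x"
proof -
  interpret FG: ring FG by (rule ring_FG)
  have "(\<ominus>\<^bsub>FG\<^esub> f \<oplus>\<^bsub>FG\<^esub> f) x = \<zero>" using f x by (simp add: FG.l_neg FG_simps)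
  then have "(\<ominus>\<^bsub>FG\<^esub> f) x \<oplus> f x = \<zero>" using x by (simp add: FG_simps)
  then show ?thesis using f x by (intro minus_equality[symmetric]) (auto simp: in_FG)
qed

lemma FG_minus:
  assumes "f \<in> carrier FG" "g \<in> carrier FG" "x \<in> carrier G"
  shows "(f \<ominus>\<^bsub>FG\<^esub> g) x = f x \<ominus> g x"
  using assms by (simp add: a_minus_def FG_simps FG_uminus)

lemma FG_add_pow:
  assumes "f \<in> carrier FG" "x \<in> carrier G"
  shows "([(m::nat)] \<cdot>\<^bsub>FG\<^esub> f) x = [m] \<cdot> f x"
proof -
  interpret FG: ring FG by (rule ring_FG)
  show ?thesis using assms by (induction m) (simp_all add: FG_simps in_FG)
qed

lemma delta_mult_delta:
  assumes "a \<in> carrier G" "b \<in> carrier G"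
  shows "delta a \<otimes>\<^bsub>FG\<^esub> delta b = delta (a \<otimes>\<^bsub>G\<^esub> b)"
proof (rule FG_eqI)
  fix x assume x: "x \<in> carrier G"
  have "inv\<^bsub>G\<^esub> a \<otimes>\<^bsub>G\<^esub> x = b \<longleftrightarrow> x = a \<otimes>\<^bsub>G\<^esub> b"
    using assms x by (metis G.inv_solve_left)
  then show "(delta a \<otimes>\<^bsub>FG\<^esub> delta b) x = delta (a \<otimes>\<^bsub>G\<^esub> b) x"
    using assms x by (simp add: delta_mult delta_closed) (simp add: delta_def)
qed (simp_all add: FG_closed delta_closed)

lemma delta_pow:
  assumes "a \<in> carrier G"
  shows "delta a [^]\<^bsub>FG\<^esub> (m::nat) = delta (a [^]\<^bsub>G\<^esub> m)"
proof -
  interpret FG: ring FG by (rule ring_FG)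
  show ?thesis using assms by (induction m) (simp_all add: one_eq_delta delta_mult_delta)
qed

lemma delta_eq_iff:
  assumes "\<one> \<noteq> \<zero>" "a \<in> carrier G" "b \<in> carrier G"
  shows "delta a = delta b \<longleftrightarrow> a = b"
  using assms by (auto simp: delta_def fun_eq_iff split: if_splits)

definition linear_extension ::
    "('e, 'f) ring_scheme \<Rightarrow> ('a \<Rightarrow> 'e) \<Rightarrow> ('c \<Rightarrow> 'e) \<Rightarrow> ('c \<Rightarrow> 'a) \<Rightarrow> 'e" where
  "linear_extension L h \<rho> f = (\<Oplus>\<^bsub>L\<^esub>x\<in>carrier G. h (f x) \<otimes>\<^bsub>L\<^esub> \<rho> x)"

lemma linear_extension_closed:
  assumes "ring_hom_cring F L h" "\<And>x. x \<in> carrier G \<Longrightarrow> \<rho> x \<in> carrier L" "f \<in> carrier FG"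
  shows "linear_extension L h \<rho> f \<in> carrier L"
proof -
  interpret h: ring_hom_cring F L h by fact
  show ?thesis unfolding linear_extension_def
    using assms(2) in_FG[OF assms(3)] by (intro h.S.finsum_closed) auto
qed

lemma linear_extension_delta:
  assumes "ring_hom_cring F L h" "\<And>x. x \<in> carrier G \<Longrightarrow> \<rho> x \<in> carrier L" "a \<in> carrier G"
  shows "linear_extension L h \<rho> (delta a) = \<rho> a"
proof -
  interpret h: ring_hom_cring F L h by fact
  have "linear_extension L h \<rho> (delta a) = (\<Oplus>\<^bsub>L\<^esub>x\<in>carrier G. if x = a then \<rho> a else \<zero>\<^bsub>L\<^esub>)"
    unfolding linear_extension_def
    using assms(2,3) by (intro h.S.finsum_cong') (auto simp: delta_def)
  then show ?thesis using assms finite_G by (simp add: h.S.finsum_delta)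
qed

text \<open>Here \<open>\<rho> a b\<close> are the coordinate functions of a matrix representation
  of degree \<open>m\<close>. Working entry by entry treats linear characters (\<open>m = 1\<close>)
  and matrices alike while all sums stay in the commutative ring \<open>L\<close>. The convolution
  is unrolled, \<open>x\<close> is replaced by \<open>y x\<close>, and the double sum then factors
  for each \<open>c\<close>.\<close>

lemma linear_extension_mult:
  fixes m :: nat
  assumes "ring_hom_cring F L h"
    and cl: "\<And>x a b. x \<in> carrier G \<Longrightarrow> a < m \<Longrightarrow> b < m \<Longrightarrow> \<rho> a b x \<in> carrier L"
    and mult: "\<And>x y a b. x \<in> carrier G \<Longrightarrow> y \<in> carrier G \<Longrightarrow> a < m \<Longrightarrow> b < m \<Longrightarrow>
      \<rho> a b (x \<otimes>\<^bsub>G\<^esub> y) = (\<Oplus>\<^bsub>L\<^esub>c\<in>{..<m}. \<rho> a c x \<otimes>\<^bsub>L\<^esub> \<rho> c b y)"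
    and f: "f \<in> carrier FG" and g: "g \<in> carrier FG" and ab: "a < m" "b < m"
  shows "linear_extension L h (\<rho> a b) (f \<otimes>\<^bsub>FG\<^esub> g) =
    (\<Oplus>\<^bsub>L\<^esub>c\<in>{..<m}. linear_extension L h (\<rho> a c) f \<otimes>\<^bsub>L\<^esub> linear_extension L h (\<rho> c b) g)"
proof -
  interpret h: ring_hom_cring F L h by fact
  let ?t = "\<lambda>y x c. (h (f y) \<otimes>\<^bsub>L\<^esub> \<rho> a c y) \<otimes>\<^bsub>L\<^esub> (h (g x) \<otimes>\<^bsub>L\<^esub> \<rho> c b x)"
  note cls = in_FG[OF f] in_FG[OF g] cl
  let ?S = "\<lambda>u. finsum L u (carrier G)"
  have "linear_extension L h (\<rho> a b) (f \<otimes>\<^bsub>FG\<^esub> g) =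
      ?S (\<lambda>x. ?S (\<lambda>y. h (f y) \<otimes>\<^bsub>L\<^esub> h (g (inv\<^bsub>G\<^esub> y \<otimes>\<^bsub>G\<^esub> x)) \<otimes>\<^bsub>L\<^esub> \<rho> a b x))"
    unfolding linear_extension_def
  proof (rule h.S.finsum_cong')
    fix x assume x: "x \<in> carrier G"
    have "h ((f \<otimes>\<^bsub>FG\<^esub> g) x) = ?S (\<lambda>y. h (f y) \<otimes>\<^bsub>L\<^esub> h (g (inv\<^bsub>G\<^esub> y \<otimes>\<^bsub>G\<^esub> x)))"
      using x cls by (simp add: FG_mult[OF f g] h.hom_finsum Pi_def o_def cong: h.S.finsum_cong)
    then show "h ((f \<otimes>\<^bsub>FG\<^esub> g) x) \<otimes>\<^bsub>L\<^esub> \<rho> a b x =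
        ?S (\<lambda>y. h (f y) \<otimes>\<^bsub>L\<^esub> h (g (inv\<^bsub>G\<^esub> y \<otimes>\<^bsub>G\<^esub> x)) \<otimes>\<^bsub>L\<^esub> \<rho> a b x)"
      using x cls ab finite_G by (simp add: h.S.finsum_ldistr Pi_def)
  qed (use cls ab in \<open>auto intro!: h.S.finsum_closed\<close>)
  also have "\<dots> = ?S (\<lambda>y. ?S (\<lambda>x. h (f y) \<otimes>\<^bsub>L\<^esub> h (g (inv\<^bsub>G\<^esub> y \<otimes>\<^bsub>G\<^esub> x)) \<otimes>\<^bsub>L\<^esub> \<rho> a b x))"
    using cls ab finite_G by (intro h.S.finsum_swap) auto
  also have "\<dots> = ?S (\<lambda>y. ?S (\<lambda>x. \<Oplus>\<^bsub>L\<^esub>c\<in>{..<m}. ?t y x c))"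
  proof (rule h.S.finsum_cong')
    fix y assume y: "y \<in> carrier G"
    have "?S (\<lambda>x. h (f y) \<otimes>\<^bsub>L\<^esub> h (g (inv\<^bsub>G\<^esub> y \<otimes>\<^bsub>G\<^esub> x)) \<otimes>\<^bsub>L\<^esub> \<rho> a b x) =
        ?S (\<lambda>x. h (f y) \<otimes>\<^bsub>L\<^esub> h (g (inv\<^bsub>G\<^esub> y \<otimes>\<^bsub>G\<^esub> (y \<otimes>\<^bsub>G\<^esub> x))) \<otimes>\<^bsub>L\<^esub> \<rho> a b (y \<otimes>\<^bsub>G\<^esub> x))"
      using y cls ab by (intro finsum_translate) (auto intro: h.S.abelian_monoid_axioms)
    also have "\<dots> = ?S (\<lambda>x. \<Oplus>\<^bsub>L\<^esub>c\<in>{..<m}. ?t y x c)"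
    proof (rule h.S.finsum_cong')
      fix x assume x: "x \<in> carrier G"
      have "inv\<^bsub>G\<^esub> y \<otimes>\<^bsub>G\<^esub> (y \<otimes>\<^bsub>G\<^esub> x) = x" using x y by (simp add: G.m_assoc[symmetric])
      then show "h (f y) \<otimes>\<^bsub>L\<^esub> h (g (inv\<^bsub>G\<^esub> y \<otimes>\<^bsub>G\<^esub> (y \<otimes>\<^bsub>G\<^esub> x))) \<otimes>\<^bsub>L\<^esub> \<rho> a b (y \<otimes>\<^bsub>G\<^esub> x) =
          (\<Oplus>\<^bsub>L\<^esub>c\<in>{..<m}. ?t y x c)"
        using x y cls ab
        by (auto simp: mult h.S.finsum_rdistr Pi_def h.S.m_ac intro!: h.S.finsum_cong')
    qed (use y cls ab in \<open>auto intro!: h.S.finsum_closed\<close>)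
    finally show "?S (\<lambda>x. h (f y) \<otimes>\<^bsub>L\<^esub> h (g (inv\<^bsub>G\<^esub> y \<otimes>\<^bsub>G\<^esub> x)) \<otimes>\<^bsub>L\<^esub> \<rho> a b x) =
        ?S (\<lambda>x. \<Oplus>\<^bsub>L\<^esub>c\<in>{..<m}. ?t y x c)" .
  qed (use cls ab in \<open>auto intro!: h.S.finsum_closed\<close>)
  also have "\<dots> = ?S (\<lambda>y. \<Oplus>\<^bsub>L\<^esub>c\<in>{..<m}. ?S (\<lambda>x. ?t y x c))"
    using cls ab finite_G
    by (intro h.S.finsum_cong' h.S.finsum_swap) (auto intro!: h.S.finsum_closed)
  also have "\<dots> = (\<Oplus>\<^bsub>L\<^esub>c\<in>{..<m}. ?S (\<lambda>y. ?S (\<lambda>x. ?t y x c)))"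
    using cls ab finite_G by (intro h.S.finsum_swap) (auto intro!: h.S.finsum_closed)
  also have "\<dots> = (\<Oplus>\<^bsub>L\<^esub>c\<in>{..<m}. linear_extension L h (\<rho> a c) f \<otimes>\<^bsub>L\<^esub> linear_extension L h (\<rho> c b) g)"
  proof (rule h.S.finsum_cong')
    fix c assume c: "c \<in> {..<m}"
    have "linear_extension L h (\<rho> a c) f \<otimes>\<^bsub>L\<^esub> linear_extension L h (\<rho> c b) g =
        ?S (\<lambda>y. (h (f y) \<otimes>\<^bsub>L\<^esub> \<rho> a c y) \<otimes>\<^bsub>L\<^esub> ?S (\<lambda>x. h (g x) \<otimes>\<^bsub>L\<^esub> \<rho> c b x))"
      unfolding linear_extension_def using c cls ab finite_G
      by (intro h.S.finsum_ldistr) (auto intro!: h.S.finsum_closed)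
    also have "\<dots> = ?S (\<lambda>y. ?S (\<lambda>x. ?t y x c))"
      using c cls ab finite_G
      by (intro h.S.finsum_cong' h.S.finsum_rdistr) (auto intro!: h.S.finsum_closed)
    finally show "?S (\<lambda>y. ?S (\<lambda>x. ?t y x c)) =
        linear_extension L h (\<rho> a c) f \<otimes>\<^bsub>L\<^esub> linear_extension L h (\<rho> c b) g" by simp
  qed (use cls ab assms(1) f g in \<open>auto intro!: linear_extension_closed\<close>)
  finally show ?thesis .
qed

end

text \<open>In characteristic \<open>p\<close>, \<open>w = a - 1\<close> satisfies
  \<open>w^(p^r) = a^(p^r) - 1 = 0\<close>. Since \<open>w\<close> commutes with \<open>z\<close>,
  also \<open>(w z)^(p^r) = 0\<close>, and the same power of \<open>1 + w z\<close> is
  \<open>1\<close>.\<close>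

lemma (in ring) one_plus_multiple_of_unipotent:
  fixes p r :: nat
  assumes p: "Factorial_Ring.prime p" and ch: "\<And>y. y \<in> carrier R \<Longrightarrow> [p] \<cdot> y = \<zero>"
    and a: "a \<in> carrier R" "a [^] (p ^ r) = \<one>" and z: "z \<in> carrier R" "a \<otimes> z = z \<otimes> a"
  shows "(\<one> \<oplus> (a \<ominus> \<one>) \<otimes> z) [^] (p ^ r) = \<one>"
proof -
  define w where "w = a \<ominus> \<one>"
  have w: "w \<in> carrier R" "\<one> \<oplus> w = a" using a by (auto simp: w_def a_minus_def a_ac r_neg)
  have wz: "w \<otimes> z = z \<otimes> w" using a z by (simp add: w_def a_minus_def l_distr r_distr l_minus r_minus)
  have "\<one> \<oplus> w [^] (p ^ r) = \<one>" using one_plus_pow_prime_power[of p w r] p ch w a by simp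
  then have w0: "w [^] (p ^ r) = \<zero>" using w by (metis add.l_cancel nat_pow_closed one_closed r_zero zero_closed)
  have "(w \<otimes> z) [^] (p ^ r) = \<zero>" using pow_mult_distrib[OF wz w(1) z(1)] w0 z by simp
  then show ?thesis
    using one_plus_pow_prime_power[of p "w \<otimes> z" r] p ch w z by (simp add: w_def)
qed

section \<open>Finite fields and roots of unity\<close>

lemma (in ring) add_pow_int_0 [simp]: "[(0::int)] \<cdot> x = \<zero>"
  by (simp add: add_pow_int_ge)

lemma (in ring) add_pow_int_one_mult: "[(a::int)] \<cdot> \<one> \<otimes> [(b::int)] \<cdot> \<one> = [(a * b)] \<cdot> \<one>"
  by (simp add: add_pow_ldistr_int add.int_pow_pow mult.commute)

lemma (in ring) add_pow_int_one_sum: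
  "finite A \<Longrightarrow> [(\<Sum>x\<in>A. f x :: int)] \<cdot> \<one> = (\<Oplus>x\<in>A. [(f x)] \<cdot> \<one>)"
  by (induction A rule: finite_induct) (simp_all add: add.int_pow_mult)

lemma (in ring_hom_ring) hom_add_pow_int: "x \<in> carrier R \<Longrightarrow> h ([(k::int)] \<cdot> x) = [k] \<cdot>\<^bsub>S\<^esub> h x"
proof -
  assume x: "x \<in> carrier R"
  have n: "h ([(m::nat)] \<cdot> x) = [m] \<cdot>\<^bsub>S\<^esub> h x" for m using x by (induction m) simp_all
  show ?thesis using x n by (cases "k \<ge> 0") (simp_all add: add_pow_int_ge add_pow_int_lt)
qed

locale char_field = field +
  fixes p :: nat
  assumes finite_R: "finite (carrier R)" and char: "ring_characteristic R = p"
begin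

lemma char_nat: "[(m::nat)] \<cdot> \<one> = \<zero> \<longleftrightarrow> p dvd m"
  using add.pow_eq_id[of \<one> m] char by (simp add: ring_characteristic_def)

lemma prime_char: "Factorial_Ring.prime p"
proof -
  have p0: "p > 0"
    using add.ord_ge_1[of \<one>] finite_R char by (simp add: ring_characteristic_def)
  have p1: "p \<noteq> 1" using char_nat[of 1] by auto
  then obtain a where a: "Factorial_Ring.prime a" "a dvd p" using prime_factor_nat by blast
  then obtain b where b: "p = a * b" by auto
  have "[a] \<cdot> \<one> \<otimes> [b] \<cdot> \<one> = [p] \<cdot> \<one>"
    by (simp add: add_pow_ldistr add.nat_pow_pow b mult.commute)
  also have "\<dots> = \<zero>" by (simp add: char_nat)
  finally have "p dvd a \<or> p dvd b" using integral[of "[a] \<cdot> \<one>" "[b] \<cdot> \<one>"] char_nat by auto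
  moreover have "\<not> p dvd b"
  proof
    assume "p dvd b"
    moreover have "b > 0" using p0 b by (cases b) auto
    ultimately have "a * b \<le> 1 * b" using b dvd_imp_le[of p b] by simp
    then have "a \<le> 1" using \<open>b > 0\<close> by simp
    then show False using prime_gt_1_nat[OF a(1)] by simp
  qed
  ultimately show ?thesis using a dvd_antisym by blast
qed

lemma char_add_pow: "x \<in> carrier R \<Longrightarrow> [p] \<cdot> x = \<zero>"
  using add_pow_ldistr[of \<one> x p] char_nat[of p] by simp

lemma char_int: "[(m::int)] \<cdot> \<one> = \<zero> \<longleftrightarrow> int p dvd m"
proof (cases m rule: int_cases2)
  case (nonneg n)
  then show ?thesis using char_nat[of n] by (simp add: add_pow_int_ge)
next
  case (nonpos n)
  have "[m] \<cdot> \<one> = \<ominus> ([(int n)] \<cdot> \<one>)" using nonpos by (simp add: add.int_pow_neg)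
  then show ?thesis using nonpos char_nat[of n] by (simp add: add_pow_int_ge)
qed

text \<open>Dividing by a nonzero \<open>x\<close> reduces the claim to the power of
  \<open>1 + t\<close> with \<open>t = x^-1 y\<close>.\<close>

lemma frobenius_add:
  assumes "x \<in> carrier R" "y \<in> carrier R"
  shows "(x \<oplus> y) [^] (p ^ k) = x [^] (p ^ k) \<oplus> y [^] (p ^ k)"
proof (cases "x = \<zero>")
  case True
  then show ?thesis using assms prime_gt_0_nat[OF prime_char] by (simp add: nat_pow_zero)
next
  case False
  then have u: "x \<in> Units R" using assms field_Units by simp
  define t where "t = inv x \<otimes> y"
  have t: "t \<in> carrier R" "x \<otimes> t = y" using u assms by (simp_all add: t_def m_assoc[symmetric])
  have "(x \<oplus> y) [^] (p ^ k) = (x \<otimes> (\<one> \<oplus> t)) [^] (p ^ k)"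
    using assms t by (simp add: r_distr)
  also have "\<dots> = x [^] (p ^ k) \<otimes> (\<one> \<oplus> t [^] (p ^ k))"
    using assms t one_plus_pow_prime_power[OF prime_char char_add_pow t(1)]
    by (simp add: nat_pow_distrib)
  also have "\<dots> = x [^] (p ^ k) \<oplus> (x \<otimes> t) [^] (p ^ k)"
    unfolding nat_pow_distrib[OF assms(1) t(1)] using assms t(1) by (simp add: r_distr)
  finally show ?thesis by (simp add: t)
qed

lemma frobenius_finsum:
  assumes "finite A" "\<And>a. a \<in> A \<Longrightarrow> f a \<in> carrier R"
  shows "(\<Oplus>a\<in>A. f a) [^] (p ^ k) = (\<Oplus>a\<in>A. f a [^] (p ^ k))"
  using assms prime_gt_0_nat[OF prime_char]
  by (induction A rule: finite_induct)
    (auto simp: nat_pow_zero frobenius_add Pi_def intro!: finsum_closed)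

lemma pow_card: "x \<in> carrier R \<Longrightarrow> x [^] card (carrier R) = x"
proof -
  assume x: "x \<in> carrier R"
  have c: "card (carrier R) > 0" using finite_R by (auto simp: card_gt_0_iff)
  show ?thesis
  proof (cases "x = \<zero>")
    case False
    interpret U: group "mult_group R" by (rule field_mult_group)
    have "x [^] (card (carrier R) - 1) = \<one>"
      using U.pow_order_eq_1[of x] x False order_mult_of[OF finite_R]
      by (simp add: Multiplicative_Group.nat_pow_mult_of order_def)
    then have "x [^] Suc (card (carrier R) - 1) = x" using x by simp
    then show ?thesis using c by simp
  qed (use c in \<open>simp add: nat_pow_zero\<close>)
qed

end

text \<open>Phrased through the exponents that give \<open>1\<close>, so that it can be used with
  powers in the field itself; \<open>primitive_roots_eq_ord\<close> links it to orders in the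
  multiplicative group.\<close>

definition primitive_roots :: "('a, 'm) monoid_scheme \<Rightarrow> nat \<Rightarrow> 'a set" where
  "primitive_roots R l = {x \<in> carrier R. \<forall>n::nat. x [^]\<^bsub>R\<^esub> n = \<one>\<^bsub>R\<^esub> \<longleftrightarrow> l dvd n}"

lemma primitive_rootsD:
  assumes "x \<in> primitive_roots R l"
  shows "x \<in> carrier R" "x [^]\<^bsub>R\<^esub> (n::nat) = \<one>\<^bsub>R\<^esub> \<longleftrightarrow> l dvd n"
  using assms by (auto simp: primitive_roots_def)

lemma (in monoid) primitive_root_pow_mod:
  assumes "x \<in> primitive_roots G l"
  shows "x [^] ((a::nat) mod l) = x [^] a"
proof -
  note x = primitive_rootsD[OF assms]
  have "x [^] a = x [^] (l * (a div l) + a mod l)" by simp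
  also have "\<dots> = (x [^] l) [^] (a div l) \<otimes> x [^] (a mod l)"
    by (simp only: nat_pow_mult[OF x(1), symmetric] nat_pow_pow[OF x(1)])
  also have "x [^] l = \<one>" using x(2) by simp
  finally show ?thesis using x(1) by simp
qed

lemma (in monoid) primitive_root_pow_eq_iff:
  assumes "x \<in> primitive_roots G l" "l > 0"
  shows "x [^] (a::nat) = x [^] (b::nat) \<longleftrightarrow> [a = b] (mod l)"
proof
  note x = primitive_rootsD[OF assms(1)]
  assume eq: "x [^] a = x [^] b"
  \<comment> \<open>In a monoid \<open>x [^] b\<close> cannot simply be cancelled; its inverse is
    the power with exponent \<open>(l - 1) * b\<close>, because \<open>l * b\<close> is a multiple
    of \<open>l\<close>.\<close>
  have "x [^] (a + (l - 1) * b) = x [^] (b + (l - 1) * b)"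
    using eq by (simp add: nat_pow_mult[OF x(1), symmetric])
  also have "b + (l - 1) * b = l * b" using assms(2) by (cases l) auto
  also have "x [^] (l * b) = \<one>" using x(2) by simp
  finally have "l dvd a + (l - 1) * b" using x(2) by simp
  then have "[a + (l - 1) * b = 0] (mod l)" by (simp add: cong_0_iff)
  moreover have "[l * b = 0] (mod l)" by (simp add: cong_0_iff)
  ultimately have "[a + (l - 1) * b = l * b] (mod l)" using cong_sym cong_trans by blast
  also have "l * b = b + (l - 1) * b" using assms(2) by (cases l) auto
  finally show "[a = b] (mod l)" by (simp add: cong_add_rcancel_nat)
next
  assume "[a = b] (mod l)"
  then show "x [^] a = x [^] b"
    using primitive_root_pow_mod[OF assms(1), of a] primitive_root_pow_mod[OF assms(1), of b]
    by (simp add: cong_def)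
qed

section \<open>Counting roots of unity in a finite field, and their power sums\<close>

context field
begin

lemma primitive_roots_eq_ord:
  assumes "l > 0"
  shows "primitive_roots R l = {a \<in> carrier (mult_group R).
    group.ord (mult_group R) a = l}"
proof -
  interpret U: group "mult_group R" by (rule field_mult_group)
  have ord: "x [^] n = \<one> \<longleftrightarrow> U.ord x dvd n" if "x \<in> carrier R" "x \<noteq> \<zero>" for x and n :: nat
    using U.pow_eq_id[of x n] that by (simp add: Multiplicative_Group.nat_pow_mult_of)
  show ?thesis
  proof (intro Set.equalityI subsetI)
    fix x assume x: "x \<in> primitive_roots R l"
    note d = primitive_rootsD[OF x]
    have "x \<noteq> \<zero>" using d(2)[of l] assms by (auto simp: nat_pow_zero)
    moreover from this have "U.ord x dvd n \<longleftrightarrow> l dvd n" for n using ord d by simp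
    then have "U.ord x = l" by (meson dvd_antisym dvd_refl)
    ultimately show "x \<in> {a \<in> carrier (mult_group R). U.ord a = l}" using d by simp
  next
    fix x assume "x \<in> {a \<in> carrier (mult_group R). U.ord a = l}"
    then show "x \<in> primitive_roots R l" using ord by (auto simp: primitive_roots_def)
  qed
qed

lemma primitive_roots_one: "primitive_roots R 1 = {\<one>}"
proof -
  have "x = \<one>" if "x \<in> primitive_roots R 1" for x
    using primitive_rootsD(2)[OF that, of 1] primitive_rootsD(1)[OF that] by simp
  then show ?thesis by (auto simp: primitive_roots_def)
qed

text \<open>The count \<open>num_elems_of_ord_eq_phi'\<close> presupposes one element of order
  \<open>l\<close>. It is supplied by \<open>g [^] c\<close>, where \<open>g\<close> generates the
  multiplicative group and \<open>N = c * l\<close> is the order of that group.\<close>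

lemma card_primitive_roots:
  assumes fin: "finite (carrier R)" and l: "l dvd card (carrier R) - 1"
  shows "card (primitive_roots R l) = totient l"
proof -
  interpret U: group "mult_group R" by (rule field_mult_group)
  define N where "N = card (carrier R) - 1"
  have N: "order (mult_group R) = N" using order_mult_of[OF fin] by (simp add: N_def order_def)
  have "card {\<zero>, \<one>} \<le> card (carrier R)" using fin by (intro card_mono) auto
  then have N0: "N > 0" by (simp add: N_def)
  then have l0: "l > 0" using l by (auto simp: N_def intro!: Nat.gr0I)
  obtain g where g: "g \<in> carrier (mult_group R)"
    "carrier (mult_group R) = {g [^] i | i::nat. i \<in> UNIV}"
    using finite_field_mult_group_has_gen[OF fin] by blast
  have "U.ord g = N"
  proof -
    have "carrier (mult_group R) \<subseteq> (\<lambda>i. g [^] i) ` {0..U.ord g - 1}"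
    proof
      fix y assume "y \<in> carrier (mult_group R)"
      then have "y \<in> {g [^]\<^bsub>mult_group R\<^esub> x | x. x \<in> (UNIV :: nat set)}"
        unfolding g(2) by (simp add: Multiplicative_Group.nat_pow_mult_of)
      then have "y \<in> {g [^]\<^bsub>mult_group R\<^esub> x | x. x \<in> {0..U.ord g - 1}}"
        unfolding U.ord_elems[OF finite_mult_of[OF fin] g(1)] .
      then show "y \<in> (\<lambda>i. g [^] i) ` {0..U.ord g - 1}"
        by (auto simp: Multiplicative_Group.nat_pow_mult_of)
    qed
    then have "N \<le> card ((\<lambda>i. g [^] i) ` {0..U.ord g - 1})"
      unfolding N[symmetric] order_def by (intro card_mono) auto
    also have "\<dots> \<le> card {0..U.ord g - 1}" by (intro card_image_le) auto
    finally have "N \<le> U.ord g" using U.ord_ge_1[OF finite_mult_of[OF fin] g(1)] by simp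
    moreover have "U.ord g \<le> N"
      using U.ord_dvd_group_order[OF g(1)] N0 unfolding N by (rule dvd_imp_le)
    ultimately show ?thesis by (rule le_antisym[rotated])
  qed
  then have gN: "g [^] n = \<one> \<longleftrightarrow> N dvd n" for n :: nat
    using U.pow_eq_id[OF g(1), of n] by (simp add: Multiplicative_Group.nat_pow_mult_of)
  obtain c where "N = l * c" using l unfolding N_def by (rule dvdE)
  then have c: "N = c * l" by (simp add: mult.commute)
  have "g [^] c \<in> primitive_roots R l"
    using g(1) c N0 by (auto simp: primitive_roots_def nat_pow_pow gN)
  then have ex: "\<exists>a\<in>carrier (mult_group R). U.ord a = l"
    using primitive_roots_eq_ord[OF l0] by auto
  have "card (primitive_roots R l) = phi' l"
    unfolding primitive_roots_eq_ord[OF l0]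
    using num_elems_of_ord_eq_phi'[OF fin _ ex] l N by (simp add: N_def)
  also have "phi' l = totient l"
    by (auto simp: phi'_def totient_def totatives_def intro!: arg_cong[where f = card])
  finally show ?thesis .
qed

lemma roots_of_unity_decomp:
  assumes "l > 0"
  shows "{x \<in> carrier R. x [^] l = \<one>} = (\<Union>d\<in>{d. d dvd l}. primitive_roots R d)"
proof (intro Set.equalityI subsetI)
  interpret U: group "mult_group R" by (rule field_mult_group)
  fix x assume x: "x \<in> {x \<in> carrier R. x [^] l = \<one>}"
  then have x0: "x \<in> carrier (mult_group R)" using assms by (auto simp: nat_pow_zero)
  have o: "x [^] n = \<one> \<longleftrightarrow> U.ord x dvd n" for n :: nat
    using U.pow_eq_id[OF x0, of n] by (simp add: Multiplicative_Group.nat_pow_mult_of)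
  then have "x \<in> primitive_roots R (U.ord x)" using x0 by (auto simp: primitive_roots_def)
  moreover have "U.ord x dvd l" using o x by simp
  ultimately show "x \<in> (\<Union>d\<in>{d. d dvd l}. primitive_roots R d)" by blast
qed (auto simp: primitive_roots_def)

lemma primitive_roots_disjoint: "pairwise (\<lambda>c d. disjnt (primitive_roots R c) (primitive_roots R d)) A"
proof (clarsimp simp: pairwise_def disjnt_iff)
  fix c d x assume "c \<noteq> d" "x \<in> primitive_roots R c" "x \<in> primitive_roots R d"
  then have "c dvd n \<longleftrightarrow> d dvd n" for n by (auto simp: primitive_roots_def)
  then show False using \<open>c \<noteq> d\<close> by (meson dvd_antisym dvd_refl)
qed

lemma card_roots_of_unity:
  assumes fin: "finite (carrier R)" and l: "l dvd card (carrier R) - 1" "l > 0"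
  shows "card {x \<in> carrier R. x [^] l = \<one>} = l"
proof -
  have "card {x \<in> carrier R. x [^] l = \<one>} = (\<Sum>d\<in>{d. d dvd l}. card (primitive_roots R d))"
    unfolding roots_of_unity_decomp[OF l(2)]
  proof (rule card_UN_disjoint)
    show "\<forall>i\<in>{d. d dvd l}. finite (primitive_roots R i)"
      using fin by (auto simp: primitive_roots_def)
    show "\<forall>i\<in>{d. d dvd l}. \<forall>j\<in>{d. d dvd l}. i \<noteq> j \<longrightarrow> primitive_roots R i \<inter> primitive_roots R j = {}"
      using primitive_roots_disjoint[of UNIV] by (auto simp: pairwise_def disjnt_def)
  qed (use l in simp)
  also have "\<dots> = (\<Sum>d\<in>{d. d dvd l}. totient d)"
    using l by (intro sum.cong) (auto intro!: card_primitive_roots[OF fin] dest: dvd_trans)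
  finally show ?thesis using totient_divisor_sum[of l] by simp
qed

text \<open>Orthogonality: multiplication by a primitive root \<open>w\<close> permutes the
  \<open>l\<close>-th roots, so the sum \<open>S\<close> satisfies \<open>S = w^m S\<close>, and
  \<open>w^m \<noteq> 1\<close> unless \<open>l\<close> divides \<open>m\<close>. The value is
  written as the image of an integer so that it can be compared across fields.\<close>

lemma roots_of_unity_power_sum:
  assumes fin: "finite (carrier R)" and l: "l dvd card (carrier R) - 1" "l > 0"
  shows "(\<Oplus>x\<in>{x \<in> carrier R. x [^] l = \<one>}. x [^] (m::nat)) = [(if l dvd m then int l else 0)] \<cdot> \<one>"
proof -
  let ?U = "{x \<in> carrier R. x [^] l = \<one>}"
  define S where "S = (\<Oplus>x\<in>?U. x [^] m)"
  have S: "S \<in> carrier R" by (auto simp: S_def intro!: finsum_closed)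
  have finU: "finite ?U" using fin by simp
  show ?thesis
  proof (cases "l dvd m")
    case True
    then obtain c where c: "m = l * c" by auto
    have "S = (\<Oplus>x\<in>?U. \<one>)"
      unfolding S_def c by (intro finsum_cong') (auto simp: nat_pow_pow[symmetric])
    also have "\<dots> = [(card ?U)] \<cdot> \<one>" by (simp add: add.finprod_const)
    also have "\<dots> = [(int l)] \<cdot> \<one>"
      unfolding card_roots_of_unity[OF fin l] by (simp add: add_pow_int_ge)
    finally show ?thesis using True by (simp add: S_def)
  next
    case False
    have "card (primitive_roots R l) > 0" using card_primitive_roots[OF fin l(1)] l by simp
    then have "primitive_roots R l \<noteq> {}" by auto
    then obtain w where w: "w \<in> primitive_roots R l" by blast
    note wd = primitive_rootsD[OF w]
    have wl: "w [^] l = \<one>" using wd by simp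
    \<comment> \<open>The inverse of \<open>w\<close>, needed to see that multiplication by
      \<open>w\<close> is injective.\<close>
    define v where "v = w [^] (l - 1)"
    have v: "v \<in> carrier R" "w \<otimes> v = \<one>" "v \<otimes> w = \<one>"
      using wd(1) wl l(2) nat_pow_Suc2[of w "l - 1"] nat_pow_Suc[of w "l - 1"] by (simp_all add: v_def)
    have "v [^] l = (w [^] l) [^] (l - 1)"
      by (simp only: v_def nat_pow_pow[OF wd(1)] mult.commute)
    then have vl: "v [^] l = \<one>" by (simp add: wl)
    have inj: "inj_on (\<lambda>x. w \<otimes> x) ?U"
    proof (rule inj_onI)
      fix x y assume "x \<in> ?U" "y \<in> ?U" "w \<otimes> x = w \<otimes> y"
      then have "v \<otimes> (w \<otimes> x) = v \<otimes> (w \<otimes> y)" by simp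
      then show "x = y" using \<open>x \<in> ?U\<close> \<open>y \<in> ?U\<close> v wd(1) by (simp add: m_assoc[symmetric])
    qed
    have im: "(\<lambda>x. w \<otimes> x) ` ?U = ?U"
    proof (rule card_subset_eq[OF finU])
      show "(\<lambda>x. w \<otimes> x) ` ?U \<subseteq> ?U" using wd(1) wl by (auto simp: nat_pow_distrib)
      show "card ((\<lambda>x. w \<otimes> x) ` ?U) = card ?U" by (rule card_image[OF inj])
    qed
    have "S = (\<Oplus>x\<in>?U. (w \<otimes> x) [^] m)"
      unfolding S_def using add.finprod_reindex[of "\<lambda>x. x [^] m" "\<lambda>x. w \<otimes> x" ?U] inj wd(1)
      by (simp add: im Pi_def)
    also have "\<dots> = w [^] m \<otimes> S"
      unfolding S_def using finU wd(1)
      by (subst finsum_rdistr) (auto intro!: finsum_cong' simp: nat_pow_distrib)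
    finally have "(w [^] m \<ominus> \<one>) \<otimes> S = \<zero>"
      using S wd(1) by (simp add: a_minus_def l_distr l_minus) (metis S r_neg)
    then have "w [^] m \<ominus> \<one> = \<zero> \<or> S = \<zero>" using S wd(1) by (intro integral) auto
    moreover have "w [^] m \<noteq> \<one>" using False wd(2) by simp
    ultimately have "S = \<zero>" using wd(1) by (auto simp: r_right_minus_eq)
    then show ?thesis using False by (simp add: S_def)
  qed
qed

end

text \<open>Ramanujan's sum: the integer whose image in every field containing the primitive \<open>l\<close>-th roots
  of unity is the sum of their \<open>m\<close>-th powers.\<close>

function ramanujan_sum :: "nat \<Rightarrow> nat \<Rightarrow> int" where
  "ramanujan_sum l m = (if l dvd m then int l else 0) - (\<Sum>d\<in>{d. d dvd l \<and> d < l}. ramanujan_sum d m)"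
  by auto
termination by (relation "measure fst") auto

declare ramanujan_sum.simps [simp del]

text \<open>The recursion is this identity solved for its top term; it mirrors the sorting of the
  \<open>l\<close>-th roots of unity by their exact order.\<close>

lemma sum_ramanujan_sum:
  assumes "l > 0"
  shows "(\<Sum>d\<in>{d. d dvd l}. ramanujan_sum d m) = (if l dvd m then int l else 0)"
proof -
  have "{d. d dvd l} = insert l {d. d dvd l \<and> d < l}" using assms by (auto dest: dvd_imp_le)
  then show ?thesis by (simp add: ramanujan_sum.simps[of l m])
qed

text \<open>Both sides obey one recursion: the sum over all \<open>l\<close>-th roots is known, and
  subtracting the primitive roots of each smaller divisor leaves level \<open>l\<close>. Smaller
  levels satisfy the same divisibility, so strong induction applies.\<close>

lemma (in field) primitive_roots_power_sum:
  assumes fin: "finite (carrier R)" and l: "l dvd card (carrier R) - 1" "l > 0"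
  shows "(\<Oplus>x\<in>primitive_roots R l. x [^] m) = [(ramanujan_sum l m)] \<cdot> \<one>"
  using l
proof (induction l rule: less_induct)
  case (less l)
  let ?D = "{d. d dvd l \<and> d < l}"
  let ?S = "\<lambda>d. \<Oplus>x\<in>primitive_roots R d. x [^] m"
  have finD: "finite ?D" by simp
  have finP: "finite (primitive_roots R d)" for d using fin by (simp add: primitive_roots_def)
  have clP: "x [^] m \<in> carrier R" if "x \<in> primitive_roots R d" for d x
    using that by (auto simp: primitive_roots_def)
  have S: "?S d \<in> carrier R" for d using clP by (auto intro!: finsum_closed)
  have D: "{d. d dvd l} = insert l ?D" using less.prems by (auto dest: dvd_imp_le)
  have IH: "?S d = [(ramanujan_sum d m)] \<cdot> \<one>" if "d \<in> ?D" for d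
    using that less.prems by (intro less.IH) (auto intro: dvd_trans dvd_pos_nat)
  have "[(if l dvd m then int l else 0)] \<cdot> \<one> = (\<Oplus>x\<in>(\<Union>d\<in>{d. d dvd l}. primitive_roots R d). x [^] m)"
    using roots_of_unity_power_sum[OF fin less.prems] roots_of_unity_decomp[OF less.prems(2)] by simp
  also have "\<dots> = (\<Oplus>d\<in>{d. d dvd l}. ?S d)"
    using less.prems finP clP by (intro add.finprod_UN_disjoint primitive_roots_disjoint) auto
  also have "\<dots> = ?S l \<oplus> (\<Oplus>d\<in>?D. ?S d)"
    unfolding D using finD S by (subst finsum_insert) auto
  also have "(\<Oplus>d\<in>?D. ?S d) = (\<Oplus>d\<in>?D. [(ramanujan_sum d m)] \<cdot> \<one>)"
    using IH by (intro finsum_cong') auto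
  also have "\<dots> = [(\<Sum>d\<in>?D. ramanujan_sum d m)] \<cdot> \<one>" by (simp add: add_pow_int_one_sum)
  finally have eq: "?S l \<oplus> [(\<Sum>d\<in>?D. ramanujan_sum d m)] \<cdot> \<one> = [(if l dvd m then int l else 0)] \<cdot> \<one>" by simp
  have "?S l = (?S l \<oplus> [(\<Sum>d\<in>?D. ramanujan_sum d m)] \<cdot> \<one>) \<ominus> [(\<Sum>d\<in>?D. ramanujan_sum d m)] \<cdot> \<one>"
    using S[of l] by (simp add: a_minus_def a_assoc r_neg)
  also have "\<dots> = [(if l dvd m then int l else 0)] \<cdot> \<one> \<ominus> [(\<Sum>d\<in>?D. ramanujan_sum d m)] \<cdot> \<one>"
    by (simp only: eq)
  also have "\<dots> = [(ramanujan_sum l m)] \<cdot> \<one>"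
    by (subst ramanujan_sum.simps) (simp add: a_minus_def add.int_pow_diff)
  finally show ?case .
qed

text \<open>Each dimension adjoins the line through some \<open>v\<close> outside \<open>E'\<close>,
  and \<open>k v + u\<close> determines \<open>k\<close> and \<open>u\<close>, so the size is
  multiplied by that of \<open>K\<close>.\<close>

lemma (in ring) card_dimension:
  assumes K: "subfield K R" and finK: "finite K" and dim: "dimension n K E"
  shows "finite E \<and> card E = card K ^ n"
  using dim
proof (induction n arbitrary: E)
  case 0
  then have "E = {\<zero>}" by (rule dimension_zero[OF K])
  then show ?case by simp
next
  case (Suc n)
  obtain v E' where v: "v \<in> carrier R" "dimension n K E'" "v \<notin> E'" "E = line_extension K v E'"
    using dimension_backwards[OF K Suc.prems] by auto
  obtain Vs where Vs: "set Vs \<subseteq> carrier R" "Span K Vs = E'" using exists_base[OF K v(2)] by auto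
  have sub: "subgroup E' (add_monoid R)" using Span_is_add_subgroup[OF K Vs(1)] Vs(2) by simp
  note Ec = add.subgroupE[OF sub]
  have Kc: "K \<subseteq> carrier R" using subfieldE(3)[OF K] .
  note Ks = subringE[OF subfieldE(1)[OF K]]
  let ?f = "\<lambda>(k, u). k \<otimes> v \<oplus> u"
  have E: "E = ?f ` (K \<times> E')" 
    unfolding v(4) by (rule Set.set_eqI) (simp add: line_extension_mem_iff image_iff)
  have "inj_on ?f (K \<times> E')"
  proof (clarsimp simp: inj_on_def)
    fix k u k' u' assume h: "k \<in> K" "u \<in> E'" "k' \<in> K" "u' \<in> E'" "k \<otimes> v \<oplus> u = k' \<otimes> v \<oplus> u'"
    have c: "k \<in> carrier R" "k' \<in> carrier R" "u \<in> carrier R" "u' \<in> carrier R"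
      using h(1-4) Kc Ec(1) by blast+
    have "(k \<ominus> k') \<otimes> v = k \<otimes> v \<ominus> k' \<otimes> v"
      using c v(1) by (simp add: a_minus_def l_distr l_minus)
    also have "\<dots> = u' \<ominus> u" using c v(1) h(5) by (intro minus_eq_minusI) auto
    also have "\<dots> \<in> E'" using Ec(3)[OF h(2)] Ec(4)[OF h(4)] by (simp add: a_minus_def)
    finally have mem: "(k \<ominus> k') \<otimes> v \<in> Span K Vs" using Vs(2) by simp
    have kk: "k = k'"
    proof (rule ccontr)
      assume "k \<noteq> k'"
      \<comment> \<open>A nonzero scalar can be divided out, which would place \<open>v\<close> in
        \<open>E'\<close>.\<close>
      then have "k \<ominus> k' \<in> K - {\<zero>}" using Ks(5,7) h c by (auto simp: a_minus_def r_right_minus_eq[unfolded a_minus_def])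
      then have "v \<in> Span K Vs" using Span_m_inv_simprule[OF K Vs(1)] mem v(1) by blast
      then show False using v(3) Vs(2) by simp
    qed
    have "k' \<otimes> v \<oplus> u = k' \<otimes> v \<oplus> u'" using h(5) unfolding kk .
    then have "u = u'" using c v(1) by simp
    then show "k = k' \<and> u = u'" using kk by simp
  qed
  then have "card E = card K * card E'" unfolding E by (simp add: card_image card_cartesian_product)
  moreover have "finite E" using Suc.IH[OF v(2)] finK unfolding E by simp
  ultimately show ?case using Suc.IH[OF v(2)] by simp
qed

lemma extension_of_degreeD:
  assumes F: "field F" "finite (carrier F)" and ext: "extension_of_degree F d K"
  obtains h where "field K" "ring_hom_cring F K h" "finite (carrier K)"
    "card (carrier K) = card (carrier F) ^ d"
proof -
  interpret F: field F by fact
  have "field K" using ext by (simp add: extension_of_degree_def)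
  then interpret K: field K .
  obtain h where h: "h \<in> ring_hom F K" "K.dimension d (h ` carrier F) (carrier K)"
    using ext by (auto simp: extension_of_degree_def)
  interpret h: ring_hom_ring F K h using h(1) by (intro ring_hom_ringI2) (auto intro: F.ring_axioms K.ring_axioms)
  have hc: "ring_hom_cring F K h" using h(1)
    by (simp add: ring_hom_cring_def ring_hom_cring_axioms_def F.cring_axioms K.cring_axioms)
  have inj: "inj_on h (carrier F)" and sub: "subfield (h ` carrier F) K"
    using h.img_is_subfield[OF F.carrier_is_subfield K.one_not_zero] by auto
  have "finite (carrier K) \<and> card (carrier K) = card (h ` carrier F) ^ d"
    using K.card_dimension[OF sub _ h(2)] F(2) by simp
  then show ?thesis using that[OF \<open>field K\<close> hc] card_image[OF inj] by simp
qed

text \<open>The image of \<open>[p] \<cdot> \<one>\<close> vanishes, so the characteristic of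
  \<open>L\<close> divides the prime \<open>p\<close>; it is not \<open>1\<close> because
  \<open>\<one> \<noteq> \<zero>\<close> in \<open>L\<close>.\<close>

lemma ring_hom_cring_char_field:
  assumes "char_field F p" and L: "field L" "finite (carrier L)" and h: "ring_hom_cring F L h"
  shows "char_field L p"
proof -
  interpret F: char_field F p by fact
  interpret L: field L by fact
  interpret h: ring_hom_cring F L h by fact
  have "h ([(m::nat)] \<cdot>\<^bsub>F\<^esub> \<one>\<^bsub>F\<^esub>) = [m] \<cdot>\<^bsub>L\<^esub> \<one>\<^bsub>L\<^esub>" for m by (induction m) simp_all
  then have "[p] \<cdot>\<^bsub>L\<^esub> \<one>\<^bsub>L\<^esub> = \<zero>\<^bsub>L\<^esub>" using F.char_nat[of p] by (metis dvd_refl h.hom_zero)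
  then have dvd: "ring_characteristic L dvd p"
    using L.add.pow_eq_id[of "\<one>\<^bsub>L\<^esub>" p] by (simp add: ring_characteristic_def)
  have "ring_characteristic L \<noteq> 1"
    using L.add.pow_eq_id[of "\<one>\<^bsub>L\<^esub>" 1] by (auto simp: ring_characteristic_def)
  then have "ring_characteristic L = p" using dvd F.prime_char by (auto simp: prime_nat_iff)
  then show ?thesis using L by (simp add: char_field_def char_field_axioms_def)
qed

lemma ring_hom_cring_field_zero_iff:
  assumes "field F" "field L" "ring_hom_cring F L h" "x \<in> carrier F"
  shows "h x = \<zero>\<^bsub>L\<^esub> \<longleftrightarrow> x = \<zero>\<^bsub>F\<^esub>"
proof
  interpret F: field F by fact
  interpret L: field L by fact
  interpret h: ring_hom_cring F L h by fact
  assume hx: "h x = \<zero>\<^bsub>L\<^esub>"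
  show "x = \<zero>\<^bsub>F\<^esub>"
  proof (rule ccontr)
    assume "x \<noteq> \<zero>\<^bsub>F\<^esub>"
    then have u: "x \<in> Units F" using assms(4) F.field_Units by simp
    then have "h (x \<otimes>\<^bsub>F\<^esub> inv\<^bsub>F\<^esub> x) = h x \<otimes>\<^bsub>L\<^esub> h (inv\<^bsub>F\<^esub> x)" by (intro h.hom_mult) auto
    then show False using hx u by simp
  qed
next
  interpret h: ring_hom_cring F L h by fact
  show "x = \<zero>\<^bsub>F\<^esub> \<Longrightarrow> h x = \<zero>\<^bsub>L\<^esub>" by simp
qed

text \<open>Multiplying by \<open>x ^ (s - u)\<close>, that is by \<open>x ^ (- u)\<close> when \<open>l\<close> divides \<open>s\<close>, and summing over
  the primitive \<open>l\<close>-th roots \<open>x\<close> is the \<open>l\<close>-part of Fourier inversion on the cyclic group of order \<open>s\<close>.\<close>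

lemma vanishing_imp_ramanujan:
  assumes "field F" and L: "field L" "finite (carrier L)" and h: "ring_hom_cring F L h"
    and l: "l dvd card (carrier L) - 1" "l > 0"
    and c: "\<And>t. t < s \<Longrightarrow> c t \<in> carrier F"
    and vanish: "\<And>x. x \<in> primitive_roots L l \<Longrightarrow> (\<Oplus>\<^bsub>L\<^esub>t\<in>{..<s}. h (c t) \<otimes>\<^bsub>L\<^esub> x [^]\<^bsub>L\<^esub> t) = \<zero>\<^bsub>L\<^esub>"
  shows "(\<Oplus>\<^bsub>F\<^esub>t\<in>{..<s}. c t \<otimes>\<^bsub>F\<^esub> [(ramanujan_sum l (t + (s - u)))] \<cdot>\<^bsub>F\<^esub> \<one>\<^bsub>F\<^esub>) = \<zero>\<^bsub>F\<^esub>"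
proof -
  interpret F: field F by fact
  interpret L: field L by fact
  interpret h: ring_hom_cring F L h by fact
  let ?r = "\<lambda>t. c t \<otimes>\<^bsub>F\<^esub> [(ramanujan_sum l (t + (s - u)))] \<cdot>\<^bsub>F\<^esub> \<one>\<^bsub>F\<^esub>"
  let ?P = "primitive_roots L l"
  have finP: "finite ?P" using L by (simp add: primitive_roots_def)
  have xP: "x \<in> carrier L" if "x \<in> ?P" for x using that by (simp add: primitive_roots_def)
  have hc: "h (c t) \<in> carrier L" if "t < s" for t using c[OF that] by simp
  have "\<zero>\<^bsub>L\<^esub> = (\<Oplus>\<^bsub>L\<^esub>x\<in>?P. (\<Oplus>\<^bsub>L\<^esub>t\<in>{..<s}. h (c t) \<otimes>\<^bsub>L\<^esub> x [^]\<^bsub>L\<^esub> t) \<otimes>\<^bsub>L\<^esub> x [^]\<^bsub>L\<^esub> (s - u))"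
    using vanish xP by (intro L.add.finprod_one_eqI[symmetric]) simp
  also have "\<dots> = (\<Oplus>\<^bsub>L\<^esub>x\<in>?P. \<Oplus>\<^bsub>L\<^esub>t\<in>{..<s}. h (c t) \<otimes>\<^bsub>L\<^esub> x [^]\<^bsub>L\<^esub> (t + (s - u)))"
  proof (rule L.finsum_cong')
    fix x assume x: "x \<in> ?P"
    show "(\<Oplus>\<^bsub>L\<^esub>t\<in>{..<s}. h (c t) \<otimes>\<^bsub>L\<^esub> x [^]\<^bsub>L\<^esub> t) \<otimes>\<^bsub>L\<^esub> x [^]\<^bsub>L\<^esub> (s - u) =
        (\<Oplus>\<^bsub>L\<^esub>t\<in>{..<s}. h (c t) \<otimes>\<^bsub>L\<^esub> x [^]\<^bsub>L\<^esub> (t + (s - u)))"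
      using xP[OF x] hc
      by (subst L.finsum_ldistr) (auto intro!: L.finsum_cong' simp: L.m_assoc L.nat_pow_mult)
  qed (use xP hc in \<open>auto intro!: L.finsum_closed\<close>)
  also have "\<dots> = (\<Oplus>\<^bsub>L\<^esub>t\<in>{..<s}. \<Oplus>\<^bsub>L\<^esub>x\<in>?P. h (c t) \<otimes>\<^bsub>L\<^esub> x [^]\<^bsub>L\<^esub> (t + (s - u)))"
    using xP hc finP by (intro L.finsum_swap) auto
  also have "\<dots> = (\<Oplus>\<^bsub>L\<^esub>t\<in>{..<s}. h (?r t))"
  proof (rule L.finsum_cong')
    fix t assume t: "t \<in> {..<s}"
    have "(\<Oplus>\<^bsub>L\<^esub>x\<in>?P. h (c t) \<otimes>\<^bsub>L\<^esub> x [^]\<^bsub>L\<^esub> (t + (s - u))) =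
        h (c t) \<otimes>\<^bsub>L\<^esub> (\<Oplus>\<^bsub>L\<^esub>x\<in>?P. x [^]\<^bsub>L\<^esub> (t + (s - u)))"
      using xP hc t finP by (intro L.finsum_rdistr[symmetric]) auto
    also have "\<dots> = h (?r t)"
      using c t L.primitive_roots_power_sum[OF L(2) l] by (simp add: h.ring.hom_add_pow_int)
    finally show "(\<Oplus>\<^bsub>L\<^esub>x\<in>?P. h (c t) \<otimes>\<^bsub>L\<^esub> x [^]\<^bsub>L\<^esub> (t + (s - u))) =
        h (?r t)" .
  qed (use c in auto)
  also have "\<dots> = h (\<Oplus>\<^bsub>F\<^esub>t\<in>{..<s}. ?r t)"
    using c by (subst h.hom_finsum) (auto simp: o_def)
  finally have "h (\<Oplus>\<^bsub>F\<^esub>t\<in>{..<s}. ?r t) = \<zero>\<^bsub>L\<^esub>"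
    by (rule sym)
  \<comment> \<open>A homomorphism of fields is injective, so the relation holds already in
    \<open>F\<close>, where relations from different levels can be added.\<close>
  then show ?thesis
    using c by (intro ring_hom_cring_field_zero_iff[OF assms(1) L(1) h, THEN iffD1] F.finsum_closed) auto
qed

text \<open>Adding the relations over all \<open>l\<close> dividing \<open>s\<close> replaces the
  Ramanujan sums by \<open>s\<close> where \<open>s\<close> divides \<open>t + (s - u)\<close> and
  by \<open>0\<close> elsewhere. Only \<open>t = u\<close> survives, and \<open>s\<close> is
  invertible.\<close>

lemma (in char_field) ramanujan_vanishing_imp_zero:
  assumes s: "\<not> p dvd s" and c: "\<And>t. t < s \<Longrightarrow> c t \<in> carrier R" and u: "u < s"
    and vanish: "\<And>l. l dvd s \<Longrightarrow> (\<Oplus>t\<in>{..<s}. c t \<otimes> [(ramanujan_sum l (t + (s - u)))] \<cdot> \<one>) = \<zero>"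
  shows "c u = \<zero>"
proof -
  \<comment> \<open>For \<open>t, u < s\<close> the number lies strictly between \<open>0\<close>
    and \<open>2 s\<close>, so the only multiple of \<open>s\<close> it can be is
    \<open>s\<close>.\<close>
  have dv: "s dvd t + (s - u) \<longleftrightarrow> t = u" if "t < s" for t
  proof
    assume "s dvd t + (s - u)"
    then obtain k where k: "t + (s - u) = s * k" by auto
    have "k = 1"
    proof (rule ccontr)
      assume "k \<noteq> 1"
      moreover have "k \<noteq> 0" using k u by (intro notI) simp
      ultimately have "s * 2 \<le> s * k" by (intro mult_le_mono2) simp
      moreover have "t + (s - u) < s * 2" using that u by simp
      ultimately show False using k by linarith
    qed
    then show "t = u" using k u by simp
  qed (use u in simp)
  have "\<zero> = (\<Oplus>l\<in>{l. l dvd s}. \<Oplus>t\<in>{..<s}. c t \<otimes> [(ramanujan_sum l (t + (s - u)))] \<cdot> \<one>)"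
    using vanish by (intro add.finprod_one_eqI[symmetric]) simp
  also have "\<dots> = (\<Oplus>t\<in>{..<s}. \<Oplus>l\<in>{l. l dvd s}. c t \<otimes> [(ramanujan_sum l (t + (s - u)))] \<cdot> \<one>)"
    using u c by (intro finsum_swap) auto
  also have "\<dots> = (\<Oplus>t\<in>{..<s}. if t = u then c u \<otimes> [(int s)] \<cdot> \<one> else \<zero>)"
  proof (rule finsum_cong')
    fix t assume t: "t \<in> {..<s}"
    have "(\<Oplus>l\<in>{l. l dvd s}. c t \<otimes> [(ramanujan_sum l (t + (s - u)))] \<cdot> \<one>) =
        c t \<otimes> (\<Oplus>l\<in>{l. l dvd s}. [(ramanujan_sum l (t + (s - u)))] \<cdot> \<one>)"
      using u c t by (intro finsum_rdistr[symmetric]) auto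
    also have "\<dots> = c t \<otimes> [(\<Sum>l\<in>{l. l dvd s}. ramanujan_sum l (t + (s - u)))] \<cdot> \<one>"
      using u by (subst add_pow_int_one_sum) auto
    also have "(\<Sum>l\<in>{l. l dvd s}. ramanujan_sum l (t + (s - u))) = (if t = u then int s else 0)"
      using u t dv by (subst sum_ramanujan_sum) auto
    finally show "(\<Oplus>l\<in>{l. l dvd s}. c t \<otimes> [(ramanujan_sum l (t + (s - u)))] \<cdot> \<one>) =
        (if t = u then c u \<otimes> [(int s)] \<cdot> \<one> else \<zero>)" using c t by simp
  qed (use c u in auto)
  also have "\<dots> = c u \<otimes> [(int s)] \<cdot> \<one>" using c u by (simp add: finsum_delta)
  finally have "c u = \<zero> \<or> [(int s)] \<cdot> \<one> = \<zero>" using c[OF u] by (intro integral) auto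
  then show ?thesis using s char_int[of "int s"] by simp
qed

text \<open>Raising to the power \<open>q\<close> is additive, fixes the coefficients since they
  come from \<open>F\<close>, and moves the point \<open>x\<close> to \<open>x^q\<close>.\<close>

lemma vanishing_frobenius:
  assumes "char_field F p" "char_field L p" and h: "ring_hom_cring F L h"
    and q: "card (carrier F) = q" "q = p ^ k" and x: "x \<in> carrier L"
    and c: "\<And>t. t < s \<Longrightarrow> c t \<in> carrier F"
    and vanish: "(\<Oplus>\<^bsub>L\<^esub>t\<in>{..<s}. h (c t) \<otimes>\<^bsub>L\<^esub> x [^]\<^bsub>L\<^esub> t) = \<zero>\<^bsub>L\<^esub>"
  shows "(\<Oplus>\<^bsub>L\<^esub>t\<in>{..<s}. h (c t) \<otimes>\<^bsub>L\<^esub> (x [^]\<^bsub>L\<^esub> (q ^ i)) [^]\<^bsub>L\<^esub> (t::nat)) = \<zero>\<^bsub>L\<^esub>"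
proof (induction i)
  interpret F: char_field F p by fact
  interpret L: char_field L p by fact
  interpret h: ring_hom_cring F L h by fact
  have hc: "h (c t) \<in> carrier L" if "t < s" for t using c[OF that] by simp
  case 0
  then show ?case using vanish x by simp
  case (Suc i)
  have q0: "q > 0" using q(1) F.finite_R F.zero_closed by (metis card_gt_0_iff empty_iff)
  define y where "y = x [^]\<^bsub>L\<^esub> (q ^ i)"
  have y: "y \<in> carrier L" "x [^]\<^bsub>L\<^esub> (q ^ Suc i) = y [^]\<^bsub>L\<^esub> q"
    using x by (simp_all add: y_def L.nat_pow_pow mult.commute)
  have hq: "h (c t) [^]\<^bsub>L\<^esub> q = h (c t)" if "t < s" for t
    using F.pow_card[OF c[OF that]] c[OF that] q by (metis h.hom_pow)
  have "\<zero>\<^bsub>L\<^esub> = (\<Oplus>\<^bsub>L\<^esub>t\<in>{..<s}. h (c t) \<otimes>\<^bsub>L\<^esub> y [^]\<^bsub>L\<^esub> t) [^]\<^bsub>L\<^esub> q"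
    using Suc q0 by (simp add: y_def L.nat_pow_zero)
  also have "\<dots> = (\<Oplus>\<^bsub>L\<^esub>t\<in>{..<s}. (h (c t) \<otimes>\<^bsub>L\<^esub> y [^]\<^bsub>L\<^esub> t) [^]\<^bsub>L\<^esub> q)"
    unfolding q(2) using hc y by (intro L.frobenius_finsum) auto
  also have "\<dots> = (\<Oplus>\<^bsub>L\<^esub>t\<in>{..<s}. h (c t) \<otimes>\<^bsub>L\<^esub> (y [^]\<^bsub>L\<^esub> q) [^]\<^bsub>L\<^esub> t)"
    using hc y hq by (intro L.finsum_cong') (auto simp: L.nat_pow_distrib L.nat_pow_pow mult.commute)
  finally show ?case unfolding y(2) ..
qed

text \<open>Two conjugates \<open>x^(q^i)\<close> and \<open>x^(q^j)\<close> agree iff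
  \<open>i\<close> and \<open>j\<close> agree modulo the order \<open>d\<close> of \<open>q\<close>
  modulo \<open>l\<close>. Every orbit thus has exactly \<open>d\<close> elements, and the orbits
  partition the primitive roots; hence exactly \<open>totient l div d\<close> representatives
  suffice.\<close>

lemma (in field) frobenius_orbit_representatives:
  assumes fin: "finite (carrier R)" and l: "l dvd card (carrier R) - 1" "l > 0" and cop: "coprime l q"
  shows "\<exists>\<zeta>. (\<forall>j < totient l div ord l q. \<zeta> j \<in> primitive_roots R l) \<and>
    (\<forall>x\<in>primitive_roots R l. \<exists>j < totient l div ord l q. \<exists>i. x = \<zeta> j [^] (q ^ i))"
proof -
  define P where "P = primitive_roots R l"
  define d where "d = ord l q"
  define orb where "orb = (\<lambda>x. (\<lambda>i. x [^] (q ^ i)) ` {..<d})"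
  have d0: "d > 0" using cop by (simp add: d_def)
  have finP: "finite P" using fin by (simp add: P_def primitive_roots_def)
  have eqi: "x [^] (q ^ i) = x [^] (q ^ j) \<longleftrightarrow> [i = j] (mod d)" if "x \<in> P" for x i j
    using primitive_root_pow_eq_iff[of x l "q ^ i" "q ^ j"] that l order_divides_expdiff[OF cop]
    by (simp add: P_def d_def)
  have orb_iff: "y \<in> orb x \<longleftrightarrow> (\<exists>i. y = x [^] (q ^ i))" if "x \<in> P" for x y
  proof
    assume "\<exists>i. y = x [^] (q ^ i)"
    then obtain i where "y = x [^] (q ^ i)" ..
    also have "\<dots> = x [^] (q ^ (i mod d))" using eqi[OF that] by (simp add: cong_def)
    finally show "y \<in> orb x" using d0 by (auto simp: orb_def)
  qed (auto simp: orb_def)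
  have card_orb: "card (orb x) = d" if "x \<in> P" for x
  proof -
    have "inj_on (\<lambda>i. x [^] (q ^ i)) {..<d}"
      using eqi[OF that] by (auto simp: inj_on_def cong_def)
    then show ?thesis unfolding orb_def by (simp add: card_image)
  qed
  have orb_sub: "orb x \<subseteq> P" if "x \<in> P" for x
  proof
    fix y assume "y \<in> orb x"
    then obtain i where y: "y = x [^] (q ^ i)" by (auto simp: orb_def)
    have "coprime l (q ^ i)" using cop by simp
    \<comment> \<open>As \<open>q\<close> is prime to \<open>l\<close>, taking
      \<open>q ^ i\<close>-th powers preserves the exact order \<open>l\<close>.\<close>
    then have "l dvd q ^ i * m \<longleftrightarrow> l dvd m" for m by (rule coprime_dvd_mult_right_iff)
    then show "y \<in> P" using that y by (auto simp: P_def primitive_roots_def nat_pow_pow)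
  qed
  have orb_eq: "orb y = orb x" if "x \<in> P" "y \<in> orb x" for x y
  proof (rule card_subset_eq)
    have yP: "y \<in> P" using orb_sub that by blast
    have xc: "x \<in> carrier R" using that by (simp add: P_def primitive_roots_def)
    obtain i where y: "y = x [^] (q ^ i)" using \<open>y \<in> orb x\<close> by (auto simp: orb_def)
    show "orb y \<subseteq> orb x"
    proof
      fix z assume "z \<in> orb y"
      then obtain j where "z = y [^] (q ^ j)" by (auto simp: orb_def)
      then have "z = x [^] (q ^ (i + j))" using y xc by (simp add: nat_pow_pow power_add)
      then show "z \<in> orb x" using orb_iff[OF that(1)] by blast
    qed
    show "card (orb y) = card (orb x)" using card_orb yP that by simp
  qed (simp add: orb_def)
  have self: "x \<in> orb x" if "x \<in> P" for x
    using orb_iff[OF that, of x] that by (auto simp: P_def primitive_roots_def intro!: exI[of _ 0])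
  define C where "C = orb ` P"
  have UC: "\<Union>C = P" using self orb_sub by (auto simp: C_def)
  have "d * card C = card (\<Union>C)"
  proof (rule card_partition)
    show "finite C" using finP by (simp add: C_def)
    show "finite (\<Union>C)" using finP UC by simp
    show "card c = d" if "c \<in> C" for c using that card_orb by (auto simp: C_def)
    show "c1 \<inter> c2 = {}" if "c1 \<in> C" "c2 \<in> C" "c1 \<noteq> c2" for c1 c2
    proof (rule ccontr)
      assume "c1 \<inter> c2 \<noteq> {}"
      then obtain z where "z \<in> c1" "z \<in> c2" by blast
      then have "c1 = orb z" "c2 = orb z" using that(1,2) orb_eq by (auto simp: C_def)
      then show False using that(3) by simp
    qed
  qed
  then have "d * card C = totient l" using card_primitive_roots[OF fin l(1)] UC by (simp add: P_def)
  then have cC: "card C = totient l div d" using d0 by (metis nonzero_mult_div_cancel_left less_numeral_extra(3))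
  \<comment> \<open>Numbers the orbits, so that the representatives are indexed by
    \<open>j < card C\<close>.\<close>
  obtain b where b: "bij_betw b {0..<card C} C"
    using ex_bij_betw_nat_finite[of C] finP by (auto simp: C_def)
  define \<zeta> where "\<zeta> = (\<lambda>j. SOME x. x \<in> P \<and> orb x = b j)"
  have \<zeta>: "\<zeta> j \<in> P \<and> orb (\<zeta> j) = b j" if "j < card C" for j
  proof -
    have "b j \<in> C" using b that by (auto simp: bij_betw_def)
    then have "\<exists>x. x \<in> P \<and> orb x = b j" by (auto simp: C_def)
    then show ?thesis unfolding \<zeta>_def by (rule someI_ex)
  qed
  have "\<exists>j < card C. \<exists>i. x = \<zeta> j [^] (q ^ i)" if x: "x \<in> P" for x
  proof -
    have "orb x \<in> b ` {0..<card C}" using b x by (auto simp: bij_betw_def C_def)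
    then obtain j where j: "j < card C" "orb x = b j" by auto
    then have "x \<in> orb (\<zeta> j)" using \<zeta>[OF j(1)] self[OF x] by simp
    then show ?thesis using orb_iff \<zeta>[OF j(1)] j(1) by blast
  qed
  then show ?thesis using \<zeta> unfolding cC P_def d_def by blast
qed

section \<open>The irreducible representations of the dihedral group of order 12\<close>

text \<open>The solution of \<open>u (j + 1) = u j - u (j - 1)\<close> with \<open>u 0 = 0\<close>
  and \<open>u 1 = 1\<close>, which has period 6. If \<open>w^2 = w - 1\<close>, the equation of a
  primitive sixth root of unity, then \<open>w^j = u j * w - u (j - 1)\<close>.\<close>

definition hex_seq :: "int \<Rightarrow> int" where
  "hex_seq j = [0, 1, 1, 0, -1, -1] ! nat (j mod 6)"

text \<open>Index \<open>k < 4\<close> is a linear character. Index \<open>k = 4 * r + 2 * a + b\<close> with \<open>r \<in> {1, 2}\<close> is the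
  entry \<open>(a, b)\<close> of the integral representation sending \<open>x\<close> to the \<open>r\<close>-th power of the companion
  matrix \<open>(0, -1; 1, 1)\<close> of order 6 and \<open>y\<close> to the matrix that swaps the coordinates; the powers
  of the companion matrix are given by the sequence \<open>hex_seq\<close>.\<close>

definition dihedral_entry :: "nat \<Rightarrow> int \<times> bool \<Rightarrow> int" where
  "dihedral_entry k = (\<lambda>(j, c).
     if k < 4 then (if odd k \<and> odd j then -1 else 1) * (if k \<ge> 2 \<and> c then -1 else 1)
     else let r = int (k div 4); a = (k div 2) mod 2; b = (if c then 1 - k mod 2 else k mod 2) in
       if a = 0 then (if b = 0 then - hex_seq (r * j - 1) else - hex_seq (r * j))
       else (if b = 0 then hex_seq (r * j) else hex_seq (r * j + 1)))"

text \<open>The degree times the transposed entry at the inverse group element.\<close>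

definition dihedral_coeff :: "nat \<Rightarrow> int \<times> bool \<Rightarrow> int" where
  "dihedral_coeff k = (\<lambda>(j, c).
     if k < 4 then dihedral_entry k (j, c)
     else 2 * dihedral_entry (4 * (k div 4) + 2 * (k mod 2) + (k div 2) mod 2) (if c then j else - j, c))"

definition dihedral_elements :: "(int \<times> bool) list" where
  "dihedral_elements = [(j, c). j \<leftarrow> [0, 1, 2, 3, 4, 5], c \<leftarrow> [False, True]]"

lemma set_dihedral_elements: "set dihedral_elements = carrier (dihedral_group 6)"
proof -
  have "{0..<6::int} = {0, 1, 2, 3, 4, 5}" by auto
  then show ?thesis by (auto simp: dihedral_elements_def dihedral_group_def UNIV_bool)
qed

text \<open>The sum over \<open>k\<close> is the regular character, the sum of degree times trace,
  at \<open>x^-1 y\<close>. With integral matrices this and the following representation identities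
  are finite integer checks, and they then hold in every field at once.\<close>

lemma dihedral_inversion_list:
  "list_all (\<lambda>x. list_all (\<lambda>y.
     sum_list (map (\<lambda>k. dihedral_coeff k x * dihedral_entry k y) [0..<12]) = (if y = x then 12 else 0))
     dihedral_elements) dihedral_elements"
  by code_simp

lemma dihedral_characters_list:
  "list_all (\<lambda>(i, b). list_all (\<lambda>(j, c). list_all (\<lambda>k.
     dihedral_entry k ((if b then i - j else i + j) mod 6, b \<noteq> c) =
     dihedral_entry k (i, b) * dihedral_entry k (j, c)) [0, 1, 2, 3]) dihedral_elements) dihedral_elements"
  by code_simp

lemma dihedral_matrices_list:
  "list_all (\<lambda>(i, b). list_all (\<lambda>(j, c). list_all (\<lambda>r. list_all (\<lambda>u. list_all (\<lambda>v.
     dihedral_entry (4 * r + 2 * u + v) ((if b then i - j else i + j) mod 6, b \<noteq> c) =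
     dihedral_entry (4 * r + 2 * u) (i, b) * dihedral_entry (4 * r + v) (j, c) +
     dihedral_entry (4 * r + 2 * u + 1) (i, b) * dihedral_entry (4 * r + 2 + v) (j, c))
     [0, 1]) [0, 1]) [1, 2]) dihedral_elements) dihedral_elements"
  by code_simp

lemma dihedral_one_list:
  "list_all (\<lambda>k. dihedral_entry k (0, False) = (if k < 4 \<or> (k div 2) mod 2 = k mod 2 then 1 else 0)) [0..<12]"
  by code_simp

lemma dihedral_inversion:
  assumes "x \<in> carrier (dihedral_group 6)" "y \<in> carrier (dihedral_group 6)"
  shows "(\<Sum>k<12. dihedral_coeff k x * dihedral_entry k y) = (if y = x then 12 else 0)"
proof -
  have "(\<Sum>k<12. dihedral_coeff k x * dihedral_entry k y) =
      sum_list (map (\<lambda>k. dihedral_coeff k x * dihedral_entry k y) [0..<12])"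
    by (simp only: interv_sum_list_conv_sum_set_nat set_upt atLeast0LessThan)
  then show ?thesis
    using dihedral_inversion_list assms unfolding list_all_iff set_dihedral_elements by simp
qed

lemma dihedral_mult:
  "x \<otimes>\<^bsub>dihedral_group m\<^esub> y =
    ((if snd x then fst x - fst y else fst x + fst y) mod int m, snd x \<noteq> snd y)"
  by (cases x; cases y) (simp add: dihedral_group_def)

lemma dihedral_character_mult:
  assumes "x \<in> carrier (dihedral_group 6)" "y \<in> carrier (dihedral_group 6)" "k < 4"
  shows "dihedral_entry k (x \<otimes>\<^bsub>dihedral_group 6\<^esub> y) = dihedral_entry k x * dihedral_entry k y"
proof -
  have "k \<in> set [0, 1, 2, 3]" using assms(3) by auto
  then show ?thesis
    using bspec[OF bspec[OF dihedral_characters_list[unfolded list_all_iff set_dihedral_elements] assms(1),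
        unfolded case_prod_unfold] assms(2), THEN bspec[of _ _ k]]
    by (simp only: dihedral_mult prod.collapse fst_conv snd_conv of_nat_numeral True_implies_equals)
qed

lemma dihedral_matrix_mult:
  assumes "x \<in> carrier (dihedral_group 6)" "y \<in> carrier (dihedral_group 6)"
    and "r \<in> {1, 2}" "u < 2" "v < 2"
  shows "dihedral_entry (4 * r + 2 * u + v) (x \<otimes>\<^bsub>dihedral_group 6\<^esub> y) =
    (\<Sum>w<2. dihedral_entry (4 * r + 2 * u + w) x * dihedral_entry (4 * r + 2 * w + v) y)"
proof -
  have "u \<in> set [0, 1]" "v \<in> set [0, 1]" "r \<in> set [1, 2]" using assms(3-5) by auto
  then have "dihedral_entry (4 * r + 2 * u + v) (x \<otimes>\<^bsub>dihedral_group 6\<^esub> y) =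
      dihedral_entry (4 * r + 2 * u) x * dihedral_entry (4 * r + v) y +
      dihedral_entry (4 * r + 2 * u + 1) x * dihedral_entry (4 * r + 2 + v) y"
    using bspec[OF bspec[OF dihedral_matrices_list[unfolded list_all_iff set_dihedral_elements] assms(1),
        unfolded case_prod_unfold] assms(2), THEN bspec[of _ _ r], THEN bspec[of _ _ u], THEN bspec[of _ _ v]]
    by (simp only: dihedral_mult prod.collapse fst_conv snd_conv of_nat_numeral True_implies_equals)
  moreover have "(\<Sum>w<2. f w) = f 0 + f 1" for f :: "nat \<Rightarrow> int" by (simp add: numeral_2_eq_2)
  ultimately show ?thesis by (simp only: mult_0_right add_0_right mult_1_right)
qed

lemma dihedral_one:
  "k < 12 \<Longrightarrow> dihedral_entry k \<one>\<^bsub>dihedral_group 6\<^esub> = (if k < 4 \<or> (k div 2) mod 2 = k mod 2 then 1 else 0)"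
  using dihedral_one_list by (simp add: list_all_iff dihedral_group_def)

section \<open>The block maps\<close>

locale dihedral_algebra = char_field F p for F (structure) and p +
  fixes n s r :: nat
  assumes p_gt_3: "p > 3" and n_eq: "n = p ^ r * s" and coprime_ps: "coprime p s"
begin

lemma s_pos: "s > 0"
  using coprime_ps p_gt_3 by (cases s) auto

lemma n_pos: "n > 0"
  using s_pos p_gt_3 by (simp add: n_eq)

lemma not_p_dvd_s: "\<not> p dvd s"
  using coprime_common_divisor_nat[OF coprime_ps dvd_refl] p_gt_3 by auto

text \<open>Inversion on the dihedral group divides by its order 12, whose prime factors are 2 and
  3.\<close>

lemma twelve_nonzero: "[(12::int)] \<cdot> \<one> \<noteq> \<zero>"
proof
  assume "[(12::int)] \<cdot> \<one> = \<zero>"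
  then have "int p dvd int 12" using char_int[of 12] by simp
  then have "p dvd 2 * 2 * 3" by (simp only: int_dvd_int_iff) simp
  then have "p dvd 2 \<or> p dvd 3" using prime_char by (simp only: prime_dvd_mult_iff) blast
  then show False using p_gt_3 by (auto dest: dvd_imp_le)
qed

abbreviation D where "D \<equiv> dihedral_group 6"
abbreviation G where "G \<equiv> integer_mod_group n \<times>\<times> dihedral_group 6"

lemma carrier_D: "carrier D = {0..<6} \<times> UNIV"
  by (simp add: dihedral_group_def)

lemma finite_D: "finite (carrier D)"
  by (simp add: carrier_D)

lemma card_D: "card (carrier D) = 12"
  by (simp add: carrier_D card_cartesian_product UNIV_bool)

lemma carrier_G: "carrier G = {0..<int n} \<times> carrier D"
  using n_pos by (simp add: carrier_integer_mod_group)

sublocale finite_group_algebra F G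
proof (intro finite_group_algebra.intro finite_group_algebra_axioms.intro)
  show "finite (carrier G)" by (simp only: carrier_G) (simp add: finite_D)
qed (simp_all add: cring_axioms DirProd_group dihedral_group_is_group)

text \<open>Cyclic exponents are split by division with remainder by \<open>s\<close>. For fixed
  \<open>t\<close> the index \<open>m\<close> runs through a coset of the subgroup of order
  \<open>p ^ r\<close>, and an \<open>s\<close>-th root of unity sees only \<open>t\<close>.\<close>

lemma carrier_G_image:
  "carrier G = (\<lambda>(x, t, m). (int (t + s * m), x)) ` (carrier D \<times> {..<s} \<times> {..<p ^ r})"
proof (intro Set.equalityI subsetI)
  fix g assume "g \<in> carrier G"
  then obtain i x where g: "g = (int i, x)" "i < n" "x \<in> carrier D"
    unfolding carrier_G by (auto simp: zero_le_imp_eq_int elim!: nonneg_int_cases)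
  have "i div s < p ^ r" using g(2) by (simp add: n_eq div_less_iff_less_mult s_pos)
  moreover have "i mod s < s" using s_pos by simp
  moreover have "g = (int (i mod s + s * (i div s)), x)" using g by (simp only: mod_mult_div_eq)
  ultimately show "g \<in> (\<lambda>(x, t, m). (int (t + s * m), x)) ` (carrier D \<times> {..<s} \<times> {..<p ^ r})"
    using g(3) by (intro image_eqI[of _ _ "(x, i mod s, i div s)"]) (auto simp del: of_nat_add of_nat_mult)
next
  fix g assume "g \<in> (\<lambda>(x, t, m). (int (t + s * m), x)) ` (carrier D \<times> {..<s} \<times> {..<p ^ r})"
  then obtain x t m where g: "g = (int (t + s * m), x)" "x \<in> carrier D" "t < s" "m < p ^ r" by auto
  have "t + s * m < s * Suc m" using g by simp
  also have "\<dots> \<le> s * p ^ r" using g by (intro mult_le_mono2) simp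
  finally have "t + s * m < n" by (simp add: n_eq mult.commute)
  then show "g \<in> carrier G" unfolding carrier_G using g by (simp del: of_nat_add of_nat_mult)
qed

lemma in_carrier_G: "x \<in> carrier D \<Longrightarrow> t < s \<Longrightarrow> m < p ^ r \<Longrightarrow> (int (t + s * m), x) \<in> carrier G"
  unfolding carrier_G_image by force

lemma inj_carrier_G: "inj_on (\<lambda>(x, t, m). (int (t + s * m), x)) (carrier D \<times> {..<s} \<times> {..<p ^ r})"
proof (clarsimp simp: inj_on_def)
  fix t m t' m' assume h: "t < s" "t' < s" "int t + int s * int m = int t' + int s * int m'"
  then have eq: "t + s * m = t' + s * m'" by (metis of_nat_add of_nat_eq_iff of_nat_mult)
  then have "(t + s * m) mod s = (t' + s * m') mod s" by simp
  then have "t = t'" using h by simp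
  then show "t = t' \<and> m = m'" using eq s_pos by simp
qed

text \<open>The coefficient at \<open>(t, x)\<close> of the image of \<open>f\<close> in the group
  algebra of the quotient by the \<open>p\<close>-subgroup, that is of C_s x D12.\<close>

definition reduce :: "(int \<times> int \<times> bool \<Rightarrow> 'a) \<Rightarrow> nat \<Rightarrow> int \<times> bool \<Rightarrow> 'a" where
  "reduce f t x = (\<Oplus>m\<in>{..<p ^ r}. f (int (t + s * m), x))"

lemma reduce_closed: "f \<in> carrier FG \<Longrightarrow> t < s \<Longrightarrow> x \<in> carrier D \<Longrightarrow> reduce f t x \<in> carrier F"
  unfolding reduce_def by (intro finsum_closed) (auto intro!: in_FG in_carrier_G simp del: of_nat_add of_nat_mult carrier_DirProd)

end

lemma (in dihedral_algebra) finsum_G: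
  assumes "abelian_monoid R" "\<And>g. g \<in> carrier G \<Longrightarrow> f g \<in> carrier R"
  shows "(\<Oplus>\<^bsub>R\<^esub>g\<in>carrier G. f g) =
    (\<Oplus>\<^bsub>R\<^esub>x\<in>carrier D. \<Oplus>\<^bsub>R\<^esub>t\<in>{..<s}. \<Oplus>\<^bsub>R\<^esub>m\<in>{..<p ^ r}. f (int (t + s * m), x))"
proof -
  interpret R: abelian_monoid R by fact
  have cl: "f (int (t + s * m), x) \<in> carrier R" if "x \<in> carrier D" "t < s" "m < p ^ r" for x t m
    using assms(2) in_carrier_G[OF that] by blast
  have "(\<Oplus>\<^bsub>R\<^esub>g\<in>carrier G. f g) =
      (\<Oplus>\<^bsub>R\<^esub>z\<in>carrier D \<times> ({..<s} \<times> {..<p ^ r}). f ((\<lambda>(x, t, m). (int (t + s * m), x)) z))"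
    unfolding carrier_G_image using cl by (intro R.finsum_reindex inj_carrier_G) auto
  also have "\<dots> = (\<Oplus>\<^bsub>R\<^esub>x\<in>carrier D. \<Oplus>\<^bsub>R\<^esub>y\<in>{..<s} \<times> {..<p ^ r}. f ((\<lambda>(x, t, m). (int (t + s * m), x)) (x, y)))"
    using cl finite_D by (intro R.finsum_Times) (auto simp del: of_nat_add of_nat_mult)
  also have "\<dots> = (\<Oplus>\<^bsub>R\<^esub>x\<in>carrier D. \<Oplus>\<^bsub>R\<^esub>t\<in>{..<s}. \<Oplus>\<^bsub>R\<^esub>m\<in>{..<p ^ r}. f (int (t + s * m), x))"
  proof (rule R.finsum_cong')
    fix x assume x: "x \<in> carrier D"
    show "(\<Oplus>\<^bsub>R\<^esub>y\<in>{..<s} \<times> {..<p ^ r}. f ((\<lambda>(x, t, m). (int (t + s * m), x)) (x, y))) =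
        (\<Oplus>\<^bsub>R\<^esub>t\<in>{..<s}. \<Oplus>\<^bsub>R\<^esub>m\<in>{..<p ^ r}. f (int (t + s * m), x))"
      using x cl by (subst R.finsum_Times) (auto simp del: of_nat_add of_nat_mult)
  qed (use cl in \<open>auto simp del: of_nat_add of_nat_mult intro!: R.finsum_closed\<close>)
  finally show ?thesis .
qed

locale dihedral_block = dihedral_algebra F p n s r + L: field L
  for F (structure) and p n s r and L :: "('e, 'f) ring_scheme" +
  fixes h :: "'a \<Rightarrow> 'e" and \<zeta> :: 'e
  assumes finite_L: "finite (carrier L)" and hom: "ring_hom_cring F L h"
    and zeta: "\<zeta> \<in> carrier L" "\<zeta> [^]\<^bsub>L\<^esub> s = \<one>\<^bsub>L\<^esub>"
begin

sublocale h: ring_hom_cring F L h by (rule hom)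

sublocale L: char_field L p
  by (rule ring_hom_cring_char_field[OF _ L.field_axioms finite_L hom]) (rule char_field_axioms)

definition component :: "nat \<Rightarrow> (int \<times> int \<times> bool \<Rightarrow> 'a) \<Rightarrow> 'e" where
  "component k = linear_extension L h
     (\<lambda>(i, x). \<zeta> [^]\<^bsub>L\<^esub> nat i \<otimes>\<^bsub>L\<^esub> [(dihedral_entry k x)] \<cdot>\<^bsub>L\<^esub> \<one>\<^bsub>L\<^esub>)"

text \<open>The coefficient of \<open>x\<close> in the element of \<open>L[D12]\<close> obtained
  from \<open>f\<close> by sending the cyclic generator to \<open>\<zeta>\<close>.\<close>

definition evaluate :: "(int \<times> int \<times> bool \<Rightarrow> 'a) \<Rightarrow> int \<times> bool \<Rightarrow> 'e" where
  "evaluate f x = (\<Oplus>\<^bsub>L\<^esub>t\<in>{..<s}. h (reduce f t x) \<otimes>\<^bsub>L\<^esub> \<zeta> [^]\<^bsub>L\<^esub> t)"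

text \<open>The matrix factors are numbered from \<open>0\<close>, the two-dimensional
  representations of \<open>dihedral_entry\<close> from \<open>1\<close>, hence
  \<open>Suc r\<close>; this \<open>r\<close> is bound here and is not the exponent of
  \<open>p\<close>.\<close>

definition block_map :: "(int \<times> int \<times> bool \<Rightarrow> 'a) \<Rightarrow> (nat \<Rightarrow> 'e) \<times> (nat \<Rightarrow> nat \<times> nat \<Rightarrow> 'e)" where
  "block_map f = ((\<lambda>k\<in>{..<4}. component k f),
     (\<lambda>r\<in>{..<2}. \<lambda>(a, b)\<in>{..<2} \<times> {..<2}. component (4 * Suc r + 2 * a + b) f))"

lemma zeta_pow_mod: "\<zeta> [^]\<^bsub>L\<^esub> (a mod n) = \<zeta> [^]\<^bsub>L\<^esub> (a::nat)"
proof -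
  have "\<zeta> [^]\<^bsub>L\<^esub> n = \<one>\<^bsub>L\<^esub>"
    using zeta by (simp add: n_eq mult.commute[of "p ^ r"] flip: L.nat_pow_pow)
  moreover have "\<zeta> [^]\<^bsub>L\<^esub> a = (\<zeta> [^]\<^bsub>L\<^esub> n) [^]\<^bsub>L\<^esub> (a div n) \<otimes>\<^bsub>L\<^esub> \<zeta> [^]\<^bsub>L\<^esub> (a mod n)"
    by (simp only: L.nat_pow_pow[OF zeta(1)] L.nat_pow_mult[OF zeta(1)] mult_div_mod_eq)
  ultimately show ?thesis using zeta(1) by simp
qed

lemma component_rep_closed:
  "(case g of (i, x) \<Rightarrow> \<zeta> [^]\<^bsub>L\<^esub> nat i \<otimes>\<^bsub>L\<^esub> [(dihedral_entry k x)] \<cdot>\<^bsub>L\<^esub> \<one>\<^bsub>L\<^esub>) \<in> carrier L"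
  using zeta(1) by (cases g) simp

lemma component_closed: "f \<in> carrier FG \<Longrightarrow> component k f \<in> carrier L"
  unfolding component_def by (rule linear_extension_closed[OF hom component_rep_closed])

text \<open>\<open>K a b\<close> is the index of the entry \<open>(a, b)\<close> of the
  representation, so that one statement covers characters and matrices.\<close>

lemma component_mult:
  fixes m :: nat and K :: "nat \<Rightarrow> nat \<Rightarrow> nat"
  assumes f: "f \<in> carrier FG" and g: "g \<in> carrier FG" and ab: "a < m" "b < m"
    and K: "\<And>x y a b. x \<in> carrier D \<Longrightarrow> y \<in> carrier D \<Longrightarrow> a < m \<Longrightarrow> b < m \<Longrightarrow>
      dihedral_entry (K a b) (x \<otimes>\<^bsub>D\<^esub> y) = (\<Sum>c<m. dihedral_entry (K a c) x * dihedral_entry (K c b) y)"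
  shows "component (K a b) (f \<otimes>\<^bsub>FG\<^esub> g) =
    (\<Oplus>\<^bsub>L\<^esub>c\<in>{..<m}. component (K a c) f \<otimes>\<^bsub>L\<^esub> component (K c b) g)"
  unfolding component_def
proof (rule linear_extension_mult[OF hom component_rep_closed _ f g ab])
  fix u v :: "int \<times> int \<times> bool" and a b :: nat
  assume uv: "u \<in> carrier G" "v \<in> carrier G" and ab: "a < m" "b < m"
  obtain i x j y where ij: "u = (i, x)" "v = (j, y)" "0 \<le> i" "0 \<le> j" "x \<in> carrier D" "y \<in> carrier D"
    using uv unfolding carrier_G by auto
  let ?z = "\<lambda>i::int. \<zeta> [^]\<^bsub>L\<^esub> nat i" and ?e = "\<lambda>k x. [(dihedral_entry k x)] \<cdot>\<^bsub>L\<^esub> \<one>\<^bsub>L\<^esub>"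
  have "nat ((i + j) mod int n) = (nat i + nat j) mod n" using ij by (simp add: nat_mod_distrib nat_add_distrib)
  then have z: "?z ((i + j) mod int n) = ?z i \<otimes>\<^bsub>L\<^esub> ?z j"
    using zeta(1) by (simp add: zeta_pow_mod L.nat_pow_mult)
  have e: "?e (K a b) (x \<otimes>\<^bsub>D\<^esub> y) = (\<Oplus>\<^bsub>L\<^esub>c\<in>{..<m}. ?e (K a c) x \<otimes>\<^bsub>L\<^esub> ?e (K c b) y)"
    unfolding K[OF ij(5,6) ab] by (simp add: L.add_pow_int_one_sum L.add_pow_int_one_mult)
  have "(\<Oplus>\<^bsub>L\<^esub>c\<in>{..<m}. (?z i \<otimes>\<^bsub>L\<^esub> ?e (K a c) x) \<otimes>\<^bsub>L\<^esub> (?z j \<otimes>\<^bsub>L\<^esub> ?e (K c b) y)) =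
      (\<Oplus>\<^bsub>L\<^esub>c\<in>{..<m}. (?z i \<otimes>\<^bsub>L\<^esub> ?z j) \<otimes>\<^bsub>L\<^esub> (?e (K a c) x \<otimes>\<^bsub>L\<^esub> ?e (K c b) y))"
    using zeta(1) by (intro L.finsum_cong') (auto simp: L.m_ac)
  also have "\<dots> = (?z i \<otimes>\<^bsub>L\<^esub> ?z j) \<otimes>\<^bsub>L\<^esub> ?e (K a b) (x \<otimes>\<^bsub>D\<^esub> y)"
    unfolding e using zeta(1) by (intro L.finsum_rdistr[symmetric]) auto
  finally show "(case u \<otimes>\<^bsub>G\<^esub> v of (i, x) \<Rightarrow> ?z i \<otimes>\<^bsub>L\<^esub> ?e (K a b) x) =
      (\<Oplus>\<^bsub>L\<^esub>c\<in>{..<m}. (case u of (i, x) \<Rightarrow> ?z i \<otimes>\<^bsub>L\<^esub> ?e (K a c) x) \<otimes>\<^bsub>L\<^esub>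
        (case v of (i, x) \<Rightarrow> ?z i \<otimes>\<^bsub>L\<^esub> ?e (K c b) x))"
    unfolding ij by (simp add: z)
qed

lemma block_map_closed: "f \<in> carrier FG \<Longrightarrow> block_map f \<in> carrier (block L)"
  by (auto simp: block_map_def component_closed matrix_monoid_simps split: if_splits)

lemma block_map_mult:
  assumes f: "f \<in> carrier FG" and g: "g \<in> carrier FG"
  shows "block_map (f \<otimes>\<^bsub>FG\<^esub> g) = block_map f \<otimes>\<^bsub>block L\<^esub> block_map g"
proof -
  \<comment> \<open>A linear character is a representation with \<open>m = 1\<close> and a constant
    index function.\<close>
  have char: "component k (f \<otimes>\<^bsub>FG\<^esub> g) = component k f \<otimes>\<^bsub>L\<^esub> component k g" if "k < 4" for k
    using component_mult[OF f g, of 0 1 0 "\<lambda>_ _. k"] dihedral_character_mult that component_closed f g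
    by (simp add: lessThan_Suc)
  have mat: "component (4 * Suc i + 2 * a + b) (f \<otimes>\<^bsub>FG\<^esub> g) =
      (\<Oplus>\<^bsub>L\<^esub>c\<in>{..<2}. component (4 * Suc i + 2 * a + c) f \<otimes>\<^bsub>L\<^esub> component (4 * Suc i + 2 * c + b) g)"
    if "i < 2" "a < 2" "b < 2" for i a b
  proof -
    have "Suc i \<in> {1, 2}" using that by auto
    then show ?thesis
      using that by (intro component_mult[OF f g, of a 2 b "\<lambda>a b. 4 * Suc i + 2 * a + b"] dihedral_matrix_mult)
  qed
  show ?thesis
    by (auto simp: block_map_def char fun_eq_iff matrix_monoid_def mat simp del: mult_Suc_right intro!: L.finsum_cong' component_closed[OF f] component_closed[OF g])
qed

lemma block_map_one: "block_map \<one>\<^bsub>FG\<^esub> = \<one>\<^bsub>block L\<^esub>"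
proof -
  have "\<one>\<^bsub>G\<^esub> \<in> carrier G" by (rule G.one_closed)
  then have "component k \<one>\<^bsub>FG\<^esub> = [(dihedral_entry k \<one>\<^bsub>D\<^esub>)] \<cdot>\<^bsub>L\<^esub> \<one>\<^bsub>L\<^esub>" for k
    unfolding component_def one_eq_delta
    by (subst linear_extension_delta[OF hom component_rep_closed]) (auto simp: zeta)
  then have c: "component k \<one>\<^bsub>FG\<^esub> = (if k < 4 \<or> (k div 2) mod 2 = k mod 2 then \<one>\<^bsub>L\<^esub> else \<zero>\<^bsub>L\<^esub>)" if "k < 12" for k
    using dihedral_one[OF that] by (simp add: add_pow_int_ge)
  have "component (4 * Suc i + 2 * a + b) \<one>\<^bsub>FG\<^esub> = (if a = b then \<one>\<^bsub>L\<^esub> else \<zero>\<^bsub>L\<^esub>)"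
    if "i < 2" "a < 2" "b < 2" for i a b
  proof -
    have "4 * Suc i + 2 * a + b < 12" "\<not> 4 * Suc i + 2 * a + b < 4" using that by auto
    moreover have "((4 * Suc i + 2 * a + b) div 2) mod 2 = a" "(4 * Suc i + 2 * a + b) mod 2 = b"
      using that by presburger+
    ultimately show ?thesis using c by simp
  qed
  then show ?thesis using c
    by (auto simp: block_map_def fun_eq_iff matrix_monoid_def simp del: mult_Suc_right)
qed

lemma component_minus:
  assumes f: "f \<in> carrier FG" and g: "g \<in> carrier FG"
  shows "component k (f \<ominus>\<^bsub>FG\<^esub> g) = component k f \<ominus>\<^bsub>L\<^esub> component k g"
proof -
  interpret FG: ring FG by (rule ring_FG)
  let ?e = "\<lambda>g. case g of (i, x) \<Rightarrow> \<zeta> [^]\<^bsub>L\<^esub> nat i \<otimes>\<^bsub>L\<^esub> [(dihedral_entry k x)] \<cdot>\<^bsub>L\<^esub> \<one>\<^bsub>L\<^esub>"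
  have fg: "f \<ominus>\<^bsub>FG\<^esub> g \<in> carrier FG" using f g by (rule FG.minus_closed)
  have e: "?e x \<in> carrier L" for x by (rule component_rep_closed)
  have "component k (f \<ominus>\<^bsub>FG\<^esub> g) \<oplus>\<^bsub>L\<^esub> component k g =
      (\<Oplus>\<^bsub>L\<^esub>x\<in>carrier G. h ((f \<ominus>\<^bsub>FG\<^esub> g) x) \<otimes>\<^bsub>L\<^esub> ?e x \<oplus>\<^bsub>L\<^esub> h (g x) \<otimes>\<^bsub>L\<^esub> ?e x)"
    unfolding component_def linear_extension_def
    using in_FG[OF fg] in_FG[OF g] e by (intro L.finsum_addf[symmetric]) auto
  also have "\<dots> = component k f"
    unfolding component_def linear_extension_def
  proof (rule L.finsum_cong')
    fix x assume x: "x \<in> carrier G"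
    have "h ((f \<ominus>\<^bsub>FG\<^esub> g) x) \<otimes>\<^bsub>L\<^esub> ?e x \<oplus>\<^bsub>L\<^esub> h (g x) \<otimes>\<^bsub>L\<^esub> ?e x = h ((f \<ominus>\<^bsub>FG\<^esub> g) x \<oplus> g x) \<otimes>\<^bsub>L\<^esub> ?e x"
      using in_FG[OF fg x] in_FG[OF g x] e[of x] by (simp add: L.l_distr)
    also have "(f \<ominus>\<^bsub>FG\<^esub> g) x \<oplus> g x = f x"
      unfolding FG_minus[OF f g x] using in_FG[OF f x] in_FG[OF g x] by (simp add: a_minus_def a_assoc l_neg)
    finally show "h ((f \<ominus>\<^bsub>FG\<^esub> g) x) \<otimes>\<^bsub>L\<^esub> ?e x \<oplus>\<^bsub>L\<^esub> h (g x) \<otimes>\<^bsub>L\<^esub> ?e x = h (f x) \<otimes>\<^bsub>L\<^esub> ?e x" .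
  qed (use in_FG[OF f] e in auto)
  finally have "component k f = component k (f \<ominus>\<^bsub>FG\<^esub> g) \<oplus>\<^bsub>L\<^esub> component k g" ..
  then show ?thesis using component_closed[OF fg] component_closed[OF g]
    by (simp add: a_minus_def L.a_assoc L.r_neg)
qed

lemma evaluate_closed:
  "f \<in> carrier FG \<Longrightarrow> x \<in> carrier D \<Longrightarrow> evaluate f x \<in> carrier L"
  unfolding evaluate_def using zeta(1) by (intro L.finsum_closed) (auto simp: reduce_closed)

text \<open>Since \<open>\<zeta>^s = 1\<close>, the power of \<open>\<zeta>\<close> at
  \<open>t + s * m\<close> does not depend on \<open>m\<close>, and summing over \<open>m\<close>
  leaves the reduced coefficient. Every component therefore factors through
  \<open>reduce\<close>.\<close>

lemma component_eq:
  assumes f: "f \<in> carrier FG"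
  shows "component k f = (\<Oplus>\<^bsub>L\<^esub>x\<in>carrier D. evaluate f x \<otimes>\<^bsub>L\<^esub> [(dihedral_entry k x)] \<cdot>\<^bsub>L\<^esub> \<one>\<^bsub>L\<^esub>)"
proof -
  let ?u = "\<lambda>x t m. h (f (int (t + s * m), x)) \<otimes>\<^bsub>L\<^esub> (\<zeta> [^]\<^bsub>L\<^esub> (t + s * m) \<otimes>\<^bsub>L\<^esub> [(dihedral_entry k x)] \<cdot>\<^bsub>L\<^esub> \<one>\<^bsub>L\<^esub>)"
  let ?e = "\<lambda>x. [(dihedral_entry k x)] \<cdot>\<^bsub>L\<^esub> \<one>\<^bsub>L\<^esub>"
  have cl: "h (f (int (t + s * m), x)) \<in> carrier L" if "x \<in> carrier D" "t < s" "m < p ^ r" for x t m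
    using in_FG[OF f in_carrier_G[OF that]] by simp
  have "component k f = (\<Oplus>\<^bsub>L\<^esub>x\<in>carrier D. \<Oplus>\<^bsub>L\<^esub>t\<in>{..<s}. \<Oplus>\<^bsub>L\<^esub>m\<in>{..<p ^ r}.
      ?u x t m)"
    unfolding component_def linear_extension_def
    using in_FG[OF f] component_rep_closed
    by (subst finsum_G) (auto simp del: of_nat_add of_nat_mult carrier_DirProd intro: L.abelian_monoid_axioms)
  also have "\<dots> = (\<Oplus>\<^bsub>L\<^esub>x\<in>carrier D. evaluate f x \<otimes>\<^bsub>L\<^esub> ?e x)"
  proof (rule L.finsum_cong')
    fix x assume x: "x \<in> carrier D"
    have zt: "\<zeta> [^]\<^bsub>L\<^esub> (t + s * m) = \<zeta> [^]\<^bsub>L\<^esub> t" for t m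
      using zeta by (simp flip: L.nat_pow_mult L.nat_pow_pow)
    have "(\<Oplus>\<^bsub>L\<^esub>m\<in>{..<p ^ r}. ?u x t m) =
        (h (reduce f t x) \<otimes>\<^bsub>L\<^esub> \<zeta> [^]\<^bsub>L\<^esub> t) \<otimes>\<^bsub>L\<^esub> ?e x" if t: "t < s" for t
    proof -
      have "(\<Oplus>\<^bsub>L\<^esub>m\<in>{..<p ^ r}. ?u x t m) =
          (\<Oplus>\<^bsub>L\<^esub>m\<in>{..<p ^ r}. h (f (int (t + s * m), x))) \<otimes>\<^bsub>L\<^esub> (\<zeta> [^]\<^bsub>L\<^esub> t \<otimes>\<^bsub>L\<^esub> ?e x)"
        unfolding zt using cl[OF x t] zeta(1) by (intro L.finsum_ldistr[symmetric]) auto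
      also have "(\<Oplus>\<^bsub>L\<^esub>m\<in>{..<p ^ r}. h (f (int (t + s * m), x))) = h (reduce f t x)"
        unfolding reduce_def using in_FG[OF f in_carrier_G[OF x t]]
        by (subst h.hom_finsum) (auto simp: o_def simp del: of_nat_add of_nat_mult)
      finally show ?thesis using reduce_closed[OF f t x] zeta(1) by (simp add: L.m_assoc)
    qed
    then have "(\<Oplus>\<^bsub>L\<^esub>t\<in>{..<s}. \<Oplus>\<^bsub>L\<^esub>m\<in>{..<p ^ r}. ?u x t m) =
        (\<Oplus>\<^bsub>L\<^esub>t\<in>{..<s}. (h (reduce f t x) \<otimes>\<^bsub>L\<^esub> \<zeta> [^]\<^bsub>L\<^esub> t) \<otimes>\<^bsub>L\<^esub> ?e x)"
      using reduce_closed[OF f _ x] zeta(1) by (intro L.finsum_cong') auto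
    also have "\<dots> = evaluate f x \<otimes>\<^bsub>L\<^esub> ?e x"
      unfolding evaluate_def using reduce_closed[OF f _ x] zeta(1)
      by (intro L.finsum_ldistr[symmetric]) auto
    finally show "(\<Oplus>\<^bsub>L\<^esub>t\<in>{..<s}. \<Oplus>\<^bsub>L\<^esub>m\<in>{..<p ^ r}. ?u x t m) =
        evaluate f x \<otimes>\<^bsub>L\<^esub> ?e x" .
  qed (use evaluate_closed[OF f] in auto)
  finally show ?thesis .
qed

text \<open>Fourier inversion on D12: summing the components against
  \<open>dihedral_coeff k y\<close> gives \<open>12\<close> times the value of
  \<open>evaluate\<close> at \<open>y\<close>.\<close>

lemma components_zero_iff:
  assumes f: "f \<in> carrier FG"
  shows "(\<forall>k<12. component k f = \<zero>\<^bsub>L\<^esub>) \<longleftrightarrow> (\<forall>x\<in>carrier D. evaluate f x = \<zero>\<^bsub>L\<^esub>)"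
proof (intro iffI ballI allI impI)

  fix k assume "\<forall>x\<in>carrier D. evaluate f x = \<zero>\<^bsub>L\<^esub>"
  then show "component k f = \<zero>\<^bsub>L\<^esub>"
    unfolding component_eq[OF f] by (intro L.add.finprod_one_eqI) simp
next
  fix y assume z: "\<forall>k<12. component k f = \<zero>\<^bsub>L\<^esub>" and y: "y \<in> carrier D"
  let ?i = "\<lambda>a::int. [a] \<cdot>\<^bsub>L\<^esub> \<one>\<^bsub>L\<^esub>"
  let ?v = "\<lambda>x k. evaluate f x \<otimes>\<^bsub>L\<^esub> ?i (dihedral_coeff k y * dihedral_entry k x)"
  note ev = evaluate_closed[OF f]
  have "\<zero>\<^bsub>L\<^esub> = (\<Oplus>\<^bsub>L\<^esub>k\<in>{..<12}. component k f \<otimes>\<^bsub>L\<^esub> ?i (dihedral_coeff k y))"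
    using z by (intro L.add.finprod_one_eqI[symmetric]) simp
  also have "\<dots> = (\<Oplus>\<^bsub>L\<^esub>k\<in>{..<12}. \<Oplus>\<^bsub>L\<^esub>x\<in>carrier D. ?v x k)"
  proof (rule L.finsum_cong')
    fix k :: nat
    have "component k f \<otimes>\<^bsub>L\<^esub> ?i (dihedral_coeff k y) =
        (\<Oplus>\<^bsub>L\<^esub>x\<in>carrier D. (evaluate f x \<otimes>\<^bsub>L\<^esub> ?i (dihedral_entry k x)) \<otimes>\<^bsub>L\<^esub> ?i (dihedral_coeff k y))"
      unfolding component_eq[OF f] using ev finite_D by (intro L.finsum_ldistr) auto
    also have "\<dots> = (\<Oplus>\<^bsub>L\<^esub>x\<in>carrier D. ?v x k)"
      using ev by (intro L.finsum_cong') (auto simp: L.m_assoc L.add_pow_int_one_mult mult.commute)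
    finally show "component k f \<otimes>\<^bsub>L\<^esub> ?i (dihedral_coeff k y) =
      (\<Oplus>\<^bsub>L\<^esub>x\<in>carrier D. ?v x k)" .
  qed (use ev in \<open>auto intro!: L.finsum_closed\<close>)
  also have "\<dots> = (\<Oplus>\<^bsub>L\<^esub>x\<in>carrier D. \<Oplus>\<^bsub>L\<^esub>k\<in>{..<12}. ?v x k)"
    using ev finite_D by (intro L.finsum_swap) auto
  also have "\<dots> = (\<Oplus>\<^bsub>L\<^esub>x\<in>carrier D. if x = y then evaluate f y \<otimes>\<^bsub>L\<^esub> ?i 12 else \<zero>\<^bsub>L\<^esub>)"
  proof (rule L.finsum_cong')
    fix x assume x: "x \<in> carrier D"
    have "(\<Oplus>\<^bsub>L\<^esub>k\<in>{..<12}. ?v x k) =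
        evaluate f x \<otimes>\<^bsub>L\<^esub> (\<Oplus>\<^bsub>L\<^esub>k\<in>{..<12}. ?i (dihedral_coeff k y * dihedral_entry k x))"
      using ev[OF x] by (intro L.finsum_rdistr[symmetric]) auto
    also have "(\<Oplus>\<^bsub>L\<^esub>k\<in>{..<12}. ?i (dihedral_coeff k y * dihedral_entry k x)) = ?i (if x = y then 12 else 0)"
      by (simp only: L.add_pow_int_one_sum[OF finite_lessThan, symmetric] dihedral_inversion[OF y x])
    finally show "(\<Oplus>\<^bsub>L\<^esub>k\<in>{..<12}. ?v x k) =
        (if x = y then evaluate f y \<otimes>\<^bsub>L\<^esub> ?i 12 else \<zero>\<^bsub>L\<^esub>)" using ev[OF x] by simp
  qed (use ev y in auto)
  also have "\<dots> = evaluate f y \<otimes>\<^bsub>L\<^esub> ?i 12" using ev y finite_D by (simp add: L.finsum_delta)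
  finally have "evaluate f y = \<zero>\<^bsub>L\<^esub> \<or> ?i 12 = \<zero>\<^bsub>L\<^esub>" using ev[OF y] by (intro L.integral) auto
  \<comment> \<open>\<open>F\<close> and \<open>L\<close> share the characteristic \<open>p\<close>,
    so \<open>12\<close> is nonzero in both.\<close>
  moreover have "?i 12 \<noteq> \<zero>\<^bsub>L\<^esub>" using twelve_nonzero char_int[of 12] L.char_int[of 12] by simp
  ultimately show "evaluate f y = \<zero>\<^bsub>L\<^esub>" by simp
qed

lemma block_map_eq_iff_components:
  "block_map f = block_map g \<longleftrightarrow> (\<forall>k<12. component k f = component k g)"
proof
  assume eq: "block_map f = block_map g"
  show "\<forall>k<12. component k f = component k g"
  proof (intro allI impI)
    fix k :: nat assume k: "k < 12"
    show "component k f = component k g"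
    proof (cases "k < 4")
      case True
      then show ?thesis using fun_cong[OF arg_cong[OF eq, of fst], of k] by (simp add: block_map_def)
    next
      case False
      \<comment> \<open>Inverts the numbering \<open>4 * Suc i + 2 * a + b\<close> of matrix
        entries.\<close>
      define i a b where "i = k div 4 - 1" and "a = (k div 2) mod 2" and "b = k mod 2"
      have "i < 2" "a < 2" "b < 2" using k by (auto simp: i_def a_def b_def)
      moreover have "k \<in> {4, 5, 6, 7, 8, 9, 10, 11}" using False k by auto
      then have "4 * Suc i + 2 * a + b = k" by (auto simp: i_def a_def b_def)
      ultimately show ?thesis
        using fun_cong[OF fun_cong[OF arg_cong[OF eq, of snd], of i], of "(a, b)"]
        by (simp add: block_map_def del: mult_Suc_right)
    qed
  qed
next
  assume eq: "\<forall>k<12. component k f = component k g"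
  have "4 * Suc i + 2 * a + b < 12" if "i < 2" "a < 2" "b < 2" for i a b :: nat using that by auto
  then show "block_map f = block_map g" using eq
    by (auto simp: block_map_def fun_eq_iff simp del: mult_Suc_right)
qed

lemma block_map_zero: "block_map \<zero>\<^bsub>FG\<^esub> = zero_block L"
proof -
  interpret FG: ring FG by (rule ring_FG)
  have z: "\<zero>\<^bsub>FG\<^esub> \<ominus>\<^bsub>FG\<^esub> \<zero>\<^bsub>FG\<^esub> = \<zero>\<^bsub>FG\<^esub>" by simp
  have "component k \<zero>\<^bsub>FG\<^esub> = \<zero>\<^bsub>L\<^esub>" for k
  proof -
    have "component k \<zero>\<^bsub>FG\<^esub> = component k \<zero>\<^bsub>FG\<^esub> \<ominus>\<^bsub>L\<^esub> component k \<zero>\<^bsub>FG\<^esub>"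
      using component_minus[OF FG.zero_closed FG.zero_closed, of k] unfolding z .
    also have "\<dots> = \<zero>\<^bsub>L\<^esub>" using component_closed[OF FG.zero_closed, of k] by simp
    finally show ?thesis .
  qed
  then show ?thesis by (auto simp: block_map_def zero_block_def zero_matrix_def fun_eq_iff)
qed

lemma block_map_eq_iff:
  assumes f: "f \<in> carrier FG" and g: "g \<in> carrier FG"
  shows "block_map f = block_map g \<longleftrightarrow> (\<forall>x\<in>carrier D. evaluate (f \<ominus>\<^bsub>FG\<^esub> g) x = \<zero>\<^bsub>L\<^esub>)"
proof -
  interpret FG: ring FG by (rule ring_FG)
  have fg: "f \<ominus>\<^bsub>FG\<^esub> g \<in> carrier FG" using f g by (rule FG.minus_closed)
  show ?thesis
    unfolding block_map_eq_iff_components components_zero_iff[OF fg, symmetric]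
    using component_closed[OF f] component_closed[OF g] by (simp add: component_minus[OF f g])
qed

end

section \<open>The kernel of the reduction modulo the normal \<open>p\<close>-subgroup\<close>

context dihedral_algebra
begin

lemma reduce_minus:
  assumes f: "f \<in> carrier FG" and g: "g \<in> carrier FG" and tx: "t < s" "x \<in> carrier D"
  shows "reduce (f \<ominus>\<^bsub>FG\<^esub> g) t x = reduce f t x \<ominus> reduce g t x"
proof -
  interpret FG: ring FG by (rule ring_FG)
  have fg: "f \<ominus>\<^bsub>FG\<^esub> g \<in> carrier FG" using f g by (rule FG.minus_closed)
  note mem = in_carrier_G[OF tx(2,1)]
  have "reduce (f \<ominus>\<^bsub>FG\<^esub> g) t x \<oplus> reduce g t x =
      (\<Oplus>m\<in>{..<p ^ r}. (f \<ominus>\<^bsub>FG\<^esub> g) (int (t + s * m), x) \<oplus> g (int (t + s * m), x))"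
    unfolding reduce_def using in_FG[OF fg mem] in_FG[OF g mem]
    by (intro finsum_addf[symmetric]) (auto simp del: of_nat_add of_nat_mult)
  also have "\<dots> = reduce f t x"
    unfolding reduce_def
  proof (rule finsum_cong')
    fix m assume "m \<in> {..<p ^ r}"
    then have m: "m < p ^ r" by simp
    show "(f \<ominus>\<^bsub>FG\<^esub> g) (int (t + s * m), x) \<oplus> g (int (t + s * m), x) = f (int (t + s * m), x)"
      unfolding FG_minus[OF f g mem[OF m]]
      using in_FG[OF f mem[OF m]] in_FG[OF g mem[OF m]] by (simp add: a_minus_def a_assoc l_neg)
  qed (use in_FG[OF f mem] in \<open>auto simp del: of_nat_add of_nat_mult\<close>)
  finally have "reduce f t x = reduce (f \<ominus>\<^bsub>FG\<^esub> g) t x \<oplus> reduce g t x" ..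
  then show ?thesis using reduce_closed[OF fg tx] reduce_closed[OF g tx]
    by (simp add: a_minus_def a_assoc r_neg)
qed

text \<open>The generator \<open>a\<close> of the subgroup of order \<open>p ^ r\<close>. The
  residue matters when \<open>r = 0\<close>: then \<open>s = n\<close>, and \<open>a\<close> has to
  be the neutral element.\<close>

definition p_element :: "int \<times> int \<times> bool" where
  "p_element = (int s mod int n, \<one>\<^bsub>D\<^esub>)"

lemma group_D: "group D"
  by (rule dihedral_group_is_group) simp

lemma p_element_closed: "p_element \<in> carrier G"
  unfolding carrier_G p_element_def using n_pos group.is_monoid[OF group_D] monoid.one_closed by fastforce

lemma p_element_mult: "x \<in> carrier D \<Longrightarrow> p_element \<otimes>\<^bsub>G\<^esub> (i, x) = ((int s + i) mod int n, x)"
  using group.is_monoid[OF group_D] by (simp add: p_element_def monoid.l_one mod_add_left_eq)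

lemma mult_p_element: "x \<in> carrier D \<Longrightarrow> (i, x) \<otimes>\<^bsub>G\<^esub> p_element = ((int s + i) mod int n, x)"
  using group.is_monoid[OF group_D] by (simp add: p_element_def monoid.r_one mod_add_right_eq add.commute)

lemma p_element_pow: "p_element [^]\<^bsub>G\<^esub> (m::nat) = (int (s * m) mod int n, \<one>\<^bsub>D\<^esub>)"
proof (induction m)
  case 0
  show ?case by (simp add: nat_pow_def)
next
  case (Suc m)
  have one: "\<one>\<^bsub>D\<^esub> \<in> carrier D" using group.is_monoid[OF group_D] monoid.one_closed by blast
  have "p_element [^]\<^bsub>G\<^esub> Suc m = (p_element [^]\<^bsub>G\<^esub> m) \<otimes>\<^bsub>G\<^esub> p_element"
    by (rule G.nat_pow_Suc)
  also have "\<dots> = (int (s * Suc m) mod int n, \<one>\<^bsub>D\<^esub>)"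
    unfolding Suc mult_p_element[OF one] by (simp add: mod_simps algebra_simps)
  finally show ?case .
qed

lemma p_element_central: "g \<in> carrier G \<Longrightarrow> p_element \<otimes>\<^bsub>G\<^esub> g = g \<otimes>\<^bsub>G\<^esub> p_element"
  unfolding carrier_G using p_element_mult mult_p_element by (cases g) auto

text \<open>Translation by \<open>a^-1\<close> goes one step back along the coset, cyclically: from
  \<open>m = 0\<close> it wraps around to \<open>p ^ r - 1\<close>.\<close>

lemma inv_p_element_mult:
  assumes x: "x \<in> carrier D" and t: "t < s" and m: "m < p ^ r"
  shows "inv\<^bsub>G\<^esub> p_element \<otimes>\<^bsub>G\<^esub> (int (t + s * m), x) =
    (int (t + s * (if m = 0 then p ^ r - 1 else m - 1)), x)"
proof -
  let ?m = "if m = 0 then p ^ r - 1 else m - 1"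
  have pr: "p ^ r > 0" using p_gt_3 by simp
  have m': "?m < p ^ r" using m pr by auto
  note mem = in_carrier_G[OF x t m] in_carrier_G[OF x t m']
  have lt: "t + s * m < n" using mem(1) unfolding carrier_G by (simp del: of_nat_add of_nat_mult)
  have "(s + (t + s * ?m)) mod n = t + s * m"
  proof (cases "m = 0")
    case True
    obtain c where c: "p ^ r = Suc c" using pr gr0_conv_Suc by blast
    have "s * (p ^ r - 1) + s = n" unfolding n_eq c by simp
    then have e: "s + (t + s * ?m) = t + n" using True by simp
    show ?thesis unfolding e using True lt by simp
  next
    case False
    then have "s + (t + s * ?m) = t + s * m" by (cases m) auto
    then show ?thesis using lt by simp
  qed
  then have "p_element \<otimes>\<^bsub>G\<^esub> (int (t + s * ?m), x) = (int (t + s * m), x)"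
    unfolding p_element_mult[OF x] by (simp only: zmod_int[symmetric] of_nat_add[symmetric])
  then show ?thesis
    using G.inv_solve_left[OF mem(2) p_element_closed mem(1)] by simp
qed

text \<open>With \<open>a\<close> the chosen generator of the cyclic \<open>p\<close>-subgroup, \<open>f = (a - 1) z\<close> where \<open>z\<close> consists of
  the negated partial sums of \<open>f\<close> along the cosets of that subgroup.\<close>

lemma reduce_zero_unipotent:
  assumes f: "f \<in> carrier FG" and red: "\<And>t x. t < s \<Longrightarrow> x \<in> carrier D \<Longrightarrow> reduce f t x = \<zero>"
  shows "(\<one>\<^bsub>FG\<^esub> \<oplus>\<^bsub>FG\<^esub> f) [^]\<^bsub>FG\<^esub> (p ^ r) = \<one>\<^bsub>FG\<^esub>"
proof -
  interpret FG: ring FG by (rule ring_FG)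

  define z where "z = (\<lambda>(i, x)\<in>carrier G. \<ominus> (\<Oplus>m\<in>{..nat i div s}. f (int (nat i mod s + s * m), x)))"
  have pr: "p ^ r > 0" using p_gt_3 by simp
  have fc: "f (int (t + s * m), x) \<in> carrier F" if "x \<in> carrier D" "t < s" "m < p ^ r" for t x m
    using in_FG[OF f in_carrier_G[OF that]] .
  have z_eq: "z (int (t + s * m), x) = \<ominus> (\<Oplus>j\<in>{..m}. f (int (t + s * j), x))"
    if "x \<in> carrier D" "t < s" "m < p ^ r" for t x m
  proof -
    have "(t + s * m) div s = m" "(t + s * m) mod s = t" using that(2) by simp_all
    then show ?thesis
      unfolding z_def using in_carrier_G[OF that] by (simp only: restrict_apply' prod.case nat_int)
  qed
  have zc: "z \<in> carrier FG"
    unfolding carrier_FG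
  proof (rule PiE_I)
    fix g assume "g \<in> carrier G"
    then obtain x t m where g: "g = (int (t + s * m), x)" "x \<in> carrier D" "t < s" "m < p ^ r"
      unfolding carrier_G_image by auto
    show "z g \<in> carrier F"
      unfolding g(1) z_eq[OF g(2-4)] using fc[OF g(2,3)] g(4)
      by (intro a_inv_closed finsum_closed) (auto simp del: of_nat_add of_nat_mult)
  qed (auto simp: z_def)
  let ?a = "delta p_element"
  let ?w = "(?a \<ominus>\<^bsub>FG\<^esub> \<one>\<^bsub>FG\<^esub>) \<otimes>\<^bsub>FG\<^esub> z"
  have ac: "?a \<in> carrier FG" by (rule delta_closed)
  have a1: "?a [^]\<^bsub>FG\<^esub> (p ^ r) = \<one>\<^bsub>FG\<^esub>"
    unfolding delta_pow[OF p_element_closed] p_element_pow one_eq_delta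
    by (simp add: n_eq mult.commute)
  have comm: "?a \<otimes>\<^bsub>FG\<^esub> z = z \<otimes>\<^bsub>FG\<^esub> ?a"
  proof (rule FG_eqI)
    fix g assume g: "g \<in> carrier G"
    have "inv\<^bsub>G\<^esub> p_element \<otimes>\<^bsub>G\<^esub> g = g \<otimes>\<^bsub>G\<^esub> inv\<^bsub>G\<^esub> p_element"
      using p_element_central[OF g] g p_element_closed
      by (metis G.inv_closed G.inv_solve_left G.inv_solve_right G.m_assoc G.m_closed)
    then show "(?a \<otimes>\<^bsub>FG\<^esub> z) g = (z \<otimes>\<^bsub>FG\<^esub> ?a) g"
      by (simp only: delta_mult[OF p_element_closed zc g] mult_delta[OF p_element_closed zc g])
  qed (use ac zc in auto)
  have "f = ?w"
  proof (rule FG_eqI[OF f])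
    fix g assume gG: "g \<in> carrier G"
    then obtain x t m where g: "g = (int (t + s * m), x)" "x \<in> carrier D" "t < s" "m < p ^ r"
      unfolding carrier_G_image by auto
    let ?S = "\<lambda>m. \<Oplus>j\<in>{..m}. f (int (t + s * j), x)"
    have Sc: "?S m \<in> carrier F" if "m < p ^ r" for m
      using fc[OF g(2,3)] that by (intro finsum_closed) (auto simp del: of_nat_add of_nat_mult)
    \<comment> \<open>At \<open>g\<close>, the product compares \<open>z\<close> at two neighbours
      of a coset, so negated partial sums telescope to the single coefficient
      \<open>f g\<close>.\<close>
    have "?w = ?a \<otimes>\<^bsub>FG\<^esub> z \<ominus>\<^bsub>FG\<^esub> z"
      using ac zc by (simp add: a_minus_def FG.l_distr FG.l_minus)
    then have "?w g = z (inv\<^bsub>G\<^esub> p_element \<otimes>\<^bsub>G\<^esub> g) \<ominus> z g"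
      using FG_minus[OF FG.m_closed[OF ac zc] zc gG] delta_mult[OF p_element_closed zc gG] by simp
    also have "\<dots> = f g"
    proof (cases m)
      \<comment> \<open>The wrap-around. The predecessor of \<open>m = 0\<close> carries the sum
        over the whole coset, and that is the reduced coefficient, zero by
        \<open>red\<close>.\<close>
      case 0
      obtain c where c: "p ^ r = Suc c" using pr gr0_conv_Suc by blast
      have "?S (p ^ r - 1) = reduce f t x"
        unfolding reduce_def c by (simp only: diff_Suc_1 lessThan_Suc_atMost)
      then have "z (inv\<^bsub>G\<^esub> p_element \<otimes>\<^bsub>G\<^esub> g) = \<zero>"
        unfolding g(1) inv_p_element_mult[OF g(2-4)] using 0 z_eq[OF g(2,3), of "p ^ r - 1"] pr red[OF g(3,2)]
        by (simp del: of_nat_add of_nat_mult)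
      moreover have "z g = \<ominus> f g" unfolding g(1) z_eq[OF g(2-4)] using 0 fc[OF g(2,3,4)] by simp
      ultimately show ?thesis using in_FG[OF f gG] by (simp add: a_minus_def)
    next
      case (Suc k)
      then have k: "k < p ^ r" using g(4) by simp
      have "z (inv\<^bsub>G\<^esub> p_element \<otimes>\<^bsub>G\<^esub> g) = \<ominus> ?S k"
        unfolding g(1) inv_p_element_mult[OF g(2-4)] using Suc z_eq[OF g(2,3) k]
        by (simp del: of_nat_add of_nat_mult)
      moreover have "?S (Suc k) = f g \<oplus> ?S k"
        using fc[OF g(2,3)] g(4) Suc unfolding g(1)
        by (subst finsum_Suc) (auto simp del: of_nat_add of_nat_mult mult_Suc_right)
      then have "z g = \<ominus> (f g \<oplus> ?S k)" using z_eq[OF g(2-4)] Suc g(1) by simp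
      ultimately show ?thesis using in_FG[OF f gG] Sc[OF k]
        by (simp add: a_minus_def minus_add a_lcomm l_neg)
    qed
    finally show "f g = ?w g" ..
  qed (use ac zc in simp)
  moreover have "[p] \<cdot>\<^bsub>FG\<^esub> y = \<zero>\<^bsub>FG\<^esub>" if "y \<in> carrier FG" for y
    using that by (intro FG_eqI) (auto simp: FG_add_pow FG_simps char_add_pow in_FG FG.add.nat_pow_closed simp del: carrier_DirProd)
  ultimately show ?thesis
    using FG.one_plus_multiple_of_unipotent[OF prime_char _ ac a1 zc comm] by simp
qed

text \<open>The preimage is supported on the exponents below \<open>s\<close>, the representatives
  with \<open>m = 0\<close>.\<close>

lemma reduce_surj:
  assumes w: "w \<in> {..<s} \<times> carrier D \<rightarrow>\<^sub>E carrier F"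
  shows "\<exists>f\<in>carrier FG. (\<lambda>(t, x)\<in>{..<s} \<times> carrier D. reduce f t x) = w"
proof
  define f where "f = (\<lambda>(i, x)\<in>carrier G. if nat i < s then w (nat i, x) else \<zero>)"
  have wc: "w (t, x) \<in> carrier F" if "t < s" "x \<in> carrier D" for t x using w that by auto
  show f: "f \<in> carrier FG"
    unfolding carrier_FG
  proof (rule PiE_I)
    fix g assume "g \<in> carrier G"
    then obtain i x where g: "g = (i, x)" "x \<in> carrier D" unfolding carrier_G by auto
    then show "f g \<in> carrier F" using wc \<open>g \<in> carrier G\<close> by (simp only: f_def restrict_apply' prod.case) auto
  qed (auto simp: f_def)
  have "reduce f t x = w (t, x)" if tx: "t < s" "x \<in> carrier D" for t x
  proof -
    have "reduce f t x = (\<Oplus>m\<in>{..<p ^ r}. if m = 0 then w (t, x) else \<zero>)"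
      unfolding reduce_def
    proof (rule finsum_cong')
      fix m assume "m \<in> {..<p ^ r}"
      then have m: "m < p ^ r" by simp
      have "t + s * m < s \<longleftrightarrow> m = 0" using tx by (cases m) auto
      then show "f (int (t + s * m), x) = (if m = 0 then w (t, x) else \<zero>)"
        using in_carrier_G[OF tx(2,1) m] by (simp only: f_def restrict_apply' prod.case nat_int) simp
    qed (use wc[OF tx] in auto)
    then show ?thesis using wc[OF tx] p_gt_3 by (simp add: finsum_delta)
  qed
  then show "(\<lambda>(t, x)\<in>{..<s} \<times> carrier D. reduce f t x) = w"
    using w by (intro extensionalityI[of _ "{..<s} \<times> carrier D"]) (auto simp: PiE_iff)
qed

lemma finite_FG: "finite (carrier FG)"
  unfolding carrier_FG using finite_G finite_R by (intro finite_PiE) auto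

lemma card_FG: "card (carrier FG) = card (carrier F) ^ (12 * n)"
  unfolding carrier_FG using finite_G
  by (simp only: card_PiE prod_constant carrier_G card_cartesian_product card_D) (simp add: mult.commute)

end

section \<open>The Wedderburn decomposition modulo the radical\<close>

text \<open>Level \<open>1\<close> is kept apart: its field is \<open>F\<close> itself, whose
  element type is independent of that of the fields \<open>L l\<close>. The fields for different
  \<open>l\<close> are not assumed to embed into a common one.\<close>

locale dihedral_decomposition = dihedral_algebra F p n s r
  for F (structure) and p n s r +
  fixes L :: "nat \<Rightarrow> ('e, 'f) ring_scheme" and h :: "nat \<Rightarrow> 'a \<Rightarrow> 'e" and \<zeta> :: "nat \<Rightarrow> nat \<Rightarrow> 'e"
    and q k :: nat and d e :: "nat \<Rightarrow> nat"
  assumes card_F: "card (carrier F) = q" and q_eq: "q = p ^ k"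
    and field_L: "\<And>l. l > 1 \<Longrightarrow> l dvd s \<Longrightarrow> field (L l)"
    and finite_L: "\<And>l. l > 1 \<Longrightarrow> l dvd s \<Longrightarrow> finite (carrier (L l))"
    and hom_L: "\<And>l. l > 1 \<Longrightarrow> l dvd s \<Longrightarrow> ring_hom_cring F (L l) (h l)"
    and card_L: "\<And>l. l > 1 \<Longrightarrow> l dvd s \<Longrightarrow> card (carrier (L l)) = q ^ d l"
    and dvd_card_L: "\<And>l. l > 1 \<Longrightarrow> l dvd s \<Longrightarrow> l dvd card (carrier (L l)) - 1"
    and totient_eq: "\<And>l. l > 1 \<Longrightarrow> l dvd s \<Longrightarrow> d l * e l = totient l"
    and zeta_primitive: "\<And>l j. l > 1 \<Longrightarrow> l dvd s \<Longrightarrow> j < e l \<Longrightarrow> \<zeta> l j \<in> primitive_roots (L l) l"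
    and zeta_cover: "\<And>l x. l > 1 \<Longrightarrow> l dvd s \<Longrightarrow> x \<in> primitive_roots (L l) l \<Longrightarrow>
      \<exists>j<e l. \<exists>i. x = \<zeta> l j [^]\<^bsub>L l\<^esub> (q ^ i)"
begin

abbreviation level_map where "level_map l j \<equiv> dihedral_block.block_map n (L l) (h l) (\<zeta> l j)"

abbreviation levels where "levels \<equiv> {l. l > 1 \<and> l dvd s}"

lemma finite_levels: "finite levels"
  using s_pos by (auto intro: finite_subset[OF _ finite_divisors_nat[of s]])

definition target :: "(((nat \<Rightarrow> 'a) \<times> (nat \<Rightarrow> nat \<times> nat \<Rightarrow> 'a)) \<times>
    (nat \<Rightarrow> nat \<Rightarrow> (nat \<Rightarrow> 'e) \<times> (nat \<Rightarrow> nat \<times> nat \<Rightarrow> 'e))) monoid" where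
  "target = block F \<times>\<times> product_group levels (\<lambda>l. group_power (block (L l)) (e l))"

definition target_zero where
  "target_zero = (zero_block F, \<lambda>l\<in>levels. \<lambda>j\<in>{..<e l}. zero_block (L l))"

definition wedderburn_map where
  "wedderburn_map f = (dihedral_block.block_map n F (\<lambda>x. x) \<one> f,
     \<lambda>l\<in>levels. \<lambda>j\<in>{..<e l}. level_map l j f)"

lemma one_block: "dihedral_block F p n s r F (\<lambda>x. x) \<one>"
proof (intro dihedral_block.intro dihedral_block_axioms.intro)
  show "ring_hom_cring F F (\<lambda>x. x)"
    by (intro ring_hom_cring.intro ring_hom_cring_axioms.intro cring_axioms) (auto simp: ring_hom_def)
qed (auto intro: dihedral_algebra_axioms field_axioms finite_R)

lemma block_at:
  assumes "l > 1" "l dvd s" "j < e l"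
  shows "dihedral_block F p n s r (L l) (h l) (\<zeta> l j)"
proof (intro dihedral_block.intro dihedral_block_axioms.intro)
  note z = primitive_rootsD[OF zeta_primitive[OF assms]]
  show "\<zeta> l j \<in> carrier (L l)" by (rule z(1))
  show "\<zeta> l j [^]\<^bsub>L l\<^esub> s = \<one>\<^bsub>L l\<^esub>" using z(2)[of s] assms(2) by simp
qed (use assms in \<open>auto intro: dihedral_algebra_axioms field_L finite_L hom_L\<close>)

lemma block_at_level: "l \<in> levels \<Longrightarrow> j \<in> {..<e l} \<Longrightarrow> dihedral_block F p n s r (L l) (h l) (\<zeta> l j)"
  using block_at by simp

lemma field_at_level: "l \<in> levels \<Longrightarrow> field (L l)"
  using field_L by simp

lemma ring_at_level: "l \<in> levels \<Longrightarrow> ring (L l)"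
  by (rule field.is_ring[OF field_at_level])

lemma monoid_at_level: "l \<in> levels \<Longrightarrow> monoid (group_power (block (L l)) (e l))"
  by (rule monoid_product_group) (rule monoid_block[OF ring_at_level])

lemma level_map_eqI:
  assumes "\<And>l j. l \<in> levels \<Longrightarrow> j \<in> {..<e l} \<Longrightarrow> f l j = g l j"
  shows "(\<lambda>l\<in>levels. \<lambda>j\<in>{..<e l}. f l j) = (\<lambda>l\<in>levels. \<lambda>j\<in>{..<e l}. g l j)"
  by (rule restrict_ext, rule restrict_ext, rule assms)

lemma monoid_target: "monoid target"
  unfolding target_def
  by (rule DirProd_monoid[OF monoid_block[OF ring_axioms] monoid_product_group]) (rule monoid_at_level)

lemma wedderburn_map_closed:
  assumes "f \<in> carrier FG" shows "wedderburn_map f \<in> carrier target"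
proof -
  have "(\<lambda>j\<in>{..<e l}. level_map l j f) \<in>
      carrier (group_power (block (L l)) (e l))" if "l \<in> levels" for l
    unfolding carrier_product_group[of "{..<e l}"] restrict_PiE_iff
    using dihedral_block.block_map_closed[OF block_at_level[OF that] assms] by blast
  then show ?thesis
    unfolding wedderburn_map_def target_def carrier_DirProd[of "block F"] carrier_product_group[of levels]
    using dihedral_block.block_map_closed[OF one_block assms] by (intro SigmaI) (simp_all only: restrict_PiE_iff, blast)
qed

lemma wedderburn_map_mult:
  assumes f: "f \<in> carrier FG" and g: "g \<in> carrier FG"
  shows "wedderburn_map (f \<otimes>\<^bsub>FG\<^esub> g) = wedderburn_map f \<otimes>\<^bsub>target\<^esub> wedderburn_map g"
proof -
  have "(\<lambda>l\<in>levels. \<lambda>j\<in>{..<e l}. level_map l j (f \<otimes>\<^bsub>FG\<^esub> g)) =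
      (\<lambda>l\<in>levels. \<lambda>j\<in>{..<e l}. level_map l j f \<otimes>\<^bsub>block (L l)\<^esub> level_map l j g)"
    by (rule level_map_eqI) (rule dihedral_block.block_map_mult[OF block_at_level f g])
  also have "\<dots> = (\<lambda>l\<in>levels. (\<lambda>j\<in>{..<e l}. level_map l j f) \<otimes>\<^bsub>group_power (block (L l)) (e l)\<^esub> (\<lambda>j\<in>{..<e l}. level_map l j g))"
    unfolding mult_product_group[of "{..<e l}" for l] by (rule level_map_eqI) simp
  also have "\<dots> = (\<lambda>l\<in>levels. \<lambda>j\<in>{..<e l}. level_map l j f) \<otimes>\<^bsub>product_group levels (\<lambda>l. group_power (block (L l)) (e l))\<^esub>
      (\<lambda>l\<in>levels. \<lambda>j\<in>{..<e l}. level_map l j g)"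
    unfolding mult_product_group[of levels] by (rule restrict_ext) (simp only: restrict_apply')
  finally show ?thesis
    unfolding wedderburn_map_def target_def mult_DirProd dihedral_block.block_map_mult[OF one_block f g] by (simp only:)
qed

lemma wedderburn_map_one: "wedderburn_map \<one>\<^bsub>FG\<^esub> = \<one>\<^bsub>target\<^esub>"
proof -
  have "(\<lambda>l\<in>levels. \<lambda>j\<in>{..<e l}. level_map l j \<one>\<^bsub>FG\<^esub>) =
      (\<lambda>l\<in>levels. \<lambda>j\<in>{..<e l}. \<one>\<^bsub>block (L l)\<^esub>)"
    by (rule level_map_eqI) (rule dihedral_block.block_map_one[OF block_at_level])
  then show ?thesis
    unfolding wedderburn_map_def target_def one_DirProd[of "block F"] dihedral_block.block_map_one[OF one_block]
      one_product_group[of levels] one_product_group[of "{..<e l}" for l] by (simp only:)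
qed

lemma wedderburn_map_zero: "wedderburn_map \<zero>\<^bsub>FG\<^esub> = target_zero"
proof -
  have "(\<lambda>l\<in>levels. \<lambda>j\<in>{..<e l}. level_map l j \<zero>\<^bsub>FG\<^esub>) =
      (\<lambda>l\<in>levels. \<lambda>j\<in>{..<e l}. zero_block (L l))"
    by (rule level_map_eqI) (rule dihedral_block.block_map_zero[OF block_at_level])
  then show ?thesis unfolding wedderburn_map_def target_zero_def dihedral_block.block_map_zero[OF one_block] by simp
qed

lemma idem_regular_target: "idem_regular target target_zero"
  unfolding target_def target_zero_def
  by (rule idem_regular_DirProd[OF idem_regular_block[OF field_axioms]
        idem_regular_product_group[OF idem_regular_product_group]])
    (rule idem_regular_block[OF field_at_level])

lemma evaluate_zero_of_reduce_zero:
  assumes B: "dihedral_block F p n s r K u w"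
    and "\<And>t. t < s \<Longrightarrow> reduce f t x = \<zero>"
  shows "dihedral_block.evaluate F p s r K u w f x = \<zero>\<^bsub>K\<^esub>"
proof -
  interpret B: dihedral_block F p n s r K u w by fact
  show ?thesis unfolding B.evaluate_def using assms(2) B.zeta(1)
    by (intro B.L.add.finprod_one_eqI) simp
qed

text \<open>One direction holds because components depend only on reduced coefficients. For the
  other, fix \<open>x\<close>: the polynomial in \<open>t\<close> of the reduced coefficients
  vanishes at each chosen root, hence by Frobenius at all primitive \<open>l\<close>-th roots. This
  becomes a Ramanujan relation in \<open>F\<close> for every \<open>l\<close> dividing
  \<open>s\<close>, and together these force all coefficients to vanish.\<close>

lemma wedderburn_map_eq_iff:
  assumes f: "f \<in> carrier FG" and g: "g \<in> carrier FG"
  shows "wedderburn_map f = wedderburn_map g \<longleftrightarrow>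
    (\<forall>t<s. \<forall>x\<in>carrier D. reduce (f \<ominus>\<^bsub>FG\<^esub> g) t x = \<zero>)"
proof
  assume red: "\<forall>t<s. \<forall>x\<in>carrier D. reduce (f \<ominus>\<^bsub>FG\<^esub> g) t x = \<zero>"
  \<comment> \<open>The field has fresh type variables, so the fact can be used for \<open>F\<close>
    as well as for \<open>L l\<close>.\<close>
  have "dihedral_block.block_map n K u w f = dihedral_block.block_map n K u w g"
    if B: "dihedral_block F p n s r K u w" for K :: "('x, 'y) ring_scheme" and u w
    unfolding dihedral_block.block_map_eq_iff[OF B f g]
    using evaluate_zero_of_reduce_zero[OF B] red by blast
  note eq = this
  have "(\<lambda>l\<in>levels. \<lambda>j\<in>{..<e l}. level_map l j f) =
      (\<lambda>l\<in>levels. \<lambda>j\<in>{..<e l}. level_map l j g)"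
    by (rule level_map_eqI) (rule eq[OF block_at_level])
  then show "wedderburn_map f = wedderburn_map g"
    unfolding wedderburn_map_def eq[OF one_block] by (simp only:)
next
  interpret FG: ring FG by (rule ring_FG)
  assume eq: "wedderburn_map f = wedderburn_map g"
  let ?c = "\<lambda>x t. reduce (f \<ominus>\<^bsub>FG\<^esub> g) t x"
  have fg: "f \<ominus>\<^bsub>FG\<^esub> g \<in> carrier FG" using f g by (rule FG.minus_closed)
  have c: "?c x t \<in> carrier F" if "x \<in> carrier D" "t < s" for x t
    using reduce_closed[OF fg that(2,1)] .
  have ev1: "dihedral_block.evaluate F p s r F (\<lambda>x. x) \<one> (f \<ominus>\<^bsub>FG\<^esub> g) x = \<zero>" if "x \<in> carrier D" for x
  proof -
    have "fst (wedderburn_map f) = fst (wedderburn_map g)" using eq by (rule arg_cong)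
    then have "dihedral_block.block_map n F (\<lambda>x. x) \<one> f = dihedral_block.block_map n F (\<lambda>x. x) \<one> g" by (simp only: wedderburn_map_def fst_conv)
    then show ?thesis using dihedral_block.block_map_eq_iff[OF one_block f g] that by blast
  qed
  have evl: "dihedral_block.evaluate F p s r (L l) (h l) (\<zeta> l j) (f \<ominus>\<^bsub>FG\<^esub> g) x = \<zero>\<^bsub>L l\<^esub>"
    if l: "l > 1" "l dvd s" "j < e l" and x: "x \<in> carrier D" for l j x
  proof -
    have mem: "l \<in> levels" "j \<in> {..<e l}" using l by simp_all
    have "snd (wedderburn_map f) l j = snd (wedderburn_map g) l j" unfolding eq ..
    then have "level_map l j f = level_map l j g"
      using mem by (simp only: wedderburn_map_def snd_conv restrict_apply')
    then show ?thesis
      using dihedral_block.block_map_eq_iff[OF block_at[OF l] f g] x by blast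
  qed
  show "\<forall>t<s. \<forall>x\<in>carrier D. reduce (f \<ominus>\<^bsub>FG\<^esub> g) t x = \<zero>"
  proof (intro allI impI ballI)
    fix u x assume u: "u < s" and x: "x \<in> carrier D"
    show "?c x u = \<zero>"
    proof (rule ramanujan_vanishing_imp_zero[OF not_p_dvd_s _ u])
      fix l assume l: "l dvd s"
      show "(\<Oplus>t\<in>{..<s}. ?c x t \<otimes> [(ramanujan_sum l (t + (s - u)))] \<cdot> \<one>) = \<zero>"
      proof (cases "l = 1")
        case True
        show ?thesis unfolding True
        proof (rule vanishing_imp_ramanujan[where c = "?c x", OF field_axioms field_axioms finite_R dihedral_block.hom[OF one_block] _ _ c[OF x]])
          fix y assume "y \<in> primitive_roots F 1"
          \<comment> \<open>At level \<open>1\<close> the only root is \<open>\<one>\<close>,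
            covered by the block of \<open>F\<close> with the identity embedding.\<close>
          then have "y = \<one>" unfolding primitive_roots_one by (rule singletonD)
          then show "(\<Oplus>t\<in>{..<s}. ?c x t \<otimes> y [^] t) = \<zero>"
            using ev1[OF x] by (simp only: dihedral_block.evaluate_def[OF one_block])
        qed auto
      next
        case False
        then have l1: "l > 1" using l s_pos by (cases l) auto
        show ?thesis
        proof (rule vanishing_imp_ramanujan[where c = "?c x", OF field_axioms field_L[OF l1 l] finite_L[OF l1 l] hom_L[OF l1 l] dvd_card_L[OF l1 l] _ c[OF x]])
          fix y assume "y \<in> primitive_roots (L l) l"
          then obtain j i where ji: "j < e l" "y = \<zeta> l j [^]\<^bsub>L l\<^esub> (q ^ i)"
            using zeta_cover[OF l1 l] by blast
          interpret B: dihedral_block F p n s r "L l" "h l" "\<zeta> l j" by (rule block_at[OF l1 l ji(1)])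
          show "(\<Oplus>\<^bsub>L l\<^esub>t\<in>{..<s}. h l (?c x t) \<otimes>\<^bsub>L l\<^esub> y [^]\<^bsub>L l\<^esub> t) = \<zero>\<^bsub>L l\<^esub>"
            unfolding ji(2)
            by (rule vanishing_frobenius[where c = "?c x", OF char_field_axioms B.L.char_field_axioms B.hom card_F q_eq B.zeta(1) c[OF x]])
              (use evl[OF l1 l ji(1) x] in \<open>simp_all only: B.evaluate_def\<close>)
        qed (use l1 in simp)
      qed
    qed (rule c[OF x])
  qed
qed

text \<open>The level \<open>l\<close> contributes \<open>12 * d l * e l = 12 * totient l\<close> to
  the exponent, level \<open>1\<close> contributes \<open>12\<close>, and the totients of the
  divisors of \<open>s\<close> add up to \<open>s\<close>.\<close>

lemma card_target: "card (carrier target) = q ^ (12 * s)"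
proof -
  have "card (carrier target) = q ^ 12 * (\<Prod>l\<in>levels. (card (carrier (L l)) ^ 12) ^ e l)"
    unfolding target_def carrier_DirProd[of "block F"] carrier_product_group[of levels] card_cartesian_product
    by (simp only: card_PiE[OF finite_levels] card_group_power[where M = "block (L l)" for l] card_block card_F)
  also have "(\<Prod>l\<in>levels. (card (carrier (L l)) ^ 12) ^ e l) = (\<Prod>l\<in>levels. q ^ (12 * totient l))"
  proof (rule prod.cong)
    fix l assume "l \<in> levels"
    then have l: "card (carrier (L l)) = q ^ d l" "d l * e l = totient l" using card_L totient_eq by auto
    show "(card (carrier (L l)) ^ 12) ^ e l = q ^ (12 * totient l)"
      unfolding l(1) l(2)[symmetric] by (simp add: mult_ac flip: power_mult)
  qed simp
  also have "q ^ 12 * (\<Prod>l\<in>levels. q ^ (12 * totient l)) = q ^ (12 * (\<Sum>l\<in>insert 1 levels. totient l))"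
    using finite_levels by (simp add: power_add power_sum sum_distrib_left)
  also have "insert 1 levels = {l. l dvd s}" using s_pos by (auto intro: Suc_lessI dest: dvd_pos_nat)
  finally show ?thesis by (simp add: totient_divisor_sum)
qed

text \<open>\<open>wedderburn_map\<close> has the same fibres as reduction, which takes all
  \<open>q ^ (12 * s)\<close> possible values. This is also the size of the target, so the image
  fills it.\<close>

lemma wedderburn_map_surj: "wedderburn_map ` carrier FG = carrier target"
proof -
  interpret FG: ring FG by (rule ring_FG)
  let ?red = "\<lambda>f. \<lambda>(t, x)\<in>{..<s} \<times> carrier D. reduce f t x"
  let ?W = "{..<s} \<times> carrier D \<rightarrow>\<^sub>E carrier F"
  have "q > 0" using card_F finite_R zero_closed by (metis card_gt_0_iff empty_iff)
  then have fin: "finite (carrier target)" using card_target by (metis card_gt_0_iff zero_less_power)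
  have "?red ` carrier FG = ?W"
  proof
    show "?W \<subseteq> ?red ` carrier FG" using reduce_surj by blast
    show "?red ` carrier FG \<subseteq> ?W" using reduce_closed by (auto split: if_splits)
  qed
  moreover have "card (wedderburn_map ` carrier FG) = card (?red ` carrier FG)"
  proof (rule card_image_eq_of_same_fibres)
    fix f g assume f: "f \<in> carrier FG" and g: "g \<in> carrier FG"
    have "?red f = ?red g \<longleftrightarrow> (\<forall>t<s. \<forall>x\<in>carrier D. reduce f t x = reduce g t x)"
      by (auto simp: fun_eq_iff)
    also have "\<dots> \<longleftrightarrow> (\<forall>t<s. \<forall>x\<in>carrier D. reduce (f \<ominus>\<^bsub>FG\<^esub> g) t x = \<zero>)"
    proof -
      have "reduce f t x = reduce g t x \<longleftrightarrow> reduce (f \<ominus>\<^bsub>FG\<^esub> g) t x = \<zero>"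
        if "t < s" "x \<in> carrier D" for t x
        unfolding reduce_minus[OF f g that]
        using r_right_minus_eq[OF reduce_closed[OF f that] reduce_closed[OF g that]] by blast
      then show ?thesis by blast
    qed
    finally show "wedderburn_map f = wedderburn_map g \<longleftrightarrow> ?red f = ?red g"
      using wedderburn_map_eq_iff[OF f g] by blast
  qed
  moreover have "card ?W = q ^ (12 * s)"
    using finite_D by (simp add: card_PiE card_cartesian_product card_D card_F mult.commute)
  ultimately have "card (wedderburn_map ` carrier FG) = card (carrier target)" by (simp only: card_target)
  then show ?thesis using fin wedderburn_map_closed by (intro card_subset_eq) auto
qed

sublocale radical: radical_map FG target wedderburn_map target_zero "p ^ r"
proof (intro radical_map.intro radical_map_axioms.intro ring_FG monoid_target idem_regular_target
    finite_FG wedderburn_map_surj wedderburn_map_one)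
  interpret FG: ring FG by (rule ring_FG)
  show "wedderburn_map \<in> hom FG target"
    by (intro homI wedderburn_map_closed wedderburn_map_mult)
  show "0 < p ^ r" using p_gt_3 by simp
  fix f assume f: "f \<in> carrier FG"
  \<comment> \<open>Comparing with the image of \<open>\<zero>\<close> turns the fibre criterion
    into a description of the kernel: all reduced coefficients vanish.\<close>
  have f0: "f \<ominus>\<^bsub>FG\<^esub> \<zero>\<^bsub>FG\<^esub> = f" using f by (simp add: a_minus_def)
  show "wedderburn_map f = wedderburn_map g \<longleftrightarrow> wedderburn_map (f \<ominus>\<^bsub>FG\<^esub> g) = target_zero"
    if g: "g \<in> carrier FG" for g
  proof -
    have fg: "f \<ominus>\<^bsub>FG\<^esub> g \<in> carrier FG" using f g by (rule FG.minus_closed)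
    have "(f \<ominus>\<^bsub>FG\<^esub> g) \<ominus>\<^bsub>FG\<^esub> \<zero>\<^bsub>FG\<^esub> = f \<ominus>\<^bsub>FG\<^esub> g" using fg by (simp add: a_minus_def)
    then show ?thesis
      unfolding wedderburn_map_zero[symmetric] wedderburn_map_eq_iff[OF f g]
        wedderburn_map_eq_iff[OF fg FG.zero_closed] by (simp only:)
  qed
  assume "wedderburn_map f = target_zero"
  then have "\<forall>t<s. \<forall>x\<in>carrier D. reduce f t x = \<zero>"
    unfolding wedderburn_map_zero[symmetric] wedderburn_map_eq_iff[OF f FG.zero_closed] f0 .
  then show "(\<one>\<^bsub>FG\<^esub> \<oplus>\<^bsub>FG\<^esub> f) [^]\<^bsub>FG\<^esub> p ^ r = \<one>\<^bsub>FG\<^esub>"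
    using reduce_zero_unipotent[OF f] by blast
qed

section \<open>The group \<open>V\<close>: quotient, exponent and order\<close>

abbreviation V where "V \<equiv> (\<lambda>j. \<one>\<^bsub>FG\<^esub> \<oplus>\<^bsub>FG\<^esub> j) ` jacobson_radical FG"

lemma units_target_iso:
  "units_of target \<cong>
    group_power (integer_mod_group (q - 1)) 4 \<times>\<times> group_power (GL 2 F) 2 \<times>\<times>
      product_group levels (\<lambda>l. group_power
        (group_power (integer_mod_group (q ^ d l - 1)) 4 \<times>\<times> group_power (GL 2 (L l)) 2) (e l))"
proof -
  let ?T = "\<lambda>l. group_power (integer_mod_group (q ^ d l - 1)) 4 \<times>\<times> group_power (GL 2 (L l)) 2"
  have GL: "group (GL 2 R)" if "ring R" for R :: "('x, 'y) ring_scheme"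
    unfolding GL_def by (rule monoid.units_group[OF ring.monoid_matrix_monoid[OF that]])
  have u1: "units_of target =
      units_of (block F) \<times>\<times> units_of (product_group levels (\<lambda>l. group_power (block (L l)) (e l)))"
    unfolding target_def
    by (rule units_of_DirProd[OF monoid_block[OF ring_axioms] monoid_product_group]) (rule monoid_at_level)
  have u2: "units_of (product_group levels (\<lambda>l. group_power (block (L l)) (e l))) =
      product_group levels (\<lambda>l. units_of (group_power (block (L l)) (e l)))"
    by (rule units_of_product_group) (rule monoid_at_level)
  have iso: "units_of (block F) \<times>\<times> product_group levels (\<lambda>l. units_of (group_power (block (L l)) (e l))) \<cong>
     (group_power (integer_mod_group (q - 1)) 4 \<times>\<times> group_power (GL 2 F) 2) \<times>\<times>
      product_group levels (\<lambda>l. group_power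
        (?T l) (e l))"
  proof (rule group.DirProd_iso_trans)
    show "group (units_of (block F))" by (rule monoid.units_group[OF monoid_block[OF ring_axioms]])
    show "units_of (block F) \<cong> group_power (integer_mod_group (q - 1)) 4 \<times>\<times> group_power (GL 2 F) 2"
      using block_units_iso[OF field_axioms finite_R] by (simp only: card_F)
    show "product_group levels (\<lambda>l. units_of (group_power (block (L l)) (e l))) \<cong>
      product_group levels (\<lambda>l. group_power
        (?T l) (e l))"
    proof (rule iso_product_groupI)
      fix l assume l: "l \<in> levels"
      have gb: "group (units_of (block (L l)))" by (rule monoid.units_group[OF monoid_block[OF ring_at_level[OF l]]])
      have gt: "group (?T l)"
        by (intro DirProd_group product_group GL[OF ring_at_level[OF l]] group_integer_mod_group)
      show "group (units_of (group_power (block (L l)) (e l)))" by (rule monoid.units_group[OF monoid_at_level[OF l]])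
      show "group (group_power (?T l) (e l))"
        by (rule product_group) (rule gt)
      have "units_of (block (L l)) \<cong> ?T l"
      proof -
        have "finite (carrier (L l))" "card (carrier (L l)) = q ^ d l" using l finite_L card_L by auto
        then show ?thesis using block_units_iso[OF field_at_level[OF l]] by (simp only:)
      qed
      then have "group_power (units_of (block (L l))) (e l) \<cong>
          group_power (?T l) (e l)"
        by (intro iso_product_groupI gb gt)
      moreover have "units_of (group_power (block (L l)) (e l)) = group_power (units_of (block (L l))) (e l)"
        by (rule units_of_product_group) (rule monoid_block[OF ring_at_level[OF l]])
      ultimately show "units_of (group_power (block (L l)) (e l)) \<cong>
          group_power (?T l) (e l)"
        by simp
    qed
  qed
  show ?thesis unfolding u1 u2 by (rule iso_trans[OF iso DirProd_assoc_iso])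
qed

lemma quotient_iso:
  "V \<lhd> units_of FG"
  "units_of FG Mod V \<cong>
    group_power (integer_mod_group (q - 1)) 4 \<times>\<times> group_power (GL 2 F) 2 \<times>\<times>
      product_group levels (\<lambda>l. group_power
        (group_power (integer_mod_group (q ^ d l - 1)) 4 \<times>\<times> group_power (GL 2 (L l)) 2) (e l))"
  by (rule radical.units_quotient(1), rule iso_trans[OF radical.units_quotient(2) units_target_iso])

lemma V_eq: "V = {f \<in> carrier FG. wedderburn_map f = \<one>\<^bsub>target\<^esub>}"
  by (rule radical.one_plus_radical)

text \<open>\<open>a\<close> and the neutral element lie in the same coset of the
  \<open>p\<close>-subgroup and hence have the same reduction. This supplies the element that bounds
  the exponent from below.\<close>

lemma p_element_in_V: "delta p_element \<in> V"
proof -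
  let ?c = "\<lambda>t x. if t = 0 \<and> x = \<one>\<^bsub>D\<^esub> then \<one> else \<zero>"
  have "reduce (delta p_element) t x = reduce \<one>\<^bsub>FG\<^esub> t x" if tx: "t < s" "x \<in> carrier D" for t x
  proof -
    have pr: "p ^ r > 0" using p_gt_3 by simp
    \<comment> \<open>Computed for an arbitrary power of \<open>a\<close>; only
      \<open>b = 1\<close>, the element \<open>a\<close>, and \<open>b = 0\<close>, the neutral
      element, are compared.\<close>
    have red: "reduce (delta (int (s * b) mod int n, \<one>\<^bsub>D\<^esub>)) t x = ?c t x" for b
    proof -
      \<comment> \<open>The position of \<open>a^b\<close> in its coset. For \<open>r = 0\<close>
        the value \<open>b = 1\<close> wraps to \<open>0\<close>.\<close>
      define m0 where "m0 = b mod p ^ r"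
      have "s * b mod n = s * m0"
        unfolding n_eq m0_def mult.commute[of "p ^ r" s] by (rule mult_mod_right[symmetric])
      then have b: "int (s * b) mod int n = int (0 + s * m0)"
        by (simp only: zmod_int[symmetric] add_0)
      have m0: "m0 < p ^ r" using pr by (simp add: m0_def)
      have eq: "(int (t + s * m), x) = (int (0 + s * m0), \<one>\<^bsub>D\<^esub>) \<longleftrightarrow> m = m0 \<and> t = 0 \<and> x = \<one>\<^bsub>D\<^esub>" for m
      proof
        assume a: "(int (t + s * m), x) = (int (0 + s * m0), \<one>\<^bsub>D\<^esub>)"
        then have "t + s * m = 0 + s * m0" by (simp only: prod.inject of_nat_eq_iff)
        moreover from this have "(t + s * m) mod s = (0 + s * m0) mod s" by (rule arg_cong)
        then have "t = 0" using tx(1) by simp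
        ultimately show "m = m0 \<and> t = 0 \<and> x = \<one>\<^bsub>D\<^esub>" using a s_pos by simp
      qed simp
      have "reduce (delta (int (s * b) mod int n, \<one>\<^bsub>D\<^esub>)) t x =
          (\<Oplus>m\<in>{..<p ^ r}. if m = m0 then ?c t x else \<zero>)"
        unfolding reduce_def b
      proof (rule finsum_cong')
        fix m assume "m \<in> {..<p ^ r}"
        then have "(int (t + s * m), x) \<in> carrier G" using in_carrier_G[OF tx(2,1)] by blast
        then have "delta (int (0 + s * m0), \<one>\<^bsub>D\<^esub>) (int (t + s * m), x) =
            (if m = m0 \<and> t = 0 \<and> x = \<one>\<^bsub>D\<^esub> then \<one> else \<zero>)"
          by (simp only: delta_def restrict_apply' eq)
        also have "\<dots> = (if m = m0 then ?c t x else \<zero>)"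
          by (cases "m = m0") (simp_all only: simp_thms if_False if_True)
        finally show "delta (int (0 + s * m0), \<one>\<^bsub>D\<^esub>) (int (t + s * m), x) =
            (if m = m0 then ?c t x else \<zero>)" .
      qed auto
      then show ?thesis using m0 by (simp add: finsum_delta)
    qed
    show ?thesis using red[of 1] red[of 0] by (simp add: p_element_def one_eq_delta)
  qed
  then have "wedderburn_map (delta p_element) = wedderburn_map \<one>\<^bsub>FG\<^esub>"
    unfolding wedderburn_map_eq_iff[OF delta_closed FG_closed(3)]
    using reduce_closed[OF delta_closed] reduce_closed[OF FG_closed(3)]
    by (simp add: reduce_minus[OF delta_closed FG_closed(3)])
  then show ?thesis unfolding V_eq wedderburn_map_one using delta_closed by simp
qed

text \<open>The upper bound is the unipotency of \<open>1 + J\<close>. For the lower one,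
  \<open>a^m = 1\<close> means that \<open>n = p^r s\<close> divides \<open>s m\<close>, so
  \<open>p^r\<close> divides \<open>m\<close>.\<close>

lemma exponent_V: "has_exponent ((units_of FG)\<lparr>carrier := V\<rparr>) (p ^ r)"
proof -
  let ?V = "(units_of FG)\<lparr>carrier := V\<rparr>"
  have pw: "x [^]\<^bsub>?V\<^esub> m = x [^]\<^bsub>FG\<^esub> m" for x and m :: nat
    by (simp add: nat_pow_def units_of_def)
  have car: "carrier ((units_of R)\<lparr>carrier := W\<rparr>) = W" for R :: "(int \<times> int \<times> bool \<Rightarrow> 'a) ring" and W
    by simp
  show ?thesis
    unfolding has_exponent_def
  proof (intro conjI allI impI ballI)
    show "0 < p ^ r" using p_gt_3 by simp
    fix x assume "x \<in> carrier ?V"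
    then obtain j where "j \<in> radical.ker" "x = \<one>\<^bsub>FG\<^esub> \<oplus>\<^bsub>FG\<^esub> j"
      by (auto simp: radical.jacobson_radical_eq)
    then show "x [^]\<^bsub>?V\<^esub> (p ^ r) = \<one>\<^bsub>?V\<^esub>"
      using radical.unipotent[of j] unfolding pw by (simp add: units_of_def)
  next
    fix m :: nat
    assume m: "0 < m \<and> (\<forall>x\<in>carrier ?V.
      x [^]\<^bsub>?V\<^esub> m = \<one>\<^bsub>?V\<^esub>)"
    have "delta p_element \<in> carrier ?V"
      unfolding car by (rule p_element_in_V)
    then have "delta p_element [^]\<^bsub>?V\<^esub> m = \<one>\<^bsub>?V\<^esub>"
      by (rule bspec[OF conjunct2[OF m]])
    then have "delta p_element [^]\<^bsub>FG\<^esub> m = \<one>\<^bsub>FG\<^esub>"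
      unfolding pw by (simp add: units_of_def)
    then have "delta (p_element [^]\<^bsub>G\<^esub> m) = delta \<one>\<^bsub>G\<^esub>"
      by (simp only: delta_pow[OF p_element_closed] one_eq_delta)
    then have "p_element [^]\<^bsub>G\<^esub> m = \<one>\<^bsub>G\<^esub>"
      using delta_eq_iff[OF one_not_zero G.nat_pow_closed[OF p_element_closed] G.one_closed] by blast
    then have "int (s * m) mod int n = 0" unfolding p_element_pow by simp
    then have "n dvd s * m" by (metis dvd_eq_mod_eq_0 int_dvd_int_iff)
    then have "p ^ r dvd m" using s_pos by (simp add: n_eq mult.commute[of "p ^ r"])
    then show "p ^ r \<le> m" using m by (auto dest: dvd_imp_le)
  qed
qed

text \<open>By \<open>card_carrier\<close>, \<open>V\<close> accounts for the factor between
  \<open>q ^ (12 * n)\<close> and \<open>q ^ (12 * s)\<close>, and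
  \<open>n - s = s (p^r - 1)\<close>.\<close>

lemma order_V: "order ((units_of FG)\<lparr>carrier := V\<rparr>) = p ^ (12 * s * k * (p ^ r - 1))"
proof -
  have "card V * q ^ (12 * s) = q ^ (12 * n)"
    using radical.card_carrier card_FG card_target card_F by simp
  also have "12 * n = 12 * s * (p ^ r - 1) + 12 * s"
  proof -
    obtain c where "p ^ r = Suc c" using p_gt_3 gr0_conv_Suc[of "p ^ r"] by auto
    then show ?thesis unfolding n_eq by simp
  qed
  also have "q ^ (12 * s * (p ^ r - 1) + 12 * s) = q ^ (12 * s * (p ^ r - 1)) * q ^ (12 * s)"
    by (rule power_add)
  finally have "card V = q ^ (12 * s * (p ^ r - 1))"
    using p_gt_3 by (simp add: q_eq)
  then show ?thesis by (simp add: order_def q_eq mult_ac flip: power_mult)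
qed

end

theorem theorem3p4:
  fixes F :: "'a ring" and K :: "nat \<Rightarrow> 'b ring"
    and G :: "(int \<times> int \<times> bool) monoid" and FG :: "(int \<times> int \<times> bool \<Rightarrow> 'a) ring"
    and V :: "(int \<times> int \<times> bool \<Rightarrow> 'a) set"
    and p k q n r s :: nat and d e :: "nat \<Rightarrow> nat"
  assumes "field F" and "finite (carrier F)"
    and "ring_characteristic F = p" and "p > 3"
    and "q = p ^ k" and "card (carrier F) = q"
    and "n = p ^ r * s" and "coprime p s"
    and "G = integer_mod_group n \<times>\<times> dihedral_group 6"
    and "FG = group_algebra F G"
    and "V = (\<lambda>j. \<one>\<^bsub>FG\<^esub> \<oplus>\<^bsub>FG\<^esub> j) ` jacobson_radical FG"
    and "\<And>l. d l = ord l q" and "\<And>l. e l = totient l div d l"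
    and "\<And>l. l > 1 \<Longrightarrow> l dvd s \<Longrightarrow> extension_of_degree F (d l) (K (d l))"
  shows "V \<lhd> units_of FG \<and>
    units_of FG Mod V \<cong>
      group_power (integer_mod_group (q - 1)) 4 \<times>\<times> group_power (GL 2 F) 2 \<times>\<times>
      product_group {l. l > 1 \<and> l dvd s} (\<lambda>l.
        group_power
          (group_power (integer_mod_group (q ^ d l - 1)) 4 \<times>\<times> group_power (GL 2 (K (d l))) 2)
          (e l)) \<and>
    has_exponent ((units_of FG)\<lparr>carrier := V\<rparr>) (p ^ r) \<and>
    order ((units_of FG)\<lparr>carrier := V\<rparr>) = p ^ (12 * s * k * (p ^ r - 1))"
proof -
  note q = assms(5,6) and de = assms(12,13) and ext = assms(14)
  have alg: "dihedral_algebra F p n s r"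
    using assms(1-4,7,8)
    by (simp add: dihedral_algebra_def dihedral_algebra_axioms_def char_field_def char_field_axioms_def)
  have cop: "coprime l q" if "l dvd s" for l
    using assms(8) that unfolding q(1)
    by (metis coprime_commute coprime_divisors coprime_power_left_iff dvd_refl)
  have ex: "\<exists>h. field (K (d l)) \<and> ring_hom_cring F (K (d l)) h \<and> finite (carrier (K (d l))) \<and>
      card (carrier (K (d l))) = q ^ d l" if "l > 1" "l dvd s" for l
  proof (rule extension_of_degreeD[OF assms(1,2) ext[OF that]])
    fix h assume "field (K (d l))" "ring_hom_cring F (K (d l)) h" "finite (carrier (K (d l)))"
      "card (carrier (K (d l))) = card (carrier F) ^ d l"
    then show ?thesis unfolding q(2) by blast
  qed
  \<comment> \<open>\<open>extension_of_degree\<close> only asserts that an embedding exists; any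
    choice will do.\<close>
  define h where "h = (\<lambda>l. SOME h. ring_hom_cring F (K (d l)) h)"
  have h: "field (K (d l))" "ring_hom_cring F (K (d l)) (h l)" "finite (carrier (K (d l)))"
      "card (carrier (K (d l))) = q ^ d l" if l: "l > 1" "l dvd s" for l
  proof -
    obtain u where u: "field (K (d l))" "ring_hom_cring F (K (d l)) u" "finite (carrier (K (d l)))"
      "card (carrier (K (d l))) = q ^ d l" using ex[OF l] by blast
    then show "field (K (d l))" "finite (carrier (K (d l)))" "card (carrier (K (d l))) = q ^ d l" by blast+
    show "ring_hom_cring F (K (d l)) (h l)" unfolding h_def by (rule someI[of "ring_hom_cring F (K (d l))" u]) (rule u(2))
  qed
  have dvd: "l dvd card (carrier (K (d l))) - 1" if "l > 1" "l dvd s" for l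
  proof -
    \<comment> \<open>\<open>l\<close> divides \<open>q ^ d l - 1\<close> by the definition of the
      order, so the extension contains all \<open>l\<close>-th roots of unity.\<close>
    have "[q ^ d l = 1] (mod l)" unfolding de(1) by (rule Pocklington.ord)
    then show ?thesis unfolding h(4)[OF that] by (rule cong_to_1_nat)
  qed
  have tot: "d l * e l = totient l" if "l dvd s" for l
    unfolding de by (rule dvd_mult_div_cancel[OF order_divides_totient[OF cop[OF that]]])
  \<comment> \<open>Bundles both properties of a system of orbit representatives, so that a single
    choice gives roots satisfying both.\<close>
  define Z where "Z = (\<lambda>l z. (\<forall>j<e l. z j \<in> primitive_roots (K (d l)) l) \<and>
      (\<forall>x\<in>primitive_roots (K (d l)) l. \<exists>j<e l. \<exists>i. x = z j [^]\<^bsub>K (d l)\<^esub> (q ^ i)))"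
  define \<zeta> where "\<zeta> = (\<lambda>l. SOME z. Z l z)"
  have Z: "Z l (\<zeta> l)" if l: "l > 1" "l dvd s" for l
  proof -
    have "l > 0" using l(1) by simp
    from field.frobenius_orbit_representatives[OF h(1)[OF l] h(3)[OF l] dvd[OF l] this cop[OF l(2)]]
    have "\<exists>z. Z l z" unfolding Z_def de .
    then show ?thesis unfolding \<zeta>_def by (rule someI_ex)
  qed
  have \<zeta>: "j < e l \<Longrightarrow> \<zeta> l j \<in> primitive_roots (K (d l)) l"
      "x \<in> primitive_roots (K (d l)) l \<Longrightarrow> \<exists>j<e l. \<exists>i. x = \<zeta> l j [^]\<^bsub>K (d l)\<^esub> (q ^ i)"
    if "l > 1" "l dvd s" for l j x
    using Z[OF that] unfolding Z_def by blast+
  interpret dihedral_decomposition F p n s r "\<lambda>l. K (d l)" h \<zeta> q k d e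
    by (intro dihedral_decomposition.intro dihedral_decomposition_axioms.intro alg q h dvd tot \<zeta>)
  show ?thesis
    \<comment> \<open>The order matters: the equation for \<open>V\<close> mentions
      \<open>FG\<close>, and that for \<open>FG\<close> mentions \<open>G\<close>.\<close>
    unfolding assms(11) unfolding assms(10) unfolding assms(9)
    using quotient_iso exponent_V order_V by blast
qed

end
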